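(* Assume that: (1) there are $A>0$ and $\gamma\in(0,1)$ with $\phi_R(n)\le A\gamma^n$ for all $n\in\mathbb N$; (2) there are $A_1>0$ and $n_0\in\mathbb N$ such that $\|P_{j,n_0}(\cdot|x)-P_{j,n_0}(\cdot|y)\|_{TV}\le A_1\,\omega(d_{j+n_0}(x,y))$ for all $j\ge 0$ and $x,y\in\mathcal X_{j+n_0}$; (3) there is $m_0\in\mathbb N$ such that for all sufficiently small $r>0$, $\inf\{P_{j,m_0}(\tilde B_{j,m_0}(b,r)|x): j\ge 0,\ b\in\mathcal X_{j,m_0},\ x\in\mathcal X_{j+m_0}\}>0$. Let $f_j:\mathcal X_{j,\infty}\to\mathbb R$ be measurable with $\sup_j\|f_j\|_{j,\omega}<\infty$. Let $R$ be the set of all real $h\neq 0$ for which $(f_j)$ is reducible to an $h\mathbb Z$-valued sequence, and let $\mathsf H=\{1/r: r\in R\}\cup\{0\}$. If $(f_j)$ is reducible and $\sigma_n\to\infty$, then $\mathsf H=h_0\mathbb Z$ for some $h_0>0$. As a consequence, the number $r_0=1/h_0$ is the largest positive number such that $(f_j)$ is reducible to an $r_0\mathbb Z$-valued sequence. Therefore, $(f_j)$ can be written in the form $f_j=\kappa_j(f_j)+H_j+hZ_j$ as in the definition of reducibility with an irreducible sequence $(Z_j)$ of $\mathbb Z$-valued functions.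
   Context: $(\mathcal X_j,d_j)$, $j\ge 0$, are metric spaces of diameter at most $1$, and $(X_j)_{j\ge 0}$ is a Markov chain with $X_j$ taking values in $\mathcal X_j$. $\mathcal F_{u,v}$ is the $\sigma$-algebra generated by $X_s$, for finite $s$ with $u\le s\le v$, and $$\phi_R(n)=\sup_{k\in\mathbb N}\{|\mathbb P(A|B)-\mathbb P(A)|: A\in\mathcal F_{0,k},\ B\in\mathcal F_{k+n,\infty},\ \mathbb P(B)>0\}.$$ $P_{j,n}(\cdot|x)$ is the law of $(X_j,\dots,X_{j+n-1})$ given $X_{j+n}=x$, and $\|\cdot\|_{TV}$ is the total variation norm. $\omega:[0,1]\to[0,1]$ is a fixed function, continuous at $0$, with $\omega(0)=0$. Write $\mathcal X_{j,n}=\prod_{j\le k<j+n}\mathcal X_k$, $\omega_{j,n}(x,y)=\max_{j\le k<j+n}\omega(d_k(x_k,y_k))$ and $\tilde B_{j,n}(b,r)=\{y\in\mathcal X_{j,n}:\omega_{j,n}(b,y)\le r\}$. $\mathcal X_{j,\infty}=\prod_{k\ge j}\mathcal X_k$; $\kappa_j$ is the law of $(X_j,X_{j+1},\dots)$ on $\mathcal X_{j,\infty}$, and $\kappa_j(g)=\int g\,d\kappa_j$. Fix $a\in(0,1)$ and set, for $x,y\in\mathcal X_{j,\infty}$, $\omega_j(x,y)=2A_1\sup_{n\ge 0}a^n\omega(d_{j+n}(x_{j+n},y_{j+n}))$, with $A_1$ the constant in assumption (2). For $g:\mathcal X_{j,\infty}\to\mathbb R$ let $v_{j,\omega}(g)=\sup_{x\ne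 y}|g(x)-g(y)|/\omega_j(x,y)$ and $\|g\|_{j,\omega}=\|g\|_{L^\infty(\kappa_j)}+v_{j,\omega}(g)$. For a sequence of functions $H_j:\mathcal X_{j,\infty}\to\mathbb R$ write $S_nH=\sum_{j=0}^{n-1}H_j(X_j,X_{j+1},\dots)$. Also $\sigma_n=\|S_nf-\mathbb E[S_nf]\|_{L^2}$. Reducibility: $(f_j)$ is reducible to an $h\mathbb Z$-valued sequence ($h\neq0$) if there are functions $H_j:\mathcal X_{j,\infty}\to\mathbb R$ and $Z_j:\mathcal X_{j,\infty}\to\mathbb Z$ with $\sup_j\|H_j\|_{j,\omega}<\infty$, $(S_nH)_{n\ge1}$ tight, and $f_j=\kappa_j(f_j)+H_j+hZ_j$ for all $j$. A sequence of real valued functions is reducible if this holds for some $h\neq 0$. A sequence of $\mathbb Z$-valued functions is called reducible (as a $\mathbb Z$-valued sequence) if it admits such a representation with some $h>1$. A sequence is irreducible if it is not reducible (in the $\mathbb Z$-valued sense for $\mathbb Z$-valued sequences). *)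

theory Defs
  imports "HOL-Probability.Probability"
begin

text \<open>
  The state spaces \<open>(E j, d j)\<close> are metric spaces carved out of one ambient type. Points of
  a product over an index set \<open>I\<close> are the extensional functions in \<open>PiE I E\<close>, always indexed by the
  absolute time \<open>k \<in> I\<close>; in particular a point of the product over \<open>k \<ge> j\<close> lives in \<open>PiE {j..} E\<close>.
\<close>

definition metric_borel :: "'a set \<Rightarrow> ('a \<Rightarrow> 'a \<Rightarrow> real) \<Rightarrow> 'a measure" where
  "metric_borel E d = sigma E {U. openin (Metric_space.mtopology E d) U}"

definition path_space ::
  "(nat \<Rightarrow> 'a set) \<Rightarrow> (nat \<Rightarrow> 'a \<Rightarrow> 'a \<Rightarrow> real) \<Rightarrow> nat set \<Rightarrow> (nat \<Rightarrow> 'a) measure" where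
  "path_space E d I = PiM I (\<lambda>k. metric_borel (E k) (d k))"

definition path_seg :: "(nat \<Rightarrow> 'w \<Rightarrow> 'a) \<Rightarrow> nat set \<Rightarrow> 'w \<Rightarrow> nat \<Rightarrow> 'a" where
  "path_seg X I w = (\<lambda>k\<in>I. X k w)"

definition chain_sigma ::
  "'w measure \<Rightarrow> (nat \<Rightarrow> 'a set) \<Rightarrow> (nat \<Rightarrow> 'a \<Rightarrow> 'a \<Rightarrow> real) \<Rightarrow> (nat \<Rightarrow> 'w \<Rightarrow> 'a)
    \<Rightarrow> nat \<Rightarrow> enat \<Rightarrow> 'w measure" where
  "chain_sigma M E d X u v =
    sigma (space M)
      {X s -` A \<inter> space M | s A. u \<le> s \<and> enat s \<le> v \<and> A \<in> sets (metric_borel (E s) (d s))}"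

definition markov_chain ::
  "'w measure \<Rightarrow> (nat \<Rightarrow> 'a set) \<Rightarrow> (nat \<Rightarrow> 'a \<Rightarrow> 'a \<Rightarrow> real) \<Rightarrow> (nat \<Rightarrow> 'w \<Rightarrow> 'a) \<Rightarrow> bool" where
  "markov_chain M E d X \<longleftrightarrow>
    (\<forall>j. X j \<in> measurable M (metric_borel (E j) (d j))) \<and>
    (\<forall>j. \<forall>A \<in> sets (metric_borel (E (Suc j)) (d (Suc j))).
      AE w in M.
        real_cond_exp M (chain_sigma M E d X 0 (enat j)) (\<lambda>w. indicator A (X (Suc j) w)) w =
        real_cond_exp M (chain_sigma M E d X j (enat j)) (\<lambda>w. indicator A (X (Suc j) w)) w)"

text \<open>The index \<open>k\<close> ranges over the positive integers; the times \<open>j\<close> of the chain start at \<open>0\<close>.\<close>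

definition phi_R ::
  "'w measure \<Rightarrow> (nat \<Rightarrow> 'a set) \<Rightarrow> (nat \<Rightarrow> 'a \<Rightarrow> 'a \<Rightarrow> real) \<Rightarrow> (nat \<Rightarrow> 'w \<Rightarrow> 'a) \<Rightarrow> nat \<Rightarrow> real"
  where
  "phi_R M E d X n =
    Sup {\<bar>measure M (A \<inter> B) / measure M B - measure M A\<bar> | A B k.
      1 \<le> k \<and> A \<in> sets (chain_sigma M E d X 0 (enat k)) \<and>
      B \<in> sets (chain_sigma M E d X (k + n) \<infinity>) \<and> 0 < measure M B}"

text \<open>
  \<open>K\<close> is a regular version of the conditional law of \<open>(X j, \<dots>, X (j + n - 1))\<close> given \<open>X (j + n)\<close>.
\<close>

definition cond_law ::
  "'w measure \<Rightarrow> (nat \<Rightarrow> 'a set) \<Rightarrow> (nat \<Rightarrow> 'a \<Rightarrow> 'a \<Rightarrow> real) \<Rightarrow> (nat \<Rightarrow> 'w \<Rightarrow> 'a)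
    \<Rightarrow> nat \<Rightarrow> nat \<Rightarrow> ('a \<Rightarrow> (nat \<Rightarrow> 'a) measure) \<Rightarrow> bool" where
  "cond_law M E d X j n K \<longleftrightarrow>
    K \<in> measurable (metric_borel (E (j + n)) (d (j + n)))
          (prob_algebra (path_space E d {j..<j + n})) \<and>
    (\<forall>A \<in> sets (path_space E d {j..<j + n}). \<forall>B \<in> sets (metric_borel (E (j + n)) (d (j + n))).
      measure M {w \<in> space M. path_seg X {j..<j + n} w \<in> A \<and> X (j + n) w \<in> B} =
      (LINT x:B | distr M (metric_borel (E (j + n)) (d (j + n))) (X (j + n)). measure (K x) A))"

text \<open>
  The total variation norm of the signed measure \<open>P - Q\<close>; for probability measures this is twice
  the supremum of \<open>\<bar>P A - Q A\<bar>\<close> over measurable sets \<open>A\<close>.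
\<close>

definition tv_dist :: "'b measure \<Rightarrow> 'b measure \<Rightarrow> real" where
  "tv_dist P Q =
    Sup {(\<Sum>A\<in>\<A>. \<bar>measure P A - measure Q A\<bar>) | \<A>. finite \<A> \<and> \<A> \<subseteq> sets P \<and> disjoint \<A>}"

definition omega_block ::
  "(nat \<Rightarrow> 'a \<Rightarrow> 'a \<Rightarrow> real) \<Rightarrow> (real \<Rightarrow> real) \<Rightarrow> nat \<Rightarrow> nat \<Rightarrow> (nat \<Rightarrow> 'a) \<Rightarrow> (nat \<Rightarrow> 'a) \<Rightarrow> real"
  where
  "omega_block d \<omega> j n x y = Max ((\<lambda>k. \<omega> (d k (x k) (y k))) ` {j..<j + n})"

text \<open>
  Nothing is assumed on \<open>\<omega>\<close> that makes these balls measurable. Since \<^const>\<open>measure\<close> is \<open>0\<close> off the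
  \<open>\<sigma>\<close>-algebra, a strict lower bound on their probability includes their measurability.
\<close>

definition omega_ball ::
  "(nat \<Rightarrow> 'a set) \<Rightarrow> (nat \<Rightarrow> 'a \<Rightarrow> 'a \<Rightarrow> real) \<Rightarrow> (real \<Rightarrow> real) \<Rightarrow> nat \<Rightarrow> nat
    \<Rightarrow> (nat \<Rightarrow> 'a) \<Rightarrow> real \<Rightarrow> (nat \<Rightarrow> 'a) set" where
  "omega_ball E d \<omega> j n b r = {y \<in> PiE {j..<j + n} E. omega_block d \<omega> j n b y \<le> r}"

definition kappa ::
  "'w measure \<Rightarrow> (nat \<Rightarrow> 'a set) \<Rightarrow> (nat \<Rightarrow> 'a \<Rightarrow> 'a \<Rightarrow> real) \<Rightarrow> (nat \<Rightarrow> 'w \<Rightarrow> 'a)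
    \<Rightarrow> nat \<Rightarrow> (nat \<Rightarrow> 'a) measure" where
  "kappa M E d X j = distr M (path_space E d {j..}) (path_seg X {j..})"

definition omega_dist ::
  "(nat \<Rightarrow> 'a \<Rightarrow> 'a \<Rightarrow> real) \<Rightarrow> (real \<Rightarrow> real) \<Rightarrow> real \<Rightarrow> real \<Rightarrow> nat
    \<Rightarrow> (nat \<Rightarrow> 'a) \<Rightarrow> (nat \<Rightarrow> 'a) \<Rightarrow> real" where
  "omega_dist d \<omega> a A1 j x y =
    2 * A1 * (SUP n. a ^ n * \<omega> (d (j + n) (x (j + n)) (y (j + n))))"

text \<open>
  The division is the one of \<^typ>\<open>ennreal\<close>: where \<open>omega_dist\<close> vanishes at distinct points, the
  quotient is \<open>\<infinity>\<close> if \<open>g x \<noteq> g y\<close> and \<open>0\<close> otherwise.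
\<close>

definition omega_var ::
  "(nat \<Rightarrow> 'a set) \<Rightarrow> (nat \<Rightarrow> 'a \<Rightarrow> 'a \<Rightarrow> real) \<Rightarrow> (real \<Rightarrow> real) \<Rightarrow> real \<Rightarrow> real \<Rightarrow> nat
    \<Rightarrow> ((nat \<Rightarrow> 'a) \<Rightarrow> real) \<Rightarrow> ennreal" where
  "omega_var E d \<omega> a A1 j g =
    Sup {ennreal \<bar>g x - g y\<bar> / ennreal (omega_dist d \<omega> a A1 j x y) | x y.
      x \<in> PiE {j..} E \<and> y \<in> PiE {j..} E \<and> x \<noteq> y}"

definition omega_norm ::
  "'w measure \<Rightarrow> (nat \<Rightarrow> 'a set) \<Rightarrow> (nat \<Rightarrow> 'a \<Rightarrow> 'a \<Rightarrow> real) \<Rightarrow> (nat \<Rightarrow> 'w \<Rightarrow> 'a)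
    \<Rightarrow> (real \<Rightarrow> real) \<Rightarrow> real \<Rightarrow> real \<Rightarrow> nat \<Rightarrow> ((nat \<Rightarrow> 'a) \<Rightarrow> real) \<Rightarrow> ennreal" where
  "omega_norm M E d X \<omega> a A1 j g =
    esssup (kappa M E d X j) (\<lambda>x. ennreal \<bar>g x\<bar>) + omega_var E d \<omega> a A1 j g"

definition birkhoff_sum ::
  "(nat \<Rightarrow> 'w \<Rightarrow> 'a) \<Rightarrow> (nat \<Rightarrow> (nat \<Rightarrow> 'a) \<Rightarrow> real) \<Rightarrow> nat \<Rightarrow> 'w \<Rightarrow> real" where
  "birkhoff_sum X H n w = (\<Sum>j<n. H j (path_seg X {j..} w))"

definition sigma_dev ::
  "'w measure \<Rightarrow> (nat \<Rightarrow> 'w \<Rightarrow> 'a) \<Rightarrow> (nat \<Rightarrow> (nat \<Rightarrow> 'a) \<Rightarrow> real) \<Rightarrow> nat \<Rightarrow> real" where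
  "sigma_dev M X f n =
    sqrt (LINT w | M. (birkhoff_sum X f n w - (LINT w' | M. birkhoff_sum X f n w'))\<^sup>2)"

text \<open>
  The functions \<open>H j\<close> are required to be measurable, so that their norms and the distributions of
  their sums make sense. For measurable \<open>f j\<close> and \<open>h \<noteq> 0\<close>, each \<open>Z j\<close> is then measurable too.
\<close>

definition reduction ::
  "'w measure \<Rightarrow> (nat \<Rightarrow> 'a set) \<Rightarrow> (nat \<Rightarrow> 'a \<Rightarrow> 'a \<Rightarrow> real) \<Rightarrow> (nat \<Rightarrow> 'w \<Rightarrow> 'a)
    \<Rightarrow> (real \<Rightarrow> real) \<Rightarrow> real \<Rightarrow> real \<Rightarrow> (nat \<Rightarrow> (nat \<Rightarrow> 'a) \<Rightarrow> real) \<Rightarrow> real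
    \<Rightarrow> (nat \<Rightarrow> (nat \<Rightarrow> 'a) \<Rightarrow> real) \<Rightarrow> (nat \<Rightarrow> (nat \<Rightarrow> 'a) \<Rightarrow> int) \<Rightarrow> bool" where
  "reduction M E d X \<omega> a A1 f h H Z \<longleftrightarrow>
    (\<forall>j. H j \<in> borel_measurable (path_space E d {j..})) \<and>
    (SUP j. omega_norm M E d X \<omega> a A1 j (H j)) < \<infinity> \<and>
    tight (\<lambda>n. distr M borel (birkhoff_sum X H (Suc n))) \<and>
    (\<forall>j. \<forall>x \<in> PiE {j..} E.
      f j x = (LINT y | kappa M E d X j. f j y) + H j x + h * real_of_int (Z j x))"

definition reducible_to ::
  "'w measure \<Rightarrow> (nat \<Rightarrow> 'a set) \<Rightarrow> (nat \<Rightarrow> 'a \<Rightarrow> 'a \<Rightarrow> real) \<Rightarrow> (nat \<Rightarrow> 'w \<Rightarrow> 'a)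
    \<Rightarrow> (real \<Rightarrow> real) \<Rightarrow> real \<Rightarrow> real \<Rightarrow> (nat \<Rightarrow> (nat \<Rightarrow> 'a) \<Rightarrow> real) \<Rightarrow> real \<Rightarrow> bool" where
  "reducible_to M E d X \<omega> a A1 f h \<longleftrightarrow>
    h \<noteq> 0 \<and> (\<exists>H Z. reduction M E d X \<omega> a A1 f h H Z)"

definition reducible ::
  "'w measure \<Rightarrow> (nat \<Rightarrow> 'a set) \<Rightarrow> (nat \<Rightarrow> 'a \<Rightarrow> 'a \<Rightarrow> real) \<Rightarrow> (nat \<Rightarrow> 'w \<Rightarrow> 'a)
    \<Rightarrow> (real \<Rightarrow> real) \<Rightarrow> real \<Rightarrow> real \<Rightarrow> (nat \<Rightarrow> (nat \<Rightarrow> 'a) \<Rightarrow> real) \<Rightarrow> bool" where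
  "reducible M E d X \<omega> a A1 f \<longleftrightarrow> (\<exists>h. reducible_to M E d X \<omega> a A1 f h)"

definition int_reducible ::
  "'w measure \<Rightarrow> (nat \<Rightarrow> 'a set) \<Rightarrow> (nat \<Rightarrow> 'a \<Rightarrow> 'a \<Rightarrow> real) \<Rightarrow> (nat \<Rightarrow> 'w \<Rightarrow> 'a)
    \<Rightarrow> (real \<Rightarrow> real) \<Rightarrow> real \<Rightarrow> real \<Rightarrow> (nat \<Rightarrow> (nat \<Rightarrow> 'a) \<Rightarrow> int) \<Rightarrow> bool" where
  "int_reducible M E d X \<omega> a A1 Z \<longleftrightarrow>
    (\<exists>h>1. reducible_to M E d X \<omega> a A1 (\<lambda>j x. real_of_int (Z j x)) h)"

definition reduction_freqs ::
  "'w measure \<Rightarrow> (nat \<Rightarrow> 'a set) \<Rightarrow> (nat \<Rightarrow> 'a \<Rightarrow> 'a \<Rightarrow> real) \<Rightarrow> (nat \<Rightarrow> 'w \<Rightarrow> 'a)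
    \<Rightarrow> (real \<Rightarrow> real) \<Rightarrow> real \<Rightarrow> real \<Rightarrow> (nat \<Rightarrow> (nat \<Rightarrow> 'a) \<Rightarrow> real) \<Rightarrow> real set" where
  "reduction_freqs M E d X \<omega> a A1 f = {1 / r | r. reducible_to M E d X \<omega> a A1 f r} \<union> {0}"

end

theory Submission
  imports Defs
begin

text \<open>
  Put \<open>t = 1 / h\<close>. Dividing the reducibility identity by \<open>h\<close> gives
  \<open>t * (f j - \<kappa> j (f j)) = H j + Z j\<close> with \<open>Z j\<close> integer valued and \<open>H j\<close> uniformly regular with
  tight sums along the chain. Such \<open>H\<close> are stable under linear combinations, so these
  frequencies \<open>t\<close>, together with \<open>0\<close>, form a subgroup of the reals. A subgroup with a nonzero
  element is of the form \<open>h0 * \<int>\<close> as soon as \<open>0\<close> is isolated in it. Hence everything rests on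
  \<open>frequencies_isolated\<close>: if \<open>\<sigma> n\<close> tends to infinity, no small \<open>t \<noteq> 0\<close> is a frequency.

  Let \<open>t > 0\<close> be a frequency, \<open>u = 2 * pi * t\<close>, let \<open>S m n\<close> denote the sum of the centred \<open>f j\<close>
  along the chain over \<open>m \<le> j < n\<close>, and \<open>S' m n\<close> that of \<open>H j\<close>, so that
  \<open>cis (u * S m n) = cis (2 * pi * S' m n)\<close>. The contradiction comes in three steps.

  First (\<open>tight_sums_asymptotic_coboundary\<close>), tightness gives functions \<open>g n\<close> of the future of
  time \<open>n\<close>, of modulus at most one and asymptotically unimodular, with \<open>cis (2 * pi * S' m n) * g m\<close>
  close to \<open>g n\<close> in \<open>L\<^sup>1\<close> for all large \<open>m \<le> n\<close>. For a large integer \<open>k\<close> and \<open>s = 2 * pi / k\<close> the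
  conditional expectations \<open>G n\<close> of \<open>cis (s * S' 0 n)\<close> given the future of \<open>n\<close> stay away from \<open>0\<close>,
  because \<open>s\<close> is small and the sums are tight. Their squared \<open>L\<^sup>2\<close> norms decrease, hence converge,
  and by Pythagoras \<open>cis (s * S' m n) * G m\<close> is close to \<open>G n\<close>. One takes \<open>g n = (sgn (G n)) ^ k\<close>.

  Second (\<open>coboundary_nearly_constant\<close>), for small \<open>u\<close> the \<open>g n\<close> are nearly constant. Indeed
  \<open>g n\<close> is close to \<open>cis (u * S m n) * g m\<close> for a fixed \<open>m\<close>. Omitting the last \<open>l\<close> terms of the
  sum costs only \<open>O(u * l)\<close>, and what remains is nearly a function of the past of \<open>n - l\<close>. As \<open>g n\<close>
  is a function of the future of \<open>n\<close>, mixing makes it nearly independent of itself.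

  Third (\<open>second_moment_le\<close>), all late block sums \<open>u * S m n\<close> are now, up to a slowly varying
  drift, close to \<open>2 * pi * \<int>\<close> with high probability, while each step is small. To leave the
  neighbourhood of \<open>0\<close> the sum has to pass at distance about \<open>1\<close> from \<open>0\<close>, at a random time which
  mixing separates from the remaining terms; the remaining terms, being near the lattice, would leave
  the total away from the lattice. So exits are rare, even conditionally on the future, and
  iterating this gives geometric tails. The variances of the block sums are then bounded,
  which contradicts \<open>\<sigma> n \<rightarrow> \<infinity>\<close>.

  The third step applied to a small multiple of \<open>H\<close> also shows that tight sums have bounded
  second moments, hence bounded means, so that \<open>H\<close> may be centred without losing tightness. This
  is what the last assertion needs: if the \<open>Z j\<close> belonging to \<open>h = 1 / h0\<close> were reducible with
  \<open>h' > 1\<close>, then substituting one representation into the other and centring would make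
  \<open>h0 / h'\<close> a frequency (\<open>frequency_refine\<close>), although \<open>h0\<close> is the least positive one.
\<close>

section \<open>Expectations of bounded functions\<close>

lemma (in prob_space) integrable_bounded:
  fixes Y :: "'a \<Rightarrow> 'b::{banach, second_countable_topology}"
  assumes "Y \<in> borel_measurable M" "\<And>w. w \<in> space M \<Longrightarrow> norm (Y w) \<le> B"
  shows "integrable M Y"
  using assms by (intro integrable_const_bound[where B = B]) auto

lemma (in prob_space) integrable_event [simp]: "A \<in> events \<Longrightarrow> integrable M (indicator A :: 'a \<Rightarrow> real)"
  by (intro integrable_bounded[where B = 1]) auto

lemma (in prob_space) expectation_le_const:
  fixes Y :: "'a \<Rightarrow> real"
  assumes "integrable M Y" "\<And>w. w \<in> space M \<Longrightarrow> Y w \<le> c"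
  shows "expectation Y \<le> c"
  using assms by (intro integral_le_const) auto

lemma (in prob_space) square_expectation_le:
  fixes Y :: "'a \<Rightarrow> real"
  assumes "Y \<in> borel_measurable M" "\<And>w. w \<in> space M \<Longrightarrow> \<bar>Y w\<bar> \<le> B"
  shows "(expectation Y)\<^sup>2 \<le> expectation (\<lambda>w. (Y w)\<^sup>2)"
proof -
  have i: "integrable M Y" using assms by (intro integrable_bounded[where B = B]) auto
  have "(Y w)\<^sup>2 \<le> B\<^sup>2" if "w \<in> space M" for w
    using assms(2)[OF that] abs_le_square_iff[of "Y w" B] by auto
  then have i2: "integrable M (\<lambda>w. (Y w)\<^sup>2)"
    using assms(1) by (intro integrable_bounded[where B = "B\<^sup>2"]) auto
  show ?thesis
    using variance_eq[OF i i2] variance_positive[of Y] by linarith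
qed

text \<open>
  The extreme values of the functional \<open>Y \<mapsto> E (Y * D)\<close> over \<open>F\<close>-measurable \<open>Y\<close> with values in
  \<open>[0, 1]\<close> are attained at the indicators of the sets where the conditional expectation of \<open>D\<close> is
  positive, respectively negative. This passes from estimates on events to estimates on functions.
\<close>

lemma (in prob_space) integral_against_subalgebra_bound:
  fixes D Y :: "'a \<Rightarrow> real"
  assumes F: "subalgebra M F" and D: "integrable M D"
    and c: "\<And>A. A \<in> sets F \<Longrightarrow> \<bar>expectation (\<lambda>w. indicator A w * D w)\<bar> \<le> c"
    and Y[measurable]: "Y \<in> borel_measurable F" and Y01: "\<And>w. w \<in> space M \<Longrightarrow> 0 \<le> Y w \<and> Y w \<le> 1"
  shows "\<bar>expectation (\<lambda>w. Y w * D w)\<bar> \<le> c"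
proof -
  interpret finite_measure_subalgebra M F
    using F by unfold_locales
  define G where "G = real_cond_exp M F D"
  have G[measurable]: "G \<in> borel_measurable F" by (simp add: G_def)
  have sp: "space F = space M" using F by (simp add: subalgebra_def)
  have [measurable]: "G \<in> borel_measurable M" "Y \<in> borel_measurable M" "D \<in> borel_measurable M"
    using measurable_from_subalg[OF F G] measurable_from_subalg[OF F Y] D by auto
  have Gi: "integrable M G" unfolding G_def using D by (rule real_cond_exp_int)
  have eq: "expectation (\<lambda>w. U w * D w) = expectation (\<lambda>w. U w * G w)"
    and int: "integrable M (\<lambda>w. U w * D w)" "integrable M (\<lambda>w. U w * G w)"
    if U[measurable]: "U \<in> borel_measurable F" and U1: "\<And>w. w \<in> space M \<Longrightarrow> \<bar>U w\<bar> \<le> 1" for U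
  proof -
    have [measurable]: "U \<in> borel_measurable M" using measurable_from_subalg[OF F U] by auto
    have *: "\<bar>U w * x\<bar> \<le> \<bar>x\<bar>" if "w \<in> space M" for w x
      using mult_mono[of "\<bar>U w\<bar>" 1 "\<bar>x\<bar>" "\<bar>x\<bar>"] U1[OF that] by (auto simp: abs_mult)
    show i: "integrable M (\<lambda>w. U w * D w)"
      using * by (intro Bochner_Integration.integrable_bound[OF D]) auto
    show "expectation (\<lambda>w. U w * D w) = expectation (\<lambda>w. U w * G w)"
      unfolding G_def by (rule real_cond_exp_intg(2)[symmetric, OF i]) auto
    show "integrable M (\<lambda>w. U w * G w)"
      using * by (intro Bochner_Integration.integrable_bound[OF Gi]) auto
  qed
  let ?P = "{w \<in> space F. 0 < G w}" and ?N = "{w \<in> space F. G w < 0}"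
  have m: "?P \<in> sets F" "?N \<in> sets F" by measurable
  then have ind: "(indicator ?P :: 'a \<Rightarrow> real) \<in> borel_measurable F" "(indicator ?N :: 'a \<Rightarrow> real) \<in> borel_measurable F"
    by (auto intro: borel_measurable_indicator)
  have YF: "\<bar>Y w\<bar> \<le> 1" if "w \<in> space M" for w using Y01[OF that] by auto
  have "expectation (\<lambda>w. Y w * D w) = expectation (\<lambda>w. Y w * G w)"
    using YF by (intro eq) auto
  also have "\<dots> \<le> expectation (\<lambda>w. indicator ?P w * G w)"
  proof (intro integral_mono int Y ind)
    fix w assume w: "w \<in> space M"
    show "Y w * G w \<le> indicator ?P w * G w"
      using Y01[OF w] w sp by (cases "0 < G w") (auto simp: mult_nonneg_nonpos)
  qed (use YF in \<open>auto simp: indicator_def\<close>)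
  also have "\<dots> = expectation (\<lambda>w. indicator ?P w * D w)"
    using m by (intro eq[symmetric]) (auto simp: indicator_def)
  also have "\<dots> \<le> c" using c[OF m(1)] by auto
  finally have 1: "expectation (\<lambda>w. Y w * D w) \<le> c" .
  have "- c \<le> expectation (\<lambda>w. indicator ?N w * D w)" using c[OF m(2)] by auto
  also have "\<dots> = expectation (\<lambda>w. indicator ?N w * G w)"
    using m by (intro eq) (auto simp: indicator_def)
  also have "\<dots> \<le> expectation (\<lambda>w. Y w * G w)"
  proof (intro integral_mono int Y ind)
    fix w assume w: "w \<in> space M"
    show "indicator ?N w * G w \<le> Y w * G w"
      using Y01[OF w] w sp mult_right_mono_neg[of "Y w" 1 "G w"] by (cases "G w < 0") auto
  qed (use YF in \<open>auto simp: indicator_def\<close>)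
  also have "\<dots> = expectation (\<lambda>w. Y w * D w)"
    using YF by (intro eq[symmetric]) auto
  finally show ?thesis using 1 by auto
qed

abbreviation (in prob_space) tail :: "('a \<Rightarrow> real) \<Rightarrow> real \<Rightarrow> 'a set" where
  "tail Y c \<equiv> {w \<in> space M. c < \<bar>Y w\<bar>}"

abbreviation (in prob_space) L1_dist :: "('a \<Rightarrow> real) \<Rightarrow> ('a \<Rightarrow> real) \<Rightarrow> real" where
  "L1_dist Y Z \<equiv> expectation (\<lambda>w. \<bar>Y w - Z w\<bar>)"

section \<open>Mixing between past and future\<close>

text \<open>
  The abstract form of a \<open>\<phi>\<close>-mixing process seen from its future: \<open>\<phi>\<close> controls the dependence
  on the past relative to the probability of the future event. This lets a bound hold
  conditionally on the future.
\<close>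

locale mixing_filtrations = prob_space M for M :: "'w measure" +
  fixes Past Future :: "nat \<Rightarrow> 'w measure" and \<phi> :: "nat \<Rightarrow> real"
  assumes Past_subalgebra: "subalgebra M (Past k)"
    and Future_subalgebra: "subalgebra M (Future n)"
    and Past_mono: "j \<le> k \<Longrightarrow> sets (Past j) \<subseteq> sets (Past k)"
    and Future_antimono: "m \<le> n \<Longrightarrow> sets (Future n) \<subseteq> sets (Future m)"
    and Future_generated: "sets (Future 0) \<subseteq> sigma_sets (space M) (\<Union>k. sets (Past k))"
    and mixing: "1 \<le> k \<Longrightarrow> 1 \<le> n \<Longrightarrow> A \<in> sets (Past k) \<Longrightarrow> B \<in> sets (Future (k + n)) \<Longrightarrow>
      \<bar>prob (A \<inter> B) - prob A * prob B\<bar> \<le> \<phi> n * prob B"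
    and mixing_tendsto: "\<phi> \<longlonglongrightarrow> 0"
begin

lemma space_Past [simp]: "space (Past k) = space M"
  using Past_subalgebra by (simp add: subalgebra_def)

lemma space_Future [simp]: "space (Future k) = space M"
  using Future_subalgebra by (simp add: subalgebra_def)

lemma Past_events: "A \<in> sets (Past k) \<Longrightarrow> A \<in> events"
  using Past_subalgebra by (auto simp: subalgebra_def)

lemma Future_events: "A \<in> sets (Future k) \<Longrightarrow> A \<in> events"
  using Future_subalgebra by (auto simp: subalgebra_def)

lemma measurable_Past: "Y \<in> measurable (Past k) N \<Longrightarrow> Y \<in> measurable M N"
  using Past_subalgebra by (rule measurable_from_subalg)

lemma measurable_Future: "Y \<in> measurable (Future k) N \<Longrightarrow> Y \<in> measurable M N"
  using Future_subalgebra by (rule measurable_from_subalg)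

lemma measurable_Past_mono: "Y \<in> measurable (Past j) N \<Longrightarrow> j \<le> k \<Longrightarrow> Y \<in> measurable (Past k) N"
  using Past_mono[of j k] by (auto simp: measurable_def)

lemma measurable_Future_mono: "Y \<in> measurable (Future n) N \<Longrightarrow> m \<le> n \<Longrightarrow> Y \<in> measurable (Future m) N"
  using Future_antimono[of m n] by (auto simp: measurable_def)

lemma mixing_nonneg:
  assumes "1 \<le> n"
  shows "0 \<le> \<phi> n"
proof -
  have "space M \<in> sets (Future (1 + n))" using sets.top[of "Future (1 + n)"] by simp
  then have "\<bar>prob ({} \<inter> space M) - prob {} * prob (space M)\<bar> \<le> \<phi> n * prob (space M)"
    using assms by (intro mixing[of 1]) auto
  also have "\<dots> = \<phi> n" by (simp add: prob_space)
  finally show ?thesis using abs_ge_zero order_trans by blast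
qed

lemma mixing_small:
  assumes "0 < e"
  obtains l where "1 \<le> l" "\<phi> l \<le> e"
proof -
  have "\<forall>\<^sub>F n in sequentially. \<phi> n < e \<and> 1 \<le> n"
    using order_tendstoD(2)[OF mixing_tendsto assms] eventually_ge_at_top[of 1] by eventually_elim auto
  then obtain l where "\<phi> l < e \<and> 1 \<le> l"
    using eventually_happens'[OF sequentially_bot] by blast
  then show thesis by (intro that[of l]) auto
qed

lemma mixing_event:
  assumes k: "1 \<le> k" "1 \<le> l" and Y[measurable]: "Y \<in> borel_measurable (Past k)"
    and Y01: "\<And>w. w \<in> space M \<Longrightarrow> 0 \<le> Y w \<and> Y w \<le> 1" and B: "B \<in> sets (Future (k + l))"
  shows "\<bar>expectation (\<lambda>w. Y w * indicator B w) - expectation Y * prob B\<bar> \<le> \<phi> l * prob B"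
proof -
  have [measurable]: "B \<in> events" "Y \<in> borel_measurable M"
    using B Future_events measurable_Past[OF Y] by auto
  have iY: "integrable M Y" using Y01 by (intro integrable_bounded[where B = 1]) auto
  have iYB: "integrable M (\<lambda>w. Y w * indicator B w)"
    using Y01 by (intro integrable_bounded[where B = 1]) (auto simp: indicator_def)
  have "\<bar>expectation (\<lambda>w. Y w * (indicator B w - prob B))\<bar> \<le> \<phi> l * prob B"
  proof (rule integral_against_subalgebra_bound[OF Past_subalgebra _ _ Y Y01])
    fix A assume A: "A \<in> sets (Past k)"
    then have [measurable]: "A \<in> events" by (rule Past_events)
    have "expectation (\<lambda>w. indicator A w * (indicator B w - prob B))
        = expectation (\<lambda>w. indicator (A \<inter> B) w - indicator A w * prob B)"
      by (intro Bochner_Integration.integral_cong) (auto simp: indicator_def)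
    also have "\<dots> = prob (A \<inter> B) - prob A * prob B"
      by (subst Bochner_Integration.integral_diff) (auto simp: Int_absorb2 sets.sets_into_space)
    finally show "\<bar>expectation (\<lambda>w. indicator A w * (indicator B w - prob B))\<bar> \<le> \<phi> l * prob B"
      using mixing[OF k A B] by simp
  qed auto
  also have "(\<lambda>w. Y w * (indicator B w - prob B)) = (\<lambda>w. Y w * indicator B w - Y w * prob B)"
    by (simp add: algebra_simps)
  also have "expectation \<dots> = expectation (\<lambda>w. Y w * indicator B w) - expectation Y * prob B"
    using iY iYB by (subst Bochner_Integration.integral_diff) auto
  finally show ?thesis .
qed

lemma mixing_covariance:
  assumes k: "1 \<le> k" "1 \<le> l" and Y[measurable]: "Y \<in> borel_measurable (Past k)"
    and Y1: "\<And>w. w \<in> space M \<Longrightarrow> \<bar>Y w\<bar> \<le> 1"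
    and Z[measurable]: "Z \<in> borel_measurable (Future (k + l))"
    and Z1: "\<And>w. w \<in> space M \<Longrightarrow> \<bar>Z w\<bar> \<le> 1"
  shows "\<bar>expectation (\<lambda>w. Y w * Z w) - expectation Y * expectation Z\<bar> \<le> 4 * \<phi> l"
proof -
  have [measurable]: "Y \<in> borel_measurable M" "Z \<in> borel_measurable M"
    using measurable_Past[OF Y] measurable_Future[OF Z] by auto
  have iY: "integrable M Y" using Y1 by (intro integrable_bounded[where B = 1]) auto
  have iZ: "integrable M Z" using Z1 by (intro integrable_bounded[where B = 1]) auto
  have "\<bar>Y w * Z w\<bar> \<le> 1" if "w \<in> space M" for w
    using mult_mono[OF Y1[OF that] Z1[OF that]] by (simp add: abs_mult)
  then have iYZ: "integrable M (\<lambda>w. Y w * Z w)" by (intro integrable_bounded[where B = 1]) auto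
  define Y' where "Y' = (\<lambda>w. (Y w + 1) / 2)"
  define Z' where "Z' = (\<lambda>w. (Z w + 1) / 2)"
  have [measurable]: "Y' \<in> borel_measurable (Past k)" unfolding Y'_def by measurable
  have EY': "expectation Y' = (expectation Y + 1) / 2"
    unfolding Y'_def using iY by (simp add: prob_space)
  have Y'01: "0 \<le> Y' w \<and> Y' w \<le> 1" if "w \<in> space M" for w
    using Y1[OF that] unfolding Y'_def by auto
  have iY': "integrable M Y'" unfolding Y'_def using iY by auto
  have "\<bar>expectation (\<lambda>w. Z' w * (Y' w - expectation Y'))\<bar> \<le> \<phi> l"
  proof (rule integral_against_subalgebra_bound[OF Future_subalgebra])
    fix B assume B: "B \<in> sets (Future (k + l))"
    then have [measurable]: "B \<in> events" by (rule Future_events)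
    have "\<bar>expectation (\<lambda>w. Y' w * indicator B w) - expectation Y' * prob B\<bar> \<le> \<phi> l * prob B"
      using k B Y1 by (intro mixing_event) (auto simp: Y'01)
    also have "\<dots> \<le> \<phi> l" using mixing_nonneg[OF k(2)] by (simp add: mult_left_le)
    also have "expectation (\<lambda>w. Y' w * indicator B w) - expectation Y' * prob B
        = expectation (\<lambda>w. Y' w * indicator B w - expectation Y' * indicator B w)"
      using iY' by (subst Bochner_Integration.integral_diff) (auto intro!: integrable_real_mult_indicator)
    also have "\<dots> = expectation (\<lambda>w. indicator B w * (Y' w - expectation Y'))"
      by (simp add: algebra_simps)
    finally show "\<bar>expectation (\<lambda>w. indicator B w * (Y' w - expectation Y'))\<bar> \<le> \<phi> l" .
  next
    show "Z' \<in> borel_measurable (Future (k + l))" unfolding Z'_def by measurable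
    show "0 \<le> Z' w \<and> Z' w \<le> 1" if "w \<in> space M" for w
      using Z1[OF that] unfolding Z'_def by auto
  qed (use iY' in auto)
  also have "(\<lambda>w. Z' w * (Y' w - expectation Y'))
      = (\<lambda>w. (Y w * Z w + Y w - expectation Y * Z w - expectation Y) / 4)"
    unfolding EY' unfolding Z'_def Y'_def by (auto simp: field_simps)
  also have "expectation \<dots> = (expectation (\<lambda>w. Y w * Z w) - expectation Y * expectation Z) / 4"
    using iY iZ iYZ by (simp add: prob_space)
  finally show ?thesis by simp
qed

text \<open>
  A function of the future which is close in \<open>L\<^sup>1\<close> to a function of the past is nearly independent
  of itself, hence nearly constant.
\<close>

lemma variance_le_of_approximation:
  assumes k: "1 \<le> k" "1 \<le> l" and Y[measurable]: "Y \<in> borel_measurable (Past k)"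
    and Y1: "\<And>w. w \<in> space M \<Longrightarrow> \<bar>Y w\<bar> \<le> 1"
    and Z[measurable]: "Z \<in> borel_measurable (Future (k + l))"
    and Z1: "\<And>w. w \<in> space M \<Longrightarrow> \<bar>Z w\<bar> \<le> 1"
  shows "variance Z \<le> 4 * \<phi> l + 2 * L1_dist Z Y"
proof -
  have [measurable]: "Y \<in> borel_measurable M" "Z \<in> borel_measurable M"
    using measurable_Past[OF Y] measurable_Future[OF Z] by auto
  have iY: "integrable M Y" using Y1 by (intro integrable_bounded[where B = 1]) auto
  have iZ: "integrable M Z" using Z1 by (intro integrable_bounded[where B = 1]) auto
  have "\<bar>Y w * Z w\<bar> \<le> 1" if "w \<in> space M" for w
    using mult_mono[OF Y1[OF that] Z1[OF that]] by (simp add: abs_mult)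
  then have iYZ: "integrable M (\<lambda>w. Y w * Z w)" by (intro integrable_bounded[where B = 1]) auto
  have "\<bar>Z w * Z w\<bar> \<le> 1" if "w \<in> space M" for w
    using mult_mono[OF Z1[OF that] Z1[OF that]] by (simp add: abs_mult)
  then have iZZ: "integrable M (\<lambda>w. Z w * Z w)" by (intro integrable_bounded[where B = 1]) auto
  let ?e = "expectation Z"
  have e: "\<bar>?e\<bar> \<le> 1"
    using order_trans[OF integral_abs_bound[of M Z] expectation_le_const[of "\<lambda>w. \<bar>Z w\<bar>" 1]] iZ Z1
    by auto
  have "variance Z = expectation (\<lambda>w. Z w * Z w - ?e * Z w)"
    using iZ iZZ by (subst variance_eq) (auto simp: power2_eq_square)
  also have "\<dots> \<le> expectation (\<lambda>w. (Y w * Z w - ?e * Y w) + 2 * \<bar>Z w - Y w\<bar>)"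
  proof (intro integral_mono)
    fix w assume "w \<in> space M"
    then have "\<bar>Z w - ?e\<bar> \<le> 2" using e Z1[of w] by auto
    then have "(Z w - Y w) * (Z w - ?e) \<le> \<bar>Z w - Y w\<bar> * 2"
      using mult_left_mono[of "\<bar>Z w - ?e\<bar>" 2 "\<bar>Z w - Y w\<bar>"] abs_mult[of "Z w - Y w" "Z w - ?e"] by linarith
    then show "Z w * Z w - ?e * Z w \<le> (Y w * Z w - ?e * Y w) + 2 * \<bar>Z w - Y w\<bar>"
      by (simp add: algebra_simps)
  qed (use iY iZ iYZ iZZ in auto)
  also have "\<dots> = expectation (\<lambda>w. Y w * Z w) - expectation Y * ?e + 2 * L1_dist Z Y"
    using iY iZ iYZ by simp
  also have "\<dots> \<le> 4 * \<phi> l + 2 * L1_dist Z Y"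
    using mixing_covariance[OF k Y Y1 Z Z1] by simp
  finally show ?thesis .
qed

text \<open>
  The functions of the past are dense in \<open>L\<^sup>1\<close> because the events of the past generate the
  future from time \<open>0\<close> on.
\<close>

lemma past_approximation:
  fixes Y :: "'w \<Rightarrow> real"
  assumes Y[measurable]: "Y \<in> borel_measurable (Future 0)"
    and Y1: "\<And>w. w \<in> space M \<Longrightarrow> \<bar>Y w\<bar> \<le> 1" and e: "0 < e"
  obtains k Y' where "Y' \<in> borel_measurable (Past k)" "\<And>w. \<bar>Y' w\<bar> \<le> 1"
    "L1_dist Y Y' < e"
proof -
  let ?near = "\<lambda>(Z :: 'w \<Rightarrow> real) e. \<exists>k Y'. Y' \<in> borel_measurable (Past k) \<and> integrable M Y' \<and> L1_dist Z Y' < e"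
  define approx where "approx Z \<longleftrightarrow> (\<forall>e>0. ?near Z e)" for Z :: "'w \<Rightarrow> real"
  have approx_lim: "approx Z"
    if Z: "integrable M Z" and a: "\<And>e. 0 < e \<Longrightarrow> \<exists>Z'. integrable M Z' \<and> approx Z' \<and> L1_dist Z Z' < e"
    for Z
    unfolding approx_def
  proof (intro allI impI)
    fix e :: real assume "0 < e"
    then obtain Z' where Z': "integrable M Z'" "approx Z'" "L1_dist Z Z' < e / 2"
      using a[of "e / 2"] by auto
    obtain k Y' where Y': "Y' \<in> borel_measurable (Past k)" "integrable M Y'" "L1_dist Z' Y' < e / 2"
      using Z'(2) \<open>0 < e\<close> unfolding approx_def by (meson half_gt_zero)
    have "L1_dist Z Y' \<le> expectation (\<lambda>w. \<bar>Z w - Z' w\<bar> + \<bar>Z' w - Y' w\<bar>)"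
      using Z Z' Y' by (intro integral_mono) auto
    also have "\<dots> < e" using Z Z' Y' by simp
    finally show "?near Z e"
      using Y' by auto
  qed
  have approx_add: "approx (\<lambda>w. U w + V w)" if U: "integrable M U" "approx U" and V: "integrable M V" "approx V" for U V
    unfolding approx_def
  proof (intro allI impI)
    fix e :: real assume "0 < e"
    obtain i U' where U': "U' \<in> borel_measurable (Past i)" "integrable M U'" "L1_dist U U' < e / 2"
      using U(2) \<open>0 < e\<close> unfolding approx_def by (meson half_gt_zero)
    obtain j V' where V': "V' \<in> borel_measurable (Past j)" "integrable M V'" "L1_dist V V' < e / 2"
      using V(2) \<open>0 < e\<close> unfolding approx_def by (meson half_gt_zero)
    have "(\<lambda>w. U' w + V' w) \<in> borel_measurable (Past (max i j))"
      using measurable_Past_mono[OF U'(1), of "max i j"] measurable_Past_mono[OF V'(1), of "max i j"] by auto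
    moreover have "expectation (\<lambda>w. \<bar>(U w + V w) - (U' w + V' w)\<bar>) \<le> expectation (\<lambda>w. \<bar>U w - U' w\<bar> + \<bar>V w - V' w\<bar>)"
      using U V U' V' by (intro integral_mono) auto
    moreover have "\<dots> < e" using U V U' V' by simp
    ultimately show "\<exists>k Y'. Y' \<in> borel_measurable (Past k) \<and> integrable M Y' \<and> expectation (\<lambda>w. \<bar>U w + V w - Y' w\<bar>) < e"
      using U' V' by (intro exI[of _ "max i j"] exI[of _ "\<lambda>w. U' w + V' w"]) auto
  qed
  have approx_scale: "approx (\<lambda>w. Z w * c)" if Z: "approx Z" for Z c
    unfolding approx_def
  proof (intro allI impI)
    fix e :: real assume "0 < e"
    then have "0 < e / (\<bar>c\<bar> + 1)" by simp
    then obtain i U' where U': "U' \<in> borel_measurable (Past i)" "integrable M U'" "L1_dist Z U' < e / (\<bar>c\<bar> + 1)"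
      using Z unfolding approx_def by blast
    have "expectation (\<lambda>w. \<bar>Z w * c - U' w * c\<bar>) = expectation (\<lambda>w. \<bar>Z w - U' w\<bar> * \<bar>c\<bar>)"
      by (simp add: abs_mult[symmetric] left_diff_distrib)
    also have "\<dots> = \<bar>c\<bar> * L1_dist Z U'" by simp
    also have "\<dots> \<le> (\<bar>c\<bar> + 1) * L1_dist Z U'"
      by (intro mult_right_mono integral_nonneg_AE) auto
    also have "\<dots> < (\<bar>c\<bar> + 1) * (e / (\<bar>c\<bar> + 1))"
      using U' by (intro mult_strict_left_mono) auto
    also have "\<dots> = e" by (simp add: field_simps)
    finally show "\<exists>k Y'. Y' \<in> borel_measurable (Past k) \<and> integrable M Y' \<and> expectation (\<lambda>w. \<bar>Z w * c - Y' w\<bar>) < e"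
      using U' by (intro exI[of _ i] exI[of _ "\<lambda>w. U' w * c"]) auto
  qed
  have approx_set: "A \<in> events \<and> approx (indicator A)" if "A \<in> sigma_sets (space M) (\<Union>k. sets (Past k))" for A
    using that
  proof induction
    case (Basic a)
    then obtain k where "a \<in> sets (Past k)" by auto
    moreover from this have "a \<in> events" by (rule Past_events)
    ultimately show ?case unfolding approx_def
      by (auto intro!: exI[of _ k] exI[of _ "indicator a :: 'w \<Rightarrow> real"] integrable_bounded[where B = 1])
  next
    case Empty
    show ?case unfolding approx_def
      by (auto intro!: exI[of _ "\<lambda>_. 0 :: real"])
  next
    case (Compl a)
    then have [measurable]: "a \<in> events" and a: "approx (indicator a)" by auto
    have one: "approx (\<lambda>_. 1)" unfolding approx_def by (auto intro!: exI[of _ "\<lambda>_. 1 :: real"])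
    have "approx (\<lambda>w. 1 + indicator a w * (- 1))"
      using a one by (intro approx_add approx_scale) auto
    moreover have "expectation (\<lambda>w. \<bar>indicator (space M - a) w - (1 + indicator a w * (- 1))\<bar> :: real) = 0"
      by (subst Bochner_Integration.integral_cong[where g = "\<lambda>_. 0" and N = M]) (auto simp: indicator_def split: if_splits)
    moreover have "integrable M (\<lambda>w. 1 + indicator a w * (- 1) :: real)"
      by auto
    ultimately have "\<exists>Z'. integrable M Z' \<and> approx Z' \<and> L1_dist (indicator (space M - a)) Z' < e"
      if "0 < e" for e :: real
      using that by (intro exI[of _ "\<lambda>w. 1 + indicator a w * (- 1)"] conjI) linarith+
    then have "approx (indicator (space M - a))" by (rule approx_lim[rotated]) auto
    then show ?case by auto
  next
    case (Union a)
    then have [measurable]: "\<And>i. a i \<in> events" and a: "\<And>i. approx (indicator (a i))" by auto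
    have fin: "approx (indicator (\<Union>i<n. a i))" for n
    proof (induction n)
      case 0
      show ?case unfolding approx_def by (auto intro!: exI[of _ "\<lambda>_. 0 :: real"])
    next
      case (Suc n)
      show ?case unfolding approx_def
      proof (intro allI impI)
        fix e :: real assume "0 < e"
        obtain i U where U: "U \<in> borel_measurable (Past i)" "integrable M U" "L1_dist (indicator (\<Union>i<n. a i)) U < e / 2"
          using Suc \<open>0 < e\<close> unfolding approx_def by (meson half_gt_zero)
        obtain j V where V: "V \<in> borel_measurable (Past j)" "integrable M V" "L1_dist (indicator (a n)) V < e / 2"
          using a[of n] \<open>0 < e\<close> unfolding approx_def by (meson half_gt_zero)
        have "expectation (\<lambda>w. \<bar>indicator (\<Union>i<Suc n. a i) w - max (U w) (V w)\<bar>)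
            \<le> expectation (\<lambda>w. \<bar>indicator (\<Union>i<n. a i) w - U w\<bar> + \<bar>indicator (a n) w - V w\<bar>)"
        proof (intro integral_mono)
          fix w
          have "indicator (\<Union>i<Suc n. a i) w = (max (indicator (\<Union>i<n. a i) w) (indicator (a n) w) :: real)"
            by (auto simp: indicator_def less_Suc_eq)
          moreover have "\<bar>max p q - max r s\<bar> \<le> \<bar>p - r\<bar> + \<bar>q - s\<bar>" for p q r s :: real by linarith
          ultimately show "\<bar>indicator (\<Union>i<Suc n. a i) w - max (U w) (V w)\<bar>
            \<le> \<bar>indicator (\<Union>i<n. a i) w - U w\<bar> + \<bar>indicator (a n) w - V w\<bar>" by simp
        qed (use U V in \<open>auto intro!: Bochner_Integration.integrable_diff Bochner_Integration.integrable_add integrable_abs integrable_max\<close>)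
        also have "\<dots> < e" using U V by simp
        finally show "?near (indicator (\<Union>i<Suc n. a i)) e"
          using U V measurable_Past_mono[OF U(1), of "max i j"] measurable_Past_mono[OF V(1), of "max i j"]
          by (intro exI[of _ "max i j"] exI[of _ "\<lambda>w. max (U w) (V w)"]) auto
      qed
    qed
    have "approx (indicator (\<Union>i. a i))"
    proof (rule approx_lim)
      fix e :: real assume "0 < e"
      have "(\<lambda>n. expectation (\<lambda>w. \<bar>indicator (\<Union>i. a i) w - indicator (\<Union>i<n. a i) w\<bar> :: real)) \<longlonglongrightarrow> expectation (\<lambda>w. \<bar>0\<bar>)"
      proof (rule integral_dominated_convergence[where w = "\<lambda>_. 1"])
        have "(\<lambda>n. \<bar>indicator (\<Union>i. a i) w - indicator (\<Union>i<n. a i) w\<bar>) \<longlonglongrightarrow> (\<bar>0\<bar>::real)" for w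
        proof (rule tendsto_eventually, cases "w \<in> (\<Union>i. a i)")
          case True
          then obtain i where "w \<in> a i" by auto
          then show "\<forall>\<^sub>F n in sequentially. \<bar>indicator (\<Union>i. a i) w - indicator (\<Union>i<n. a i) w\<bar> = (\<bar>0\<bar>::real)"
            by (intro eventually_mono[OF eventually_gt_at_top[of i]]) (auto simp: indicator_def)
        qed (auto simp: indicator_def)
        then show "AE w in M. (\<lambda>n. \<bar>indicator (\<Union>i. a i) w - indicator (\<Union>i<n. a i) w\<bar>) \<longlonglongrightarrow> (\<bar>0\<bar>::real)" by auto
      qed (auto simp: indicator_def)
      then have "\<forall>\<^sub>F n in sequentially. L1_dist (indicator (\<Union>i. a i)) (indicator (\<Union>i<n. a i)) < e"
        using \<open>0 < e\<close> by (intro order_tendstoD(2)[where a = e]) auto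
      then obtain n where "L1_dist (indicator (\<Union>i. a i)) (indicator (\<Union>i<n. a i)) < e"
        by (meson eventually_sequentially order.refl)
      then show "\<exists>Z'. integrable M Z' \<and> approx Z' \<and> L1_dist (indicator (\<Union>i. a i)) Z' < e"
        using fin[of n] by (intro exI[of _ "indicator (\<Union>i<n. a i)"]) auto
    qed auto
    then show ?case by auto
  qed
  have [measurable]: "Y \<in> borel_measurable M" using measurable_Future[OF Y] by auto
  have iY: "integrable M Y" using Y1 by (intro integrable_bounded[where B = 1]) auto
  let ?R = "restr_to_subalg M (Future 0)"
  have i: "integrable M Z" if "integrable ?R Z" for Z :: "'w \<Rightarrow> real"
    using integrable_from_subalg[OF Future_subalgebra that] .
  have "integrable ?R Y" using integrable_in_subalg[OF Future_subalgebra Y iY] .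
  then have "approx Y"
  proof induction
    case (base A c)
    then have "A \<in> sets (Future 0)" by (simp add: sets_restr_to_subalg[OF Future_subalgebra])
    then have "approx (indicator A)" using approx_set Future_generated by auto
    then show ?case using approx_scale[of "indicator A" c] by simp
  next
    case (add U V)
    then show ?case using i by (intro approx_add) auto
  next
    case (lim U s)
    show ?case
    proof (rule approx_lim)
      show "integrable M U" using lim i by blast
    next
      fix e :: real assume "0 < e"
      have sp: "space ?R = space M" by (simp add: space_restr_to_subalg)
      have "(\<lambda>n. L1_dist U (s n)) \<longlonglongrightarrow> expectation (\<lambda>w. \<bar>0\<bar>)"
      proof (rule integral_dominated_convergence[where w = "\<lambda>w. 3 * \<bar>U w\<bar>"])
        show "AE w in M. (\<lambda>n. \<bar>U w - s n w\<bar>) \<longlonglongrightarrow> \<bar>0\<bar>"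
        proof (intro AE_I2 tendsto_rabs)
          fix w assume "w \<in> space M"
          then have "(\<lambda>n. U w - s n w) \<longlonglongrightarrow> U w - U w" using lim sp by (intro tendsto_intros) auto
          then show "(\<lambda>n. U w - s n w) \<longlonglongrightarrow> 0" by simp
        qed
        show "AE w in M. norm \<bar>U w - s n w\<bar> \<le> 3 * \<bar>U w\<bar>" for n
        proof (rule AE_I2)
          fix w assume "w \<in> space M"
          then have "\<bar>s n w\<bar> \<le> 2 * \<bar>U w\<bar>" using lim sp by (metis real_norm_def)
          then show "norm \<bar>U w - s n w\<bar> \<le> 3 * \<bar>U w\<bar>" by auto
        qed
      next
        have "integrable M U" "\<And>n. integrable M (s n)" using lim i by blast+
        then show "(\<lambda>w. \<bar>0\<bar> :: real) \<in> borel_measurable M" "integrable M (\<lambda>w. 3 * \<bar>U w\<bar>)"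
          "\<And>n. (\<lambda>w. \<bar>U w - s n w\<bar>) \<in> borel_measurable M" by auto
      qed
      then have "\<forall>\<^sub>F n in sequentially. L1_dist U (s n) < e"
        using \<open>0 < e\<close> by (intro order_tendstoD(2)[where a = e]) auto
      then obtain n where "L1_dist U (s n) < e"
        by (meson eventually_sequentially order.refl)
      moreover have "integrable M (s n)" "approx (s n)" using lim i by blast+
      ultimately show "\<exists>Z'. integrable M Z' \<and> approx Z' \<and> L1_dist U Z' < e"
        by blast
    qed
  qed
  then obtain k Y' where Y': "Y' \<in> borel_measurable (Past k)" "integrable M Y'" "L1_dist Y Y' < e"
    using e unfolding approx_def by blast
  show thesis
  proof (rule that[of "\<lambda>w. max (- 1) (min 1 (Y' w))" k])
    show "(\<lambda>w. max (- 1) (min 1 (Y' w))) \<in> borel_measurable (Past k)"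
      using Y'(1) by measurable
    then have [measurable]: "(\<lambda>w. max (- 1) (min 1 (Y' w))) \<in> borel_measurable M" by (rule measurable_Past)
    have "expectation (\<lambda>w. \<bar>Y w - max (- 1) (min 1 (Y' w))\<bar>) \<le> L1_dist Y Y'"
    proof (intro integral_mono)
      show "\<bar>Y w - max (- 1) (min 1 (Y' w))\<bar> \<le> \<bar>Y w - Y' w\<bar>" if "w \<in> space M" for w
        using Y1[OF that] by auto
      show "integrable M (\<lambda>w. \<bar>Y w - max (- 1) (min 1 (Y' w))\<bar>)"
      proof (rule integrable_bounded)
        show "norm \<bar>Y w - max (- 1) (min 1 (Y' w))\<bar> \<le> 2" if "w \<in> space M" for w
          using Y1[OF that] by auto
      qed measurable
    qed (use iY Y' in auto)
    then show "expectation (\<lambda>w. \<bar>Y w - max (- 1) (min 1 (Y' w))\<bar>) < e" using Y'(3) by linarith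
  qed auto
qed

end

section \<open>Block sums that stay near the circle lattice\<close>

lemma measurable_cis [measurable]: "cis \<in> borel_measurable borel"
  by (intro borel_measurable_continuous_onI continuous_intros)

lemma cmod_cis_diff: "cmod (cis x - cis y) = 2 * \<bar>sin ((x - y) / 2)\<bar>"
proof -
  have "(cmod (cis x - cis y))\<^sup>2 = 2 - 2 * cos (x - y)"
    by (simp add: cmod_power2 power2_diff cos_diff sin_squared_eq)
  also have "\<dots> = (2 * \<bar>sin ((x - y) / 2)\<bar>)\<^sup>2"
    using cos_double_sin[of "(x - y) / 2"]
    by (simp only: power_mult_distrib power2_abs times_divide_eq_right nonzero_mult_div_cancel_left) simp
  finally show ?thesis by (rule power2_eq_imp_eq) auto
qed

lemma cmod_cis_diff_le: "cmod (cis x - cis y) \<le> \<bar>x - y\<bar>"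
  using abs_sin_x_le_abs_x[of "(x - y) / 2"] by (simp add: cmod_cis_diff)

lemma cmod_cis_minus_one_ge:
  assumes "1 < \<bar>x\<bar>" "\<bar>x\<bar> \<le> 1 + 1 / 100"
  shows "9 / 10 \<le> cmod (cis x - 1)"
proof -
  define y where "y = \<bar>x\<bar> / 2"
  have y: "1 / 2 \<le> y" "y \<le> 101 / 200" using assms by (auto simp: y_def)
  have "\<bar>sin y - y\<bar> \<le> \<bar>y\<bar> ^ 3 / 6"
    using Maclaurin_sin_bound[of y 3] by (simp add: eval_nat_numeral sin_coeff_def)
  moreover have "\<bar>y\<bar> ^ 3 \<le> (101 / 200) ^ 3" using y by (intro power_mono) auto
  ultimately have "\<bar>sin y - y\<bar> \<le> (101 / 200) ^ 3 / 6" by linarith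
  then have "9 / 20 \<le> sin y"
    using y(1) unfolding power3_eq_cube by linarith
  moreover have "\<bar>sin (x / 2)\<bar> = \<bar>sin y\<bar>" by (simp add: y_def abs_if)
  ultimately show ?thesis using cmod_cis_diff[of x 0] by simp
qed

lemma (in prob_space) integrable_cmod_diff:
  assumes [measurable]: "Y \<in> borel_measurable M" "Z \<in> borel_measurable M"
    and "\<And>w. cmod (Y w) \<le> p" "\<And>w. cmod (Z w) \<le> q"
  shows "integrable M (\<lambda>w. cmod (Y w - Z w))"
proof (rule integrable_bounded)
  show "norm (cmod (Y w - Z w)) \<le> p + q" for w
    using norm_triangle_ineq4[of "Y w" "Z w"] assms(3)[of w] assms(4)[of w] by simp
qed measurable

definition block_sum :: "(nat \<Rightarrow> 'w \<Rightarrow> real) \<Rightarrow> nat \<Rightarrow> nat \<Rightarrow> 'w \<Rightarrow> real" where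
  "block_sum q m n w = (\<Sum>j\<in>{m..<n}. q j w)"

lemma block_sum_empty [simp]: "n \<le> m \<Longrightarrow> block_sum q m n w = 0"
  by (simp add: block_sum_def)

lemma block_sum_split: "m \<le> k \<Longrightarrow> k \<le> n \<Longrightarrow> block_sum q m n w = block_sum q m k w + block_sum q k n w"
  by (simp add: block_sum_def sum.atLeastLessThan_concat)

lemma abs_block_sum_le:
  assumes "\<And>j. \<bar>q j w\<bar> \<le> L"
  shows "\<bar>block_sum q m n w\<bar> \<le> real (n - m) * L"
proof -
  have "\<bar>block_sum q m n w\<bar> \<le> (\<Sum>j\<in>{m..<n}. \<bar>q j w\<bar>)" unfolding block_sum_def by (rule sum_abs)
  also have "\<dots> \<le> (\<Sum>j\<in>{m..<n}. L)" using assms by (intro sum_mono) auto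
  finally show ?thesis by simp
qed

context mixing_filtrations
begin

text \<open>
  The one constant \<open>L\<close> bounds each term and also the error made in replacing any sum of terms up
  to time \<open>p\<close> by a function of the past of \<open>p\<close>, whatever the length of the sum.
\<close>

definition short_memory :: "(nat \<Rightarrow> 'w \<Rightarrow> real) \<Rightarrow> real \<Rightarrow> bool" where
  "short_memory q L \<longleftrightarrow>
    (\<forall>j. q j \<in> borel_measurable (Future j)) \<and>
    (\<forall>j. \<forall>w\<in>space M. \<bar>q j w\<bar> \<le> L) \<and>
    (\<forall>j p. j \<le> p \<longrightarrow> (\<exists>r\<in>borel_measurable (Past p). \<forall>w\<in>space M. \<bar>block_sum q j p w - r w\<bar> \<le> L))"

lemma block_sum_Future:
  assumes "\<And>j. q j \<in> borel_measurable (Future j)"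
  shows "block_sum q m n \<in> borel_measurable (Future m)"
  unfolding block_sum_def by (intro borel_measurable_sum measurable_Future_mono[OF assms]) auto

lemma block_sum_measurable:
  assumes "\<And>j. q j \<in> borel_measurable (Future j)"
  shows "block_sum q m n \<in> borel_measurable M"
  by (rule measurable_Future[OF block_sum_Future[OF assms]])

lemma short_memory_FutureD: "short_memory q L \<Longrightarrow> q j \<in> borel_measurable (Future j)"
  by (simp add: short_memory_def)

lemma short_memory_boundD: "short_memory q L \<Longrightarrow> w \<in> space M \<Longrightarrow> \<bar>q j w\<bar> \<le> L"
  by (simp add: short_memory_def)

lemma short_memory_nonneg: "short_memory q L \<Longrightarrow> 0 \<le> L"
  using not_empty unfolding short_memory_def by force

lemma short_memory_block_sum:
  assumes q: "short_memory q L"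
  shows "block_sum q m n \<in> borel_measurable M"
    and "w \<in> space M \<Longrightarrow> \<bar>block_sum q m n w\<bar> \<le> real (n - m) * L"
    and "integrable M (block_sum q m n)" and "integrable M (\<lambda>w. (block_sum q m n w)\<^sup>2)"
proof -
  show meas[measurable]: "block_sum q m n \<in> borel_measurable M"
    using block_sum_measurable short_memory_FutureD[OF q] by blast
  show bound: "\<bar>block_sum q m n w\<bar> \<le> real (n - m) * L" if "w \<in> space M" for w
    using short_memory_boundD[OF q that] by (rule abs_block_sum_le)
  show "integrable M (block_sum q m n)"
    using bound by (intro integrable_bounded[where B = "real (n - m) * L"]) auto
  show "integrable M (\<lambda>w. (block_sum q m n w)\<^sup>2)"
  proof (rule integrable_bounded)
    fix w assume "w \<in> space M"
    then have "\<bar>block_sum q m n w\<bar>\<^sup>2 \<le> (real (n - m) * L)\<^sup>2" using bound by (intro power_mono) auto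
    then show "norm ((block_sum q m n w)\<^sup>2) \<le> (real (n - m) * L)\<^sup>2" by simp
  qed measurable
qed

end

text \<open>
  A process with small steps whose late block sums are all close to \<open>2 * pi * \<int>\<close> in mean. The gap \<open>l\<close>
  separates past from future; the steps are so small that a gap, together with the two errors of
  a localisation, does not change a phase noticeably.
\<close>

locale near_identity = mixing_filtrations M Past Future \<phi>
  for M :: "'w measure" and Past Future \<phi> +
  fixes W :: "nat \<Rightarrow> 'w \<Rightarrow> real" and b :: real and l m1 :: nat
  assumes memory: "short_memory W b"
    and gap: "1 \<le> l" "\<phi> l \<le> 1 / 100" "(l + 2) * b \<le> 1 / 100"
    and start: "1 \<le> m1"
    and near_one: "m1 \<le> m \<Longrightarrow> m \<le> n \<Longrightarrow> expectation (\<lambda>w. cmod (cis (block_sum W m n w) - 1)) \<le> 1 / 100"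
begin

lemma W_Future: "W j \<in> borel_measurable (Future j)"
  using memory by (simp add: short_memory_def)

lemma W_le: "w \<in> space M \<Longrightarrow> \<bar>W j w\<bar> \<le> b"
  using memory by (simp add: short_memory_def)

lemma b_nonneg: "0 \<le> b" using memory by (rule short_memory_nonneg)

lemma b_small: "b \<le> 1 / 100" "l * b + b \<le> 1 / 100" "l * b \<le> 1 / 100"
proof -
  have "0 \<le> l * b" using b_nonneg by simp
  moreover have "l * b + 2 * b \<le> 1 / 100" using gap(3) by (simp add: algebra_simps)
  ultimately show "b \<le> 1 / 100" "l * b + b \<le> 1 / 100" "l * b \<le> 1 / 100"
    using b_nonneg by linarith+
qed

lemma sums_measurable [measurable]: "block_sum W m n \<in> borel_measurable M"
  using block_sum_measurable W_Future by blast

lemma short_block_sum: "w \<in> space M \<Longrightarrow> k \<le> m + l \<Longrightarrow> \<bar>block_sum W m k w\<bar> \<le> l * b"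
  using abs_block_sum_le[of W w b m k] W_le[of w] b_nonneg
    mult_right_mono[of "real (k - m)" "real l" b]
  by (auto intro: order_trans)

lemma integrable_cis [simp]: "integrable M (\<lambda>w. cmod (cis (block_sum W m n w) - 1))"
  by (intro integrable_cmod_diff[where p = 1 and q = 1]) auto

text \<open>
  Closeness to the lattice persists conditionally on the future: drop the last \<open>l\<close> terms,
  replace the rest by a function of the past of \<open>k - l\<close>, and use mixing.
\<close>

lemma near_one_given_future:
  assumes A: "A \<in> sets (Future k)" and m: "m1 \<le> m" "m \<le> k"
  shows "expectation (\<lambda>w. indicator A w * cmod (cis (block_sum W m k w) - 1)) \<le> prob A / 10"
proof -
  have [measurable]: "A \<in> events" using A by (rule Future_events)
  have iA: "integrable M (\<lambda>w. indicator A w * cmod (cis (block_sum W m k w) - 1))"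
    using integrable_real_mult_indicator[OF \<open>A \<in> events\<close> integrable_cis] by (simp add: mult.commute)
  show ?thesis
  proof (cases "k < m + l")
    case True
    have "expectation (\<lambda>w. indicator A w * cmod (cis (block_sum W m k w) - 1))
        \<le> expectation (\<lambda>w. indicator A w * (1 / 100))"
    proof (intro integral_mono iA mult_left_mono)
      fix w assume "w \<in> space M"
      then have "\<bar>block_sum W m k w\<bar> \<le> 1 / 100"
        using short_block_sum[of w k m] True b_small by auto
      then show "cmod (cis (block_sum W m k w) - 1) \<le> 1 / 100"
        using cmod_cis_diff_le[of "block_sum W m k w" 0] by simp
    qed auto
    also have "\<dots> \<le> prob A / 10" by simp
    finally show ?thesis .
  next
    case False
    define p where "p = k - l"
    have p: "m \<le> p" "p + l = k" "p \<le> k" using False by (auto simp: p_def)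
    obtain r where r: "r \<in> borel_measurable (Past p)" "\<And>w. w \<in> space M \<Longrightarrow> \<bar>block_sum W m p w - r w\<bar> \<le> b"
      using memory p(1) unfolding short_memory_def by blast
    have [measurable]: "r \<in> borel_measurable M" using r(1) by (rule measurable_Past)
    define Y where "Y = (\<lambda>w. cmod (cis (r w) - 1) / 2)"
    have Yeq: "Y = (\<lambda>w. \<bar>sin (r w / 2)\<bar>)"
      using cmod_cis_diff[of _ 0] by (simp add: Y_def)
    have Y[measurable]: "Y \<in> borel_measurable (Past p)" unfolding Yeq using r(1) by measurable
    have [measurable]: "Y \<in> borel_measurable M" by (rule measurable_Past[OF Y])
    have Y01: "0 \<le> Y w \<and> Y w \<le> 1" for w by (simp add: Yeq)
    have iY: "integrable M Y" using Y01 by (intro integrable_bounded[where B = 1]) auto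
    have iYA: "integrable M (\<lambda>w. Y w * indicator A w)"
      using integrable_real_mult_indicator[OF \<open>A \<in> events\<close> iY] .
    have diff: "cmod (cis x - 1) \<le> cmod (cis y - 1) + \<bar>x - y\<bar>" for x y
      using norm_triangle_ineq[of "cis x - cis y" "cis y - 1"] cmod_cis_diff_le[of x y] by simp
    have "expectation (\<lambda>w. 2 * Y w) \<le> expectation (\<lambda>w. cmod (cis (block_sum W m p w) - 1) + 1 / 100)"
    proof (intro integral_mono)
      fix w assume w: "w \<in> space M"
      show "2 * Y w \<le> cmod (cis (block_sum W m p w) - 1) + 1 / 100"
        using diff[of "r w" "block_sum W m p w"] r(2)[OF w] b_small by (simp add: Y_def)
    qed (use iY in auto)
    also have "\<dots> \<le> 2 / 100" using near_one[OF m(1) p(1)] by (simp add: prob_space)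
    finally have EY: "expectation Y \<le> 1 / 100" using iY by simp
    have "expectation (\<lambda>w. indicator A w * cmod (cis (block_sum W m k w) - 1))
        \<le> expectation (\<lambda>w. 2 * (Y w * indicator A w) + 1 / 100 * indicator A w)"
    proof (intro integral_mono iA)
      fix w assume w: "w \<in> space M"
      have "\<bar>block_sum W m k w - r w\<bar> \<le> 1 / 100"
        using block_sum_split[of m p k W w] p r(2)[OF w] short_block_sum[OF w, of k p] b_small(2)
        by linarith
      then have "cmod (cis (block_sum W m k w) - 1) \<le> 2 * Y w + 1 / 100"
        using diff[of "block_sum W m k w" "r w"] by (simp add: Y_def)
      then show "indicator A w * cmod (cis (block_sum W m k w) - 1) \<le> 2 * (Y w * indicator A w) + 1 / 100 * indicator A w"
        by (auto simp: indicator_def)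
    qed (use iYA in auto)
    also have "\<dots> = 2 * expectation (\<lambda>w. Y w * indicator A w) + prob A / 100"
      using iYA by simp
    also have "\<dots> \<le> 2 * (expectation Y * prob A + \<phi> l * prob A) + prob A / 100"
      using mixing_event[of p l Y A] gap start m p A Y Y01 by (auto simp: abs_le_iff)
    also have "\<dots> \<le> 2 * (1 / 100 * prob A + 1 / 100 * prob A) + prob A / 100"
      using EY gap by (intro add_right_mono mult_left_mono add_mono mult_right_mono) auto
    also have "\<dots> \<le> prob A / 10" by simp
    finally show ?thesis .
  qed
qed

text \<open>
  The block sums ending at \<open>n\<close> are followed backwards in their left end, since the event that
  level \<open>c\<close> is first exceeded at \<open>k\<close> then belongs to the future of \<open>k\<close> and can be conditioned upon.
\<close>

definition exit_at :: "real \<Rightarrow> nat \<Rightarrow> nat \<Rightarrow> 'w set" where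
  "exit_at c n k = {w \<in> space M. c < \<bar>block_sum W k n w\<bar> \<and> (\<forall>j\<in>{k<..n}. \<bar>block_sum W j n w\<bar> \<le> c)}"

abbreviation exceed :: "real \<Rightarrow> nat \<Rightarrow> nat \<Rightarrow> 'w set" where
  "exceed c m n \<equiv> {w \<in> space M. \<exists>k\<in>{m..n}. c < \<bar>block_sum W k n w\<bar>}"

lemma exit_at_Future: "exit_at c n k \<in> sets (Future k)"
proof -
  have [measurable]: "block_sum W j n \<in> borel_measurable (Future k)" if "k \<le> j" for j
    by (rule measurable_Future_mono[OF block_sum_Future that]) (rule W_Future)
  have "{w \<in> space (Future k). c < \<bar>block_sum W k n w\<bar> \<and> (\<forall>j\<in>{k<..n}. \<bar>block_sum W j n w\<bar> \<le> c)} \<in> sets (Future k)"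
    by (intro sets.sets_Collect sets.sets_Collect_finite_All)
      (auto intro!: borel_measurable_le borel_measurable_less borel_measurable_abs simp del: space_Future)
  then show ?thesis by (simp add: exit_at_def)
qed

lemma exit_at_events [measurable, simp]: "exit_at c n k \<in> events"
  using exit_at_Future by (rule Future_events)

lemma exit_at_disjoint: "disjoint_family_on (exit_at c n) {m..n}"
proof -
  have False if "w \<in> exit_at c n i" "w \<in> exit_at c n j" "i < j" "j \<le> n" for w i j
    using that unfolding exit_at_def by force
  then show ?thesis unfolding disjoint_family_on_def
    by (metis (no_types, lifting) atLeastAtMost_iff disjoint_iff linorder_less_linear)
qed

lemma exceed_eq_exit_at:
  "exceed c m n = (\<Union>k\<in>{m..n}. exit_at c n k)"
proof (intro equalityI subsetI)
  fix w assume "w \<in> exceed c m n"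
  then have w: "w \<in> space M" and ne: "{k\<in>{m..n}. c < \<bar>block_sum W k n w\<bar>} \<noteq> {}" (is "?K \<noteq> {}") by auto
  have fin: "finite ?K" by simp
  have "Max ?K \<in> ?K" using Max_in[OF fin ne] .
  moreover have "\<bar>block_sum W j n w\<bar> \<le> c" if "j \<in> {Max ?K<..n}" for j
  proof (rule ccontr)
    assume "\<not> \<bar>block_sum W j n w\<bar> \<le> c"
    then have "j \<in> ?K" using that \<open>Max ?K \<in> ?K\<close> by auto
    then have "j \<le> Max ?K" using fin by (rule Max_ge[rotated])
    then show False using that by auto
  qed
  ultimately have "w \<in> exit_at c n (Max ?K)" "Max ?K \<in> {m..n}" using w by (auto simp: exit_at_def)
  then show "w \<in> (\<Union>k\<in>{m..n}. exit_at c n k)" by blast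
qed (auto simp: exit_at_def)

lemma prob_exceed:
  "prob (exceed c m n) = (\<Sum>k\<in>{m..n}. prob (exit_at c n k))"
  unfolding exceed_eq_exit_at by (intro finite_measure_finite_Union exit_at_disjoint) auto

lemma exceed_events [measurable]: "exceed c m n \<in> events"
  unfolding exceed_eq_exit_at by auto

lemma exit_at_le:
  assumes "w \<in> exit_at c n k" "0 \<le> c"
  shows "\<bar>block_sum W k n w\<bar> \<le> c + b" "k < n"
proof -
  show "k < n" using assms by (cases "k < n") (auto simp: exit_at_def)
  then have "\<bar>block_sum W (Suc k) n w\<bar> \<le> c" using assms by (auto simp: exit_at_def)
  moreover have "block_sum W k n w = W k w + block_sum W (Suc k) n w"
    using block_sum_split[of k "Suc k" n W w] \<open>k < n\<close> by (simp add: block_sum_def)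
  moreover have "\<bar>W k w\<bar> \<le> b" using assms W_le by (auto simp: exit_at_def)
  ultimately show "\<bar>block_sum W k n w\<bar> \<le> c + b" by linarith
qed

text \<open>
  At its first exit from \<open>[-1, 1]\<close> the sum is barely larger than \<open>1\<close> in modulus, so its phase is
  at distance at least \<open>9 / 10\<close> from \<open>1\<close>. The terms before the exit have phase near \<open>1\<close> given the
  future, so the total is still away from the lattice, which is rare.
\<close>

lemma prob_exceed_one:
  assumes "m1 \<le> m" "m \<le> n"
  shows "prob (exceed 1 m n) \<le> 1 / 50"
proof -
  let ?c = "\<lambda>m n w. cmod (cis (block_sum W m n w) - 1)"
  let ?A = "exit_at 1 n"
  have int: "integrable M (\<lambda>w. indicator (?A k) w * ?c m' n' w)" for k m' n'
    using integrable_real_mult_indicator[OF exit_at_events integrable_cis] by (simp add: mult.commute)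
  have "8 / 10 * prob (?A k) \<le> expectation (\<lambda>w. indicator (?A k) w * ?c m n w)" if k: "k \<in> {m..n}" for k
  proof -
    have "9 / 10 * prob (?A k) = expectation (\<lambda>w. indicator (?A k) w * (9 / 10))" by simp
    also have "\<dots> \<le> expectation (\<lambda>w. indicator (?A k) w * ?c m n w + indicator (?A k) w * ?c m k w)"
    proof (intro integral_mono)
      fix w
      show "indicator (?A k) w * (9 / 10) \<le> indicator (?A k) w * ?c m n w + indicator (?A k) w * ?c m k w"
      proof (cases "w \<in> ?A k")
        case True
        have "9 / 10 \<le> cmod (cis (block_sum W k n w) - 1)"
          using exit_at_le(1)[OF True] True b_small by (intro cmod_cis_minus_one_ge) (auto simp: exit_at_def)
        also have "\<dots> = cmod (cis (block_sum W m k w) * (cis (block_sum W k n w) - 1))"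
          by (simp add: norm_mult)
        also have "cis (block_sum W m k w) * (cis (block_sum W k n w) - 1) =
            (cis (block_sum W m n w) - 1) - (cis (block_sum W m k w) - 1)"
          using block_sum_split[of m k n W w] k by (simp add: cis_mult algebra_simps)
        also have "cmod \<dots> \<le> ?c m n w + ?c m k w" by (rule norm_triangle_ineq4)
        finally show ?thesis using True by simp
      qed auto
    qed (use int in auto)
    also have "\<dots> = expectation (\<lambda>w. indicator (?A k) w * ?c m n w) + expectation (\<lambda>w. indicator (?A k) w * ?c m k w)"
      using int by simp
    also have "expectation (\<lambda>w. indicator (?A k) w * ?c m k w) \<le> prob (?A k) / 10"
      using k assms by (intro near_one_given_future exit_at_Future) auto
    finally show ?thesis by simp
  qed
  then have "(\<Sum>k\<in>{m..n}. 8 / 10 * prob (?A k)) \<le> (\<Sum>k\<in>{m..n}. expectation (\<lambda>w. indicator (?A k) w * ?c m n w))"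
    by (rule sum_mono)
  also have "\<dots> = expectation (\<lambda>w. \<Sum>k\<in>{m..n}. indicator (?A k) w * ?c m n w)"
    using int by (subst Bochner_Integration.integral_sum) auto
  also have "\<dots> \<le> expectation (?c m n)"
  proof (intro integral_mono)
    fix w
    have "(\<Sum>k\<in>{m..n}. indicator (?A k) w * ?c m n w) = indicator (\<Union>k\<in>{m..n}. ?A k) w * ?c m n w"
      using exit_at_disjoint[of 1 n m] by (simp add: indicator_UN_disjoint sum_distrib_right)
    also have "\<dots> \<le> ?c m n w" by (auto simp: indicator_def)
    finally show "(\<Sum>k\<in>{m..n}. indicator (?A k) w * ?c m n w) \<le> ?c m n w" .
  next
    show "integrable M (\<lambda>w. \<Sum>k\<in>{m..n}. indicator (?A k) w * ?c m n w)"
      by (intro Bochner_Integration.integrable_sum int)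
  qed auto
  also have "\<dots> \<le> 1 / 100" by (rule near_one[OF assms])
  finally show ?thesis unfolding prob_exceed sum_distrib_left[symmetric] by simp
qed

text \<open>
  The exit estimate holds conditionally on the future too; the level is raised from \<open>1\<close> to \<open>2\<close>
  to absorb the gap and the localisation error.
\<close>

lemma prob_exceed_two_given_future:
  assumes A: "A \<in> sets (Future k)" and m: "m1 \<le> m" "m \<le> k"
  shows "prob (A \<inter> (exceed 2 m k)) \<le> prob A / 4"
proof -
  have [measurable]: "A \<in> events" using A by (rule Future_events)
  show ?thesis
  proof (cases "k < m + l")
    case True
    have "\<bar>block_sum W j k w\<bar> \<le> 2" if "w \<in> space M" "j \<in> {m..k}" for w j
      using True b_small short_block_sum[of w k j] that by auto
    then have none: "exceed 2 m k = {}" by (auto simp: not_less)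
    show ?thesis unfolding none by simp
  next
    case False
    define p where "p = k - l"
    have p: "m \<le> p" "p + l = k" "p \<le> k" using False by (auto simp: p_def)
    have "\<forall>j\<in>{m..p}. \<exists>r\<in>borel_measurable (Past p). \<forall>w\<in>space M. \<bar>block_sum W j p w - r w\<bar> \<le> b"
      using memory unfolding short_memory_def by auto
    then obtain r where r: "\<And>j. j \<in> {m..p} \<Longrightarrow> r j \<in> borel_measurable (Past p)"
        "\<And>j w. j \<in> {m..p} \<Longrightarrow> w \<in> space M \<Longrightarrow> \<bar>block_sum W j p w - r j w\<bar> \<le> b"
      by metis
    define E where "E = {w \<in> space (Past p). \<exists>j\<in>{m..p}. 3 / 2 < \<bar>r j w\<bar>}"
    have E: "E \<in> sets (Past p)" unfolding E_def
      by (intro sets.sets_Collect_finite_Ex) (use r(1) in \<open>auto intro!: borel_measurable_less borel_measurable_abs simp del: space_Past\<close>)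
    have "1 < \<bar>block_sum W j p w\<bar>" if "j \<in> {m..p}" "w \<in> space M" "3 / 2 < \<bar>r j w\<bar>" for j w
      using r(2)[OF that(1,2)] b_small that(3) by linarith
    then have "E \<subseteq> exceed 1 m p"
      unfolding E_def by fastforce
    then have "prob E \<le> prob (exceed 1 m p)"
      by (intro finite_measure_mono) auto
    also have "\<dots> \<le> 1 / 50" using m p by (intro prob_exceed_one) auto
    finally have PE: "prob E \<le> 1 / 50" .
    have "A \<inter> (exceed 2 m k) \<subseteq> E \<inter> A"
    proof
      fix w assume "w \<in> A \<inter> (exceed 2 m k)"
      then obtain j where w: "w \<in> space M" "w \<in> A" and j: "j \<in> {m..k}" "2 < \<bar>block_sum W j k w\<bar>" by auto
      have "j \<le> p"
        using short_block_sum[OF w(1), of k j] b_small j p by (cases "j \<le> p") auto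
      then have "block_sum W j k w = block_sum W j p w + block_sum W p k w"
        using p by (intro block_sum_split) auto
      moreover have "\<bar>block_sum W p k w\<bar> \<le> l * b" using short_block_sum[OF w(1), of k p] p by auto
      moreover have "\<bar>block_sum W j p w - r j w\<bar> \<le> b" using r(2) w j \<open>j \<le> p\<close> by auto
      ultimately have "3 / 2 < \<bar>r j w\<bar>" using j b_small by linarith
      then show "w \<in> E \<inter> A" using w j \<open>j \<le> p\<close> by (auto simp: E_def)
    qed
    then have "prob (A \<inter> (exceed 2 m k)) \<le> prob (E \<inter> A)"
      using Past_events[OF E] by (intro finite_measure_mono) auto
    also have "\<dots> \<le> prob E * prob A + \<phi> l * prob A"
      using mixing[of p l E A] E A gap start m p by (auto simp: abs_le_iff)
    also have "\<dots> \<le> 1 / 50 * prob A + 1 / 100 * prob A"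
      using PE gap by (intro add_mono mult_right_mono) auto
    also have "\<dots> \<le> prob A / 4" by simp
    finally show ?thesis .
  qed
qed

text \<open>
  After a first exit above \<open>3 * i\<close>, overshooting by at most one step, reaching \<open>3 * (i + 1)\<close> needs
  a further oscillation of size \<open>2\<close>, and this has conditional probability at most \<open>1 / 4\<close>.
\<close>

lemma prob_exceed_geometric:
  assumes "m1 \<le> m" "m \<le> n"
  shows "prob (exceed (3 * real i) m n) \<le> (1 / 4) ^ i"
proof (induction i)
  case 0
  then show ?case by simp
next
  case (Suc i)
  let ?A = "exit_at (3 * real i) n"
  let ?B = "\<lambda>k. (exceed 2 m k)"
  have "(exceed (3 * real (Suc i)) m n) \<subseteq> (\<Union>k\<in>{m..n}. ?A k \<inter> ?B k)"
  proof
    fix w assume "w \<in> (exceed (3 * real (Suc i)) m n)"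
    then obtain j where w: "w \<in> space M" and j: "j \<in> {m..n}" "3 * real i + 3 < \<bar>block_sum W j n w\<bar>" by auto
    then have "w \<in> (\<Union>k\<in>{m..n}. ?A k)"
      unfolding exceed_eq_exit_at[symmetric] by force
    then obtain k where k: "k \<in> {m..n}" "w \<in> ?A k" by auto
    have "j \<le> k"
    proof (rule ccontr)
      assume "\<not> j \<le> k"
      then have "j \<in> {k<..n}" using j by auto
      then have "\<bar>block_sum W j n w\<bar> \<le> 3 * real i" using k(2) unfolding exit_at_def by blast
      then show False using j by linarith
    qed
    then have "block_sum W j n w = block_sum W j k w + block_sum W k n w"
      using k by (intro block_sum_split) auto
    moreover have "\<bar>block_sum W k n w\<bar> \<le> 3 * real i + b" using exit_at_le[OF k(2)] by simp
    ultimately have "2 < \<bar>block_sum W j k w\<bar>" using j(2) b_small by linarith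
    then have "w \<in> ?B k" using j \<open>j \<le> k\<close> w by auto
    then show "w \<in> (\<Union>k\<in>{m..n}. ?A k \<inter> ?B k)" using k by blast
  qed
  then have "prob (exceed (3 * real (Suc i)) m n) \<le> prob (\<Union>k\<in>{m..n}. ?A k \<inter> ?B k)"
    by (intro finite_measure_mono) auto
  also have "\<dots> \<le> (\<Sum>k\<in>{m..n}. prob (?A k \<inter> ?B k))"
    by (intro finite_measure_subadditive_finite) auto
  also have "\<dots> \<le> (\<Sum>k\<in>{m..n}. prob (?A k) / 4)"
    using assms by (intro sum_mono prob_exceed_two_given_future exit_at_Future) auto
  also have "\<dots> = prob (exceed (3 * real i) m n) / 4"
    unfolding prob_exceed sum_divide_distrib ..
  also have "\<dots> \<le> (1 / 4) ^ Suc i" using Suc by simp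
  finally show ?case .
qed

text \<open>
  The geometric tails are summed over the layers \<open>3 * i < \<bar>x\<bar> \<le> 3 * (i + 1)\<close>, where \<open>x\<^sup>2\<close> is
  at most the sum of \<open>9 * (2 * i + 1)\<close> over the layers below.
\<close>

theorem second_moment_le:
  assumes "m1 \<le> n"
  shows "expectation (\<lambda>w. (block_sum W m1 n w)\<^sup>2) \<le> 36"
proof -
  let ?S = "block_sum W m1 n"
  let ?A = "\<lambda>i. {w \<in> space M. 3 * real i < \<bar>?S w\<bar>}"
  have A: "?A i \<in> events" for i by measurable
  have layers: "x\<^sup>2 \<le> (\<Sum>i<N. 9 * (2 * real i + 1) * (if 3 * real i < \<bar>x\<bar> then 1 else 0))"
    if "\<bar>x\<bar> \<le> 3 * real N" for x :: real and N
    using that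
  proof (induction N)
    case (Suc N)
    show ?case
    proof (cases "3 * real N < \<bar>x\<bar>")
      case True
      have "(\<Sum>i<k. 9 * (2 * real i + 1)) = 9 * (real k)\<^sup>2" for k
        by (induction k) (auto simp: algebra_simps power2_eq_square)
      moreover have "(\<Sum>i<Suc N. 9 * (2 * real i + 1) * (if 3 * real i < \<bar>x\<bar> then 1 else 0)) = (\<Sum>i<Suc N. 9 * (2 * real i + 1))"
        using True by (intro sum.cong) auto
      moreover have "\<bar>x\<bar>\<^sup>2 \<le> (3 * real (Suc N))\<^sup>2" using Suc.prems by (intro power_mono) auto
      ultimately show ?thesis by (simp only: power_mult_distrib power2_abs) simp
    next
      case False
      then show ?thesis using Suc.IH by simp
    qed
  qed simp
  obtain N :: nat where N: "real (n - m1) * b \<le> 3 * real N"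
    using real_arch_simple[of "real (n - m1) * b"] by (metis mult_le_cancel_right1 not_less of_nat_0_le_iff order_trans one_le_numeral)
  have "expectation (\<lambda>w. (?S w)\<^sup>2) \<le> expectation (\<lambda>w. \<Sum>i<N. 9 * (2 * real i + 1) * indicator (?A i) w)"
  proof (intro integral_mono short_memory_block_sum[OF memory])
    fix w assume w: "w \<in> space M"
    have "\<bar>?S w\<bar> \<le> 3 * real N" using short_memory_block_sum(2)[OF memory w, of m1 n] N by auto
    from layers[OF this] show "(?S w)\<^sup>2 \<le> (\<Sum>i<N. 9 * (2 * real i + 1) * indicator (?A i) w)"
    proof (rule order_trans[OF _ eq_refl], intro sum.cong)
      show "9 * (2 * real i + 1) * (if 3 * real i < \<bar>?S w\<bar> then 1 else 0) = 9 * (2 * real i + 1) * indicator (?A i) w" for i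
        using w by (simp add: indicator_def)
    qed simp
  next
    show "integrable M (\<lambda>w. \<Sum>i<N. 9 * (2 * real i + 1) * indicator (?A i) w)"
      using A by (intro Bochner_Integration.integrable_sum) auto
  qed
  also have "\<dots> = (\<Sum>i<N. 9 * (2 * real i + 1) * prob (?A i))"
    using A by (subst Bochner_Integration.integral_sum) auto
  also have "\<dots> \<le> (\<Sum>i<N. 18 * (1 / 2) ^ i)"
  proof (intro sum_mono)
    fix i
    have "?A i \<subseteq> (exceed (3 * real i) m1 n)"
      using assms by auto
    then have "prob (?A i) \<le> prob (exceed (3 * real i) m1 n)"
      by (intro finite_measure_mono) auto
    also have "\<dots> \<le> (1 / 4) ^ i" using assms by (intro prob_exceed_geometric) auto
    finally have P: "prob (?A i) \<le> (1 / 4) ^ i" .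
    have "real i + 1 \<le> 2 ^ i" by (induction i) auto
    then have "2 * real i + 1 \<le> 2 * 2 ^ i" by linarith
    then have "9 * (2 * real i + 1) * prob (?A i) \<le> 9 * (2 * 2 ^ i) * (1 / 4) ^ i"
      using P by (intro mult_mono) auto
    also have "\<dots> = 18 * (1 / 2) ^ i"
    proof -
      have "(2 :: real) ^ i * (1 / 4) ^ i = (1 / 2) ^ i" by (simp add: power_mult_distrib[symmetric])
      then show ?thesis by simp
    qed
    finally show "9 * (2 * real i + 1) * prob (?A i) \<le> 18 * (1 / 2) ^ i" .
  qed
  also have "\<dots> = 18 * (\<Sum>i<N. (1 / 2) ^ i)" by (simp add: sum_distrib_left)
  also have "\<dots> \<le> 18 * 2"
    using sum_gp_strict[of "1 / 2 :: real" N] by simp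
  finally show ?thesis by simp
qed

end

section \<open>Tight sums are multiplicative coboundaries\<close>

lemma measurable_cnj [measurable]: "cnj \<in> borel_measurable borel"
  by (intro borel_measurable_continuous_onI continuous_intros)

text \<open>
  The point \<open>c * sgn x\<close> is the radial projection of \<open>x\<close> to the circle of radius \<open>c\<close>. This
  bounds the variation of \<open>sgn\<close> along points whose modulus is close to a common \<open>c > 0\<close>.
\<close>

lemma sgn_scaled_diff_le: "0 \<le> c \<Longrightarrow> cmod (of_real c * sgn x - x) \<le> \<bar>cmod x - c\<bar>" for x :: complex
proof (cases "x = 0")
  case False
  have "of_real c * sgn x - x = of_real (c - cmod x) * sgn x"
    using False by (simp add: sgn_eq field_simps)
  then show ?thesis using False by (simp add: norm_mult norm_sgn abs_minus_commute flip: of_real_diff)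
qed simp

lemma sgn_diff_le:
  assumes "0 \<le> c"
  shows "c * cmod (sgn x - sgn y) \<le> cmod (x - y) + \<bar>cmod x - c\<bar> + \<bar>cmod y - c\<bar>"
proof -
  have "c * cmod (sgn x - sgn y) = cmod (of_real c * sgn x - of_real c * sgn y)"
    using assms by (simp add: norm_mult flip: right_diff_distrib)
  also have "of_real c * sgn x - of_real c * sgn y = (of_real c * sgn x - x) + (x - y) - (of_real c * sgn y - y)" by simp
  also have "cmod \<dots> \<le> cmod (of_real c * sgn x - x) + cmod (x - y) + cmod (of_real c * sgn y - y)"
    by (meson norm_triangle_ineq norm_triangle_ineq4 add_right_mono order_trans)
  finally show ?thesis
    using sgn_scaled_diff_le[OF assms, of x] sgn_scaled_diff_le[OF assms, of y] by linarith
qed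

lemma (in prob_space) expectation_cis_near_one:
  assumes X[measurable]: "X \<in> borel_measurable M" and "0 \<le> s" "0 \<le> K"
  shows "expectation (\<lambda>w. cmod (cis (s * X w) - 1)) \<le> s * K + 2 * prob {w \<in> space M. K < \<bar>X w\<bar>}"
proof -
  let ?A = "{w \<in> space M. K < \<bar>X w\<bar>}"
  have A: "?A \<in> events" by measurable
  have two: "cmod (cis (s * X w) - 1) \<le> 2" for w using norm_triangle_ineq4[of "cis (s * X w)" 1] by simp
  have "expectation (\<lambda>w. cmod (cis (s * X w) - 1)) \<le> expectation (\<lambda>w. s * K + 2 * indicator ?A w)"
  proof (intro integral_mono)
    show "integrable M (\<lambda>w. cmod (cis (s * X w) - 1))"
      by (intro integrable_cmod_diff[where p = 1 and q = 1]) auto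
    fix w assume w: "w \<in> space M"
    show "cmod (cis (s * X w) - 1) \<le> s * K + 2 * indicator ?A w"
    proof (cases "w \<in> ?A")
      case True
      then show ?thesis using two[of w] assms by (simp add: add_increasing)
    next
      case False
      then have "\<bar>X w\<bar> \<le> K" using w by auto
      then have "\<bar>s * X w\<bar> \<le> s * K" using assms by (simp add: abs_mult mult_left_mono)
      then show ?thesis using cmod_cis_diff_le[of "s * X w" 0] False by simp
    qed
  qed (use A in auto)
  then show ?thesis using A by (simp add: prob_space)
qed

text \<open>
  A version of the conditional expectation that is bounded everywhere, characterised by
  testing against bounded functions.
\<close>

lemma (in prob_space) bounded_conditional_expectation:
  fixes U :: "'a \<Rightarrow> real"
  assumes F: "subalgebra M F" and U[measurable]: "U \<in> borel_measurable M" and U1: "\<And>w. w \<in> space M \<Longrightarrow> \<bar>U w\<bar> \<le> 1"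
  obtains G :: "'a \<Rightarrow> real" where "G \<in> borel_measurable F" "\<And>w. \<bar>G w\<bar> \<le> 1"
    "\<And>(Z :: 'a \<Rightarrow> real) B. Z \<in> borel_measurable F \<Longrightarrow> (\<And>w. w \<in> space M \<Longrightarrow> \<bar>Z w\<bar> \<le> B) \<Longrightarrow>
      expectation (\<lambda>w. Z w * G w) = expectation (\<lambda>w. Z w * U w)"
proof -
  interpret finite_measure_subalgebra M F
    using F by unfold_locales
  define G0 where "G0 = real_cond_exp M F U"
  define G where "G = (\<lambda>w. max (- 1) (min 1 (G0 w)))"
  have G0[measurable]: "G0 \<in> borel_measurable F" by (simp add: G0_def)
  have G[measurable]: "G \<in> borel_measurable F" unfolding G_def by measurable
  have [measurable]: "G0 \<in> borel_measurable M" "G \<in> borel_measurable M"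
    using measurable_from_subalg[OF F G0] measurable_from_subalg[OF F G] by auto
  have iU: "integrable M U" using U1 by (intro integrable_bounded[where B = 1]) auto
  have "AE w in M. G0 w \<le> 1" "AE w in M. G0 w \<ge> - 1"
    unfolding G0_def using U1 iU by (intro real_cond_exp_le_c real_cond_exp_ge_c AE_I2; force)+
  then have eq: "AE w in M. G w = G0 w" by eventually_elim (simp add: G_def)
  show thesis
  proof (rule that[OF G])
    show "\<bar>G w\<bar> \<le> 1" for w by (auto simp: G_def)
    fix Z :: "'a \<Rightarrow> real" and B assume Z[measurable]: "Z \<in> borel_measurable F" and B: "\<And>w. w \<in> space M \<Longrightarrow> \<bar>Z w\<bar> \<le> B"
    have [measurable]: "Z \<in> borel_measurable M" by (rule measurable_from_subalg[OF F Z])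
    have "expectation (\<lambda>w. Z w * G w) = expectation (\<lambda>w. Z w * G0 w)"
      using eq by (intro integral_cong_AE) auto
    also have "\<dots> = expectation (\<lambda>w. Z w * U w)"
      unfolding G0_def
    proof (rule real_cond_exp_intg(2))
      show "integrable M (\<lambda>w. Z w * U w)"
      proof (rule integrable_bounded)
        show "norm (Z w * U w) \<le> B * 1" if "w \<in> space M" for w
          using mult_mono[OF B[OF that] U1[OF that]] B[OF that] by (simp add: abs_mult)
      qed measurable
    qed auto
    finally show "expectation (\<lambda>w. Z w * G w) = expectation (\<lambda>w. Z w * U w)" .
  qed
qed

text \<open>
  The bound \<open>2\<close> comes from bounding the real and the imaginary part separately by \<open>1\<close>.
\<close>

lemma (in prob_space) bounded_conditional_expectation_complex:
  fixes U :: "'a \<Rightarrow> complex"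
  assumes F: "subalgebra M F" and U[measurable]: "U \<in> borel_measurable M" and U1: "\<And>w. w \<in> space M \<Longrightarrow> cmod (U w) \<le> 1"
  obtains G where "G \<in> borel_measurable F" "\<And>w. cmod (G w) \<le> 2"
    "\<And>Z B. Z \<in> borel_measurable F \<Longrightarrow> (\<And>w. w \<in> space M \<Longrightarrow> cmod (Z w) \<le> B) \<Longrightarrow>
      expectation (\<lambda>w. Re (Z w * G w)) = expectation (\<lambda>w. Re (Z w * U w))"
proof -
  have "\<bar>Re (U w)\<bar> \<le> 1" if "w \<in> space M" for w using abs_Re_le_cmod[of "U w"] U1[OF that] by linarith
  then obtain G1 where G1[measurable]: "G1 \<in> borel_measurable F" and G1b: "\<And>w. \<bar>G1 w\<bar> \<le> 1"
    and E1: "\<And>Z B. Z \<in> borel_measurable F \<Longrightarrow> (\<And>w. w \<in> space M \<Longrightarrow> \<bar>Z w\<bar> \<le> B) \<Longrightarrow>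
      expectation (\<lambda>w. Z w * G1 w) = expectation (\<lambda>w. Z w * Re (U w))"
    using bounded_conditional_expectation[OF F, of "\<lambda>w. Re (U w)"] by auto
  have "\<bar>Im (U w)\<bar> \<le> 1" if "w \<in> space M" for w using abs_Im_le_cmod[of "U w"] U1[OF that] by linarith
  then obtain G2 where G2[measurable]: "G2 \<in> borel_measurable F" and G2b: "\<And>w. \<bar>G2 w\<bar> \<le> 1"
    and E2: "\<And>Z B. Z \<in> borel_measurable F \<Longrightarrow> (\<And>w. w \<in> space M \<Longrightarrow> \<bar>Z w\<bar> \<le> B) \<Longrightarrow>
      expectation (\<lambda>w. Z w * G2 w) = expectation (\<lambda>w. Z w * Im (U w))"
    using bounded_conditional_expectation[OF F, of "\<lambda>w. Im (U w)"] by auto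
  show thesis
  proof (rule that[of "\<lambda>w. of_real (G1 w) + \<i> * of_real (G2 w)"])
    show "(\<lambda>w. of_real (G1 w) + \<i> * of_real (G2 w)) \<in> borel_measurable F" by measurable
    show "cmod (of_real (G1 w) + \<i> * of_real (G2 w)) \<le> 2" for w
      using norm_triangle_ineq[of "of_real (G1 w)" "\<i> * of_real (G2 w)"] G1b[of w] G2b[of w]
      by (simp add: norm_mult)
    fix Z :: "'a \<Rightarrow> complex" and B assume Z[measurable]: "Z \<in> borel_measurable F" and B: "\<And>w. w \<in> space M \<Longrightarrow> cmod (Z w) \<le> B"
    have [measurable]: "Z \<in> borel_measurable M" "G1 \<in> borel_measurable M" "G2 \<in> borel_measurable M"
      using measurable_from_subalg[OF F Z] measurable_from_subalg[OF F G1] measurable_from_subalg[OF F G2] by auto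
    have ZR: "\<bar>Re (Z w)\<bar> \<le> B" and ZI: "\<bar>Im (Z w)\<bar> \<le> B" if "w \<in> space M" for w
      using abs_Re_le_cmod[of "Z w"] abs_Im_le_cmod[of "Z w"] B[OF that] by linarith+
    have int: "integrable M (\<lambda>w. X w * Y w)"
      if [measurable]: "X \<in> borel_measurable M" "Y \<in> borel_measurable M"
        and X: "\<And>w. w \<in> space M \<Longrightarrow> \<bar>X w\<bar> \<le> B" and Y: "\<And>w. w \<in> space M \<Longrightarrow> \<bar>Y w\<bar> \<le> 1" for X Y :: "'a \<Rightarrow> real"
    proof (rule integrable_bounded)
      show "norm (X w * Y w) \<le> B * 1" if "w \<in> space M" for w
        using mult_mono[OF X[OF that] Y[OF that]] X[OF that] by (simp add: abs_mult)
    qed measurable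
    have UR: "\<bar>Re (U w)\<bar> \<le> 1" and UI: "\<bar>Im (U w)\<bar> \<le> 1" if "w \<in> space M" for w
      using abs_Re_le_cmod[of "U w"] abs_Im_le_cmod[of "U w"] U1[OF that] by linarith+
    have "expectation (\<lambda>w. Re (Z w * (of_real (G1 w) + \<i> * of_real (G2 w))))
      = expectation (\<lambda>w. Re (Z w) * G1 w - Im (Z w) * G2 w)" by simp
    also have "\<dots> = expectation (\<lambda>w. Re (Z w) * G1 w) - expectation (\<lambda>w. Im (Z w) * G2 w)"
      using ZR ZI G1b G2b by (intro Bochner_Integration.integral_diff int) auto
    also have "\<dots> = expectation (\<lambda>w. Re (Z w) * Re (U w)) - expectation (\<lambda>w. Im (Z w) * Im (U w))"
      using ZR ZI by (intro arg_cong2[where f = "(-)"] E1 E2) auto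
    also have "\<dots> = expectation (\<lambda>w. Re (Z w) * Re (U w) - Im (Z w) * Im (U w))"
      using ZR ZI UR UI by (intro Bochner_Integration.integral_diff[symmetric] int) auto
    finally show "expectation (\<lambda>w. Re (Z w * (of_real (G1 w) + \<i> * of_real (G2 w)))) = expectation (\<lambda>w. Re (Z w * U w))"
      by simp
  qed
qed

context mixing_filtrations
begin

text \<open>
  The estimate has to hold for \<open>m\<close> and \<open>n\<close> beyond one common threshold, however far apart
  they are: this uniformity is what excludes an accumulation of small errors over long blocks.
\<close>

definition asymptotic_coboundary :: "(nat \<Rightarrow> 'w \<Rightarrow> real) \<Rightarrow> (nat \<Rightarrow> 'w \<Rightarrow> complex) \<Rightarrow> bool" where
  "asymptotic_coboundary \<theta> g \<longleftrightarrow>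
    (\<forall>n. g n \<in> borel_measurable (Future n)) \<and> (\<forall>n w. cmod (g n w) \<le> 1) \<and>
    (\<forall>\<epsilon>>0. \<exists>N. \<forall>n\<ge>N. 1 - \<epsilon> \<le> expectation (\<lambda>w. cmod (g n w)) \<and>
      (\<forall>m\<in>{N..n}. expectation (\<lambda>w. cmod (g n w - cis (block_sum \<theta> m n w) * g m w)) \<le> \<epsilon>))"

lemma L1_deviation_le:
  assumes k: "1 \<le> k" "1 \<le> l" and Y: "Y \<in> borel_measurable (Past k)"
    and Y1: "\<And>w. w \<in> space M \<Longrightarrow> \<bar>Y w\<bar> \<le> 1"
    and Z: "Z \<in> borel_measurable (Future (k + l))"
    and Z1: "\<And>w. w \<in> space M \<Longrightarrow> \<bar>Z w\<bar> \<le> 1"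
    and t: "0 \<le> t" "4 * \<phi> l + 2 * expectation (\<lambda>w. \<bar>Z w - Y w\<bar>) \<le> t\<^sup>2"
  shows "expectation (\<lambda>w. \<bar>Z w - expectation Z\<bar>) \<le> t"
proof -
  have [measurable]: "Z \<in> borel_measurable M" using measurable_Future[OF Z] .
  have "\<bar>Z w - expectation Z\<bar> \<le> 1 + \<bar>expectation Z\<bar>" if "w \<in> space M" for w
    using Z1[OF that] by linarith
  then have "(expectation (\<lambda>w. \<bar>Z w - expectation Z\<bar>))\<^sup>2 \<le> expectation (\<lambda>w. \<bar>Z w - expectation Z\<bar>\<^sup>2)"
    by (intro square_expectation_le[where B = "1 + \<bar>expectation Z\<bar>"]) auto
  also have "\<dots> \<le> t\<^sup>2"
    using variance_le_of_approximation[OF k Y Y1 Z Z1] t by simp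
  finally show ?thesis using t(1) by (rule power2_le_imp_le)
qed

text \<open>
  The functions \<open>G n\<close> are conditional expectations of \<open>cis (s * S)\<close> where \<open>s = 2 * pi / k\<close>
  is a small fraction of the wanted frequency, and \<open>g n\<close> is the \<open>k\<close>-th power of the phase of \<open>G n\<close>.
  By the near independence of past and future the modulus of \<open>G n\<close> is asymptotically constant,
  and this constant is at least \<open>1 / 2\<close>; hence taking phases preserves closeness in \<open>L\<^sup>1\<close>.
\<close>

theorem tight_sums_asymptotic_coboundary:
  fixes H :: "nat \<Rightarrow> 'w \<Rightarrow> real"
  assumes H: "\<And>j. H j \<in> borel_measurable (Future j)"
    and tight: "\<And>\<epsilon>. 0 < \<epsilon> \<Longrightarrow> \<exists>K. \<forall>n. prob (tail (block_sum H 0 n) K) \<le> \<epsilon>"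
  shows "\<exists>g. asymptotic_coboundary (\<lambda>j w. 2 * pi * H j w) g"
proof -
  let ?\<theta> = "block_sum (\<lambda>j w. 2 * pi * H j w)"
  have SF: "block_sum H m n \<in> borel_measurable (Future m)" for m n by (rule block_sum_Future[OF H])
  have S[measurable]: "block_sum H m n \<in> borel_measurable M" for m n by (rule measurable_Future[OF SF])
  obtain K0 where K0: "\<And>n. prob (tail (block_sum H 0 n) K0) \<le> 1 / 8"
    using tight[of "1 / 8"] by auto
  define K where "K = max K0 0"
  have K: "0 \<le> K" "prob (tail (block_sum H 0 n) K) \<le> 1 / 8" for n
    using order_trans[OF finite_measure_mono K0[of n], of "(tail (block_sum H 0 n) K)"]
    by (auto simp: K_def)
  \<comment> \<open>The frequency \<open>s\<close> is chosen so small that the tight sums, up to probability \<open>1 / 8\<close>, move the phase by at most \<open>1 / 4\<close>.\<close>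
  obtain k where k: "8 * pi * K \<le> real k" "1 \<le> k"
    using real_arch_simple[of "max 1 (8 * pi * K)"] by auto
  define s where "s = 2 * pi / real k"
  have s: "0 \<le> s" "s * K \<le> 1 / 4" "real k * s = 2 * pi"
    using k by (auto simp: s_def field_simps)
  define c where "c = (\<lambda>m n w. cis (s * block_sum H m n w))"
  have cF: "c m n \<in> borel_measurable (Future m)" for m n
    using SF[of m n] unfolding c_def by measurable
  have [measurable]: "c m n \<in> borel_measurable M" for m n by (rule measurable_Future[OF cF])
  have c1: "cmod (c m n w) = 1" for m n w by (simp add: c_def)
  have c_split: "c i n w = c i m w * c m n w" if "i \<le> m" "m \<le> n" for i m n w
    using block_sum_split[OF that, of H w] by (simp add: c_def cis_mult distrib_left)
  have "\<exists>G. G \<in> borel_measurable (Future n) \<and> (\<forall>w. cmod (G w) \<le> 2) \<and>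
    (\<forall>Z B. Z \<in> borel_measurable (Future n) \<longrightarrow> (\<forall>w\<in>space M. cmod (Z w) \<le> B) \<longrightarrow>
      expectation (\<lambda>w. Re (Z w * G w)) = expectation (\<lambda>w. Re (Z w * c 0 n w)))" for n
  proof (rule bounded_conditional_expectation_complex[OF Future_subalgebra])
    show "c 0 n \<in> borel_measurable M" by measurable
    show "cmod (c 0 n w) \<le> 1" for w by (simp add: c1)
  qed blast
  then obtain G where GF: "\<And>n. G n \<in> borel_measurable (Future n)" and G2: "\<And>n w. cmod (G n w) \<le> 2"
    and GE: "\<And>n Z B. Z \<in> borel_measurable (Future n) \<Longrightarrow> (\<And>w. w \<in> space M \<Longrightarrow> cmod (Z w) \<le> B) \<Longrightarrow>
      expectation (\<lambda>w. Re (Z w * G n w)) = expectation (\<lambda>w. Re (Z w * c 0 n w))"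
    by metis
  have [measurable]: "G n \<in> borel_measurable M" for n by (rule measurable_Future[OF GF])
  have iG: "integrable M (\<lambda>w. cmod (G n w))" for n
    using G2 by (intro integrable_bounded[where B = 2]) auto
  have iG2: "integrable M (\<lambda>w. (cmod (G n w))\<^sup>2)" for n
    using power_mono[OF G2, of _ _ 2] by (intro integrable_bounded[where B = 4]) auto
  let ?D = "\<lambda>m n w. cmod (G n w - c m n w * G m w)"
  have cG2: "?D m n w \<le> 4" for m n w
    using norm_triangle_ineq4[of "G n w" "c m n w * G m w"] G2[of n w] G2[of m w] c1[of m n w] by (simp add: norm_mult)
  have icG: "integrable M (\<lambda>w. ?D m n w)" for m n
    using cG2 by (intro integrable_bounded[where B = 4]) auto

  \<comment> \<open>Orthogonality of the increments: \<open>G n\<close> is the conditional expectation of \<open>c m n * G m\<close> given the future of \<open>n\<close>.\<close>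
  define e where "e = (\<lambda>n. expectation (\<lambda>w. (cmod (G n w))\<^sup>2))"
  have pythagoras: "expectation (\<lambda>w. (?D m n w)\<^sup>2) = e m - e n" if mn: "m \<le> n" for m n
  proof -
    have bound: "cmod (cnj (G n w) * c m n w) \<le> 2" for w using G2 c1 by (simp add: norm_mult)
    have bound2: "\<bar>Re (cnj (G n w) * c m n w * G m w)\<bar> \<le> 4" for w
      using abs_Re_le_cmod[of "cnj (G n w) * c m n w * G m w"] mult_mono[OF bound[of w] G2[of m w]] by (simp add: norm_mult)
    have int: "integrable M (\<lambda>w. Re (cnj (G n w) * c m n w * G m w))"
      by (intro integrable_bounded[where B = 4]) (use bound2 in auto)
    have "expectation (\<lambda>w. Re (cnj (G n w) * c m n w * G m w)) = expectation (\<lambda>w. Re (cnj (G n w) * c m n w * c 0 m w))"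
    proof (rule GE[OF _ bound])
      show "(\<lambda>w. cnj (G n w) * c m n w) \<in> borel_measurable (Future m)"
        using measurable_Future_mono[OF GF mn] cF[of m n] by measurable
    qed
    also have "\<dots> = expectation (\<lambda>w. Re (cnj (G n w) * c 0 n w))"
      using c_split[OF _ mn, of 0] by (simp add: mult.commute mult.left_commute)
    also have "\<dots> = expectation (\<lambda>w. Re (cnj (G n w) * G n w))"
    proof (rule GE[symmetric])
      show "(\<lambda>w. cnj (G n w)) \<in> borel_measurable (Future n)"
        using GF[of n] by measurable
      show "cmod (cnj (G n w)) \<le> 2" for w using G2 by simp
    qed
    also have "\<dots> = e n" unfolding e_def
      by (intro Bochner_Integration.integral_cong) (auto simp: cmod_power2 simp flip: power2_eq_square)
    finally have cross: "expectation (\<lambda>w. Re (cnj (G n w) * c m n w * G m w)) = e n" .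
    have "(?D m n w)\<^sup>2 = (cmod (G n w))\<^sup>2 + (cmod (G m w))\<^sup>2 - 2 * Re (cnj (G n w) * c m n w * G m w)" for w
    proof -
      have "(cmod (x - y))\<^sup>2 = (cmod x)\<^sup>2 + (cmod y)\<^sup>2 - 2 * Re (cnj x * y)" for x y
        by (simp add: cmod_power2 power2_diff algebra_simps)
      from this[of "G n w" "c m n w * G m w"] show ?thesis using c1[of m n w] by (simp add: norm_mult mult.assoc)
    qed
    then have "expectation (\<lambda>w. (?D m n w)\<^sup>2) = e n + e m - 2 * e n"
      unfolding e_def using iG2 int cross
      by (simp only: Bochner_Integration.integral_add Bochner_Integration.integral_diff
          Bochner_Integration.integrable_add integral_mult_right_zero Bochner_Integration.integrable_mult_right e_def)
    then show ?thesis by simp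
  qed
  have "decseq e"
    unfolding decseq_def
  proof (intro allI impI)
    fix m n :: nat assume "m \<le> n"
    from pythagoras[OF this] have "0 \<le> e m - e n" using integral_nonneg_AE[of "\<lambda>w. (?D m n w)\<^sup>2" M] by simp
    then show "e n \<le> e m" by simp
  qed
  moreover have "\<forall>n. 0 \<le> e n"
    by (auto simp: e_def intro!: integral_nonneg_AE)
  ultimately obtain e' where "e \<longlonglongrightarrow> e'" by (rule decseq_convergent)
  then have "Cauchy e" by (intro convergent_Cauchy convergentI)
  have cauchy: "\<exists>N. \<forall>m\<ge>N. \<forall>n\<ge>m. expectation (\<lambda>w. ?D m n w) \<le> \<epsilon>" if eps: "0 < \<epsilon>" for \<epsilon>
  proof -
    obtain N where N: "\<And>m n. m \<ge> N \<Longrightarrow> n \<ge> N \<Longrightarrow> dist (e m) (e n) < \<epsilon>\<^sup>2"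
      using metric_CauchyD[OF \<open>Cauchy e\<close>, of "\<epsilon>\<^sup>2"] zero_less_power[OF eps, of 2] by blast
    have "expectation (\<lambda>w. ?D m n w) \<le> \<epsilon>" if mn: "N \<le> m" "m \<le> n" for m n
    proof -
      have "(expectation (\<lambda>w. ?D m n w))\<^sup>2 \<le> expectation (\<lambda>w. (?D m n w)\<^sup>2)"
        using cG2 by (intro square_expectation_le[where B = 4]) auto
      also have "\<dots> = e m - e n" by (rule pythagoras[OF mn(2)])
      also have "\<dots> \<le> \<epsilon>\<^sup>2" using N[of m n] mn by (auto simp: dist_real_def)
      finally show ?thesis by (rule power2_le_imp_le) (use \<open>0 < \<epsilon>\<close> in simp)
    qed
    then show ?thesis by blast
  qed
  have half: "1 / 2 \<le> expectation (\<lambda>w. cmod (G n w))" for n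
  proof -
    have "expectation (\<lambda>w. cmod (cis (s * block_sum H 0 n w) - 1)) \<le> 1 / 2"
      using expectation_cis_near_one[of "block_sum H 0 n" s K] s K(1) K(2)[of n] by auto
    moreover have "integrable M (\<lambda>w. cmod (c 0 n w - 1))"
      using c1 by (intro integrable_cmod_diff[where p = 1 and q = 1]) auto
    moreover have "expectation (\<lambda>w. 1 - cmod (c 0 n w - 1)) \<le> expectation (\<lambda>w. Re (c 0 n w))"
    proof (intro integral_mono)
      show "1 - cmod (c 0 n w - 1) \<le> Re (c 0 n w)" for w
        using abs_Re_le_cmod[of "c 0 n w - 1"] by (simp add: abs_le_iff)
      show "integrable M (\<lambda>w. Re (c 0 n w))"
        using abs_Re_le_cmod[of "c 0 n _"] c1 by (intro integrable_bounded[where B = 1]) (auto intro: order_trans)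
    qed (use calculation in auto)
    ultimately have "1 / 2 \<le> expectation (\<lambda>w. Re (c 0 n w))" by (simp add: c_def prob_space)
    also have "\<dots> = expectation (\<lambda>w. Re (G n w))"
      using GE[of "\<lambda>_. 1" n 1] by simp
    also have "\<dots> \<le> expectation (\<lambda>w. cmod (G n w))"
      using abs_Re_le_cmod[of "G n _"] G2
      by (intro integral_mono iG integrable_bounded[where B = 2]) (auto intro: order_trans complex_Re_le_cmod)
    finally show ?thesis .
  qed
  let ?m = "\<lambda>n w. cmod (G n w)"
  \<comment> \<open>The modulus at a fixed time is nearly a function of the past, and it is close to the modulus at any later time, a function of the future.\<close>
  have modulus: "\<exists>N r. 1 / 2 \<le> r \<and> (\<forall>n\<ge>N. expectation (\<lambda>w. \<bar>?m n w - r\<bar>) \<le> \<epsilon>)" if "0 < \<epsilon>" for \<epsilon>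
  proof -
    define t where "t = min 1 (\<epsilon> / 4)"
    define d where "d = t\<^sup>2 / 8"
    have t: "0 < t" "t \<le> 1" "4 * t \<le> \<epsilon>" using that by (auto simp: t_def)
    have d: "0 < d" "d \<le> t" using t power_decreasing[of 1 2 t] by (auto simp: d_def)
    obtain N0 where N0: "\<And>m n. N0 \<le> m \<Longrightarrow> m \<le> n \<Longrightarrow> expectation (\<lambda>w. ?D m n w) \<le> d"
      using cauchy[OF d(1)] by blast
    have mod_diff: "L1_dist (?m n) (?m m) \<le> d" if "N0 \<le> m" "m \<le> n" for m n
    proof -
      have "L1_dist (?m n) (?m m) \<le> expectation (\<lambda>w. ?D m n w)"
      proof (intro integral_mono icG)
        show "\<bar>?m n w - ?m m w\<bar> \<le> ?D m n w" for w
          using norm_triangle_ineq3[of "G n w" "c m n w * G m w"] c1[of m n w] by (simp add: norm_mult)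
      qed (use iG in auto)
      also have "\<dots> \<le> d" by (rule N0[OF that])
      finally show ?thesis .
    qed
    have "(\<lambda>w. ?m N0 w / 2) \<in> borel_measurable (Future 0)"
      using measurable_Future_mono[OF GF, of 0 N0] by auto
    moreover have "\<bar>?m N0 w / 2\<bar> \<le> 1" for w using G2[of N0 w] by simp
    ultimately obtain i Y where Y: "Y \<in> borel_measurable (Past i)" "\<And>w. \<bar>Y w\<bar> \<le> 1"
        "expectation (\<lambda>w. \<bar>?m N0 w / 2 - Y w\<bar>) < d"
      using past_approximation[OF _ _ d(1)] by blast
    have Yi: "Y \<in> borel_measurable (Past (Suc i))" by (rule measurable_Past_mono[OF Y(1)]) simp
    have [measurable]: "Y \<in> borel_measurable M" by (rule measurable_Past[OF Y(1)])
    have iY: "integrable M Y" using Y(2) by (intro integrable_bounded[where B = 1]) auto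
    obtain l where l: "1 \<le> l" "\<phi> l \<le> d" using mixing_small[OF d(1)] .
    define N where "N = max N0 (Suc i + l)"
    have dev: "expectation (\<lambda>w. \<bar>?m n w / 2 - expectation (\<lambda>w. ?m n w / 2)\<bar>) \<le> t" if "N \<le> n" for n
    proof (rule L1_deviation_le[OF _ l(1) Yi Y(2)])
      show "(\<lambda>w. ?m n w / 2) \<in> borel_measurable (Future (Suc i + l))"
        using measurable_Future_mono[OF GF, of "Suc i + l" n] that by (auto simp: N_def)
      show "\<bar>?m n w / 2\<bar> \<le> 1" for w using G2[of n w] by simp
      have "expectation (\<lambda>w. \<bar>?m n w / 2 - Y w\<bar>)
          \<le> expectation (\<lambda>w. \<bar>?m n w - ?m N0 w\<bar> / 2 + \<bar>?m N0 w / 2 - Y w\<bar>)"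
      proof (intro integral_mono)
        show "\<bar>?m n w / 2 - Y w\<bar> \<le> \<bar>?m n w - ?m N0 w\<bar> / 2 + \<bar>?m N0 w / 2 - Y w\<bar>" for w
          by (simp add: abs_if field_simps)
      qed (use iG iY in auto)
      also have "\<dots> = L1_dist (?m n) (?m N0) / 2 + expectation (\<lambda>w. \<bar>?m N0 w / 2 - Y w\<bar>)"
        using iG iY by simp
      also have "\<dots> \<le> d / 2 + d" using mod_diff[of N0 n] Y(3) that by (intro add_mono) (auto simp: N_def)
      finally have "4 * \<phi> l + 2 * expectation (\<lambda>w. \<bar>?m n w / 2 - Y w\<bar>) \<le> 8 * d" using l d by linarith
      then show "4 * \<phi> l + 2 * expectation (\<lambda>w. \<bar>?m n w / 2 - Y w\<bar>) \<le> t\<^sup>2" by (simp add: d_def)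
    qed (use t in auto)
    define r where "r = expectation (?m N)"
    have "expectation (\<lambda>w. \<bar>?m n w - r\<bar>) \<le> \<epsilon>" if n: "N \<le> n" for n
    proof -
      let ?r = "expectation (?m n)"
      have "\<bar>?r - r\<bar> = \<bar>expectation (\<lambda>w. ?m n w - ?m N w)\<bar>" using iG by (simp add: r_def)
      also have "\<dots> \<le> L1_dist (?m n) (?m N)" by (rule integral_abs_bound)
      also have "\<dots> \<le> d" using n by (intro mod_diff) (auto simp: N_def)
      finally have r: "\<bar>?r - r\<bar> \<le> d" .
      have "expectation (\<lambda>w. \<bar>?m n w - r\<bar>) \<le> expectation (\<lambda>w. 2 * \<bar>?m n w / 2 - ?r / 2\<bar> + d)"
      proof (intro integral_mono)
        show "\<bar>?m n w - r\<bar> \<le> 2 * \<bar>?m n w / 2 - ?r / 2\<bar> + d" for w using r by (simp add: abs_if split: if_splits)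
      qed (use iG in auto)
      also have "\<dots> \<le> 2 * t + d" using dev[OF n] iG by (simp add: prob_space)
      also have "\<dots> \<le> \<epsilon>" using d t by linarith
      finally show ?thesis .
    qed
    then show ?thesis using half[of N] by (intro exI[of _ N] exI[of _ r]) (auto simp: r_def)
  qed

  define g where "g = (\<lambda>n w. sgn (G n w) ^ k)"
  have sgn1: "cmod (sgn z) \<le> 1" for z by (simp add: norm_sgn)
  have g_eq: "cis (?\<theta> m n w) * g m w = sgn (c m n w * G m w) ^ k" for m n w
  proof -
    have "?\<theta> m n w = real k * (s * block_sum H m n w)"
      using s(3) by (simp add: block_sum_def sum_distrib_left mult.assoc[symmetric])
    then have "cis (?\<theta> m n w) = c m n w ^ k"
      unfolding c_def using Complex.DeMoivre[of "s * block_sum H m n w" k] by simp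
    moreover have "sgn (c m n w * G m w) = c m n w * sgn (G m w)"
      using c1[of m n w] by (simp add: sgn_eq norm_mult)
    ultimately show ?thesis by (simp add: g_def power_mult_distrib)
  qed
  have sgnF: "(\<lambda>w. sgn (G n w)) \<in> borel_measurable (Future n)" for n
    using GF[of n] unfolding sgn_eq by measurable
  have gF: "g n \<in> borel_measurable (Future n)" for n
    unfolding g_def using sgnF[of n] by measurable
  have [measurable]: "g n \<in> borel_measurable M" for n by (rule measurable_Future[OF gF])
  have g1: "cmod (g n w) \<le> 1" for n w using power_le_one[OF norm_ge_zero sgn1] by (simp add: g_def norm_power)
  have ig: "integrable M (\<lambda>w. cmod (g n w))" for n using g1 by (intro integrable_bounded[where B = 1]) auto
  have "\<exists>N. \<forall>n\<ge>N. 1 - \<epsilon> \<le> expectation (\<lambda>w. cmod (g n w)) \<and>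
      (\<forall>m\<in>{N..n}. expectation (\<lambda>w. cmod (g n w - cis (?\<theta> m n w) * g m w)) \<le> \<epsilon>)"
    if "0 < \<epsilon>" for \<epsilon>
  proof -
    define \<delta> where "\<delta> = \<epsilon> / (6 * real k)"
    have \<delta>: "0 < \<delta>" "6 * real k * \<delta> = \<epsilon>" using that k by (auto simp: \<delta>_def)
    then have \<delta>2: "2 * \<delta> \<le> \<epsilon>" using k mult_right_mono[of 2 "6 * real k" \<delta>] by auto
    obtain N1 where N1: "\<And>m n. N1 \<le> m \<Longrightarrow> m \<le> n \<Longrightarrow> expectation (\<lambda>w. ?D m n w) \<le> \<delta>"
      using cauchy[OF \<delta>(1)] by blast
    obtain N2 r where r: "1 / 2 \<le> r" and N2: "\<And>n. N2 \<le> n \<Longrightarrow> expectation (\<lambda>w. \<bar>cmod (G n w) - r\<bar>) \<le> \<delta>"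
      using modulus[OF \<delta>(1)] by blast
    have "1 - \<epsilon> \<le> expectation (\<lambda>w. cmod (g n w))" if "N2 \<le> n" for n
    proof -
      have "expectation (\<lambda>w. 1 - cmod (g n w)) \<le> expectation (\<lambda>w. 2 * \<bar>cmod (G n w) - r\<bar>)"
      proof (intro integral_mono)
        show "1 - cmod (g n w) \<le> 2 * \<bar>cmod (G n w) - r\<bar>" for w
          using r k by (cases "G n w = 0") (auto simp: g_def norm_power norm_sgn power_0_left)
      qed (use iG ig in auto)
      then show ?thesis using N2[OF that] \<delta>2 iG ig by (simp add: prob_space)
    qed
    moreover have "expectation (\<lambda>w. cmod (g n w - cis (?\<theta> m n w) * g m w)) \<le> \<epsilon>"
      if mn: "N1 \<le> m" "N2 \<le> m" "m \<le> n" for m n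
    proof -
      have "expectation (\<lambda>w. cmod (g n w - cis (?\<theta> m n w) * g m w))
        \<le> expectation (\<lambda>w. 2 * real k * (?D m n w + \<bar>cmod (G n w) - r\<bar> + \<bar>cmod (G m w) - r\<bar>))"
        unfolding g_eq
      proof (intro integral_mono)
        fix w
        let ?d = "cmod (sgn (G n w) - sgn (c m n w * G m w))"
        let ?e = "?D m n w + \<bar>cmod (G n w) - r\<bar> + \<bar>cmod (G m w) - r\<bar>"
        have "cmod (sgn (G n w) ^ k - sgn (c m n w * G m w) ^ k) \<le> real k * ?d"
          by (intro norm_power_diff sgn1)
        moreover have "?d \<le> 2 * (r * ?d)" using r mult_right_mono[of 1 "2 * r" ?d] by simp
        moreover have "r * ?d \<le> ?e"
          using sgn_diff_le[of r "G n w" "c m n w * G m w"] r c1[of m n w] by (simp add: norm_mult)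
        ultimately have "cmod (sgn (G n w) ^ k - sgn (c m n w * G m w) ^ k) \<le> real k * (2 * ?e)"
          using mult_left_mono[of ?d "2 * ?e" "real k"] by simp
        then show "cmod (g n w - sgn (c m n w * G m w) ^ k) \<le> 2 * real k * ?e"
          by (simp add: g_def algebra_simps)
      next
        have "(\<lambda>w. sgn (c m n w * G m w) ^ k) \<in> borel_measurable M" unfolding sgn_eq by measurable
        then show "integrable M (\<lambda>w. cmod (g n w - sgn (c m n w * G m w) ^ k))"
          using g1 power_le_one[OF norm_ge_zero sgn1]
          by (intro integrable_cmod_diff[where p = 1 and q = 1]) (auto simp: norm_power)
      qed (use iG icG in auto)
      also have "\<dots> \<le> 2 * real k * (\<delta> + \<delta> + \<delta>)"
      proof -
        have "expectation (\<lambda>w. ?D m n w) + expectation (\<lambda>w. \<bar>cmod (G n w) - r\<bar>)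
            + expectation (\<lambda>w. \<bar>cmod (G m w) - r\<bar>) \<le> \<delta> + \<delta> + \<delta>"
          using N1[of m n] N2[of m] N2[of n] mn by (intro add_mono) auto
        then have "2 * real k * (expectation (\<lambda>w. ?D m n w) + expectation (\<lambda>w. \<bar>cmod (G n w) - r\<bar>)
            + expectation (\<lambda>w. \<bar>cmod (G m w) - r\<bar>)) \<le> 2 * real k * (\<delta> + \<delta> + \<delta>)"
          by (intro mult_left_mono) auto
        then show ?thesis using iG icG by simp
      qed
      also have "\<dots> = \<epsilon>" using \<delta>(2) by simp
      finally show ?thesis .
    qed
    ultimately show ?thesis by (intro exI[of _ "max N1 N2"]) auto
  qed
  then have "asymptotic_coboundary (\<lambda>j w. 2 * pi * H j w) g"
    unfolding asymptotic_coboundary_def using gF g1 by auto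
  then show ?thesis by blast
qed

end

context mixing_filtrations
begin

lemma block_sum_diff: "block_sum (\<lambda>j w. u * q j w - v j) m n w = u * block_sum q m n w - (\<Sum>j\<in>{m..<n}. v j)"
  by (simp add: block_sum_def sum_subtractf sum_distrib_left)

lemma block_sum_scale: "block_sum (\<lambda>j w. u * q j w) m n w = u * block_sum q m n w"
  by (simp add: block_sum_def sum_distrib_left)

lemma short_memory_affine:
  assumes q: "short_memory q L" and u: "0 \<le> u" and v: "\<And>j. \<bar>v j\<bar> \<le> V"
  shows "short_memory (\<lambda>j w. u * q j w - v j) (u * L + V)"
  unfolding short_memory_def
proof (intro conjI allI ballI impI)
  have V: "0 \<le> V" using v[of 0] by linarith
  show "(\<lambda>w. u * q j w - v j) \<in> borel_measurable (Future j)" for j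
    using short_memory_FutureD[OF q, of j] by measurable
  show "\<bar>u * q j w - v j\<bar> \<le> u * L + V" if "w \<in> space M" for j w
  proof -
    have "\<bar>u * q j w\<bar> \<le> u * L"
      using short_memory_boundD[OF q that] u by (simp add: abs_mult mult_left_mono)
    then show ?thesis using v[of j] by linarith
  qed
  fix j p :: nat assume "j \<le> p"
  then obtain r where r: "r \<in> borel_measurable (Past p)" "\<And>w. w \<in> space M \<Longrightarrow> \<bar>block_sum q j p w - r w\<bar> \<le> L"
    using q unfolding short_memory_def by blast
  have "\<bar>block_sum (\<lambda>j w. u * q j w - v j) j p w - (u * r w - (\<Sum>j\<in>{j..<p}. v j))\<bar> \<le> u * L + V"
    if "w \<in> space M" for w
  proof -
    have "\<bar>u * (block_sum q j p w - r w)\<bar> \<le> u * L"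
      using r(2)[OF that] u by (simp add: abs_mult mult_left_mono)
    then show ?thesis using V by (simp add: block_sum_diff right_diff_distrib)
  qed
  then show "\<exists>r\<in>borel_measurable (Past p). \<forall>w\<in>space M. \<bar>block_sum (\<lambda>j w. u * q j w - v j) j p w - r w\<bar> \<le> u * L + V"
    using r(1) by (intro bexI[of _ "\<lambda>w. u * r w - (\<Sum>j\<in>{j..<p}. v j)"]) auto
qed

section \<open>Small frequencies and bounded variances\<close>

text \<open>
  For a fixed starting time \<open>N0\<close>, the function \<open>g n\<close> is close to \<open>cis (u * S) * g N0\<close>, where
  \<open>g N0\<close> is nearly a function of the past of some \<open>k\<close>. Dropping the last \<open>l\<close> terms of \<open>S\<close> costs
  at most \<open>u * (l + 1) * L\<close>. The bound \<open>\<delta>\<close> depends on \<open>\<eta>\<close>, \<open>L\<close> and the mixing rate only, so it is the same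
  for all \<open>g\<close>, although the time from which the estimate holds depends on \<open>g\<close>.
\<close>

lemma coboundary_nearly_constant:
  assumes q: "short_memory q L" and \<eta>: "0 < \<eta>"
  shows "\<exists>\<delta>>0. \<forall>u g. 0 < u \<longrightarrow> u < \<delta> \<longrightarrow> asymptotic_coboundary (\<lambda>j w. u * q j w) g \<longrightarrow>
    (\<exists>N \<gamma>. (\<forall>n\<ge>N. cmod (\<gamma> n) = 1) \<and>
      (\<forall>m\<ge>N. \<forall>n\<ge>m. expectation (\<lambda>w. cmod (cis (u * block_sum q m n w) * \<gamma> m - \<gamma> n)) \<le> \<eta>))"
proof -
  define t where "t = min (\<eta> / 20) (1 / 20)"
  have t: "0 < t" "20 * t \<le> \<eta>" "20 * t \<le> 1" using \<eta> by (auto simp: t_def)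
  define d where "d = t\<^sup>2 / 32"
  have d: "0 < d" "d \<le> t" "32 * d = t\<^sup>2" using t power_decreasing[of 1 2 t] by (auto simp: d_def)
  have L: "0 \<le> L" by (rule short_memory_nonneg[OF q])
  obtain l where l: "1 \<le> l" "\<phi> l \<le> d" using mixing_small[OF d(1)] .
  \<comment> \<open>The gap \<open>l\<close> is fixed before \<open>u\<close>, so that \<open>u\<close> can be small compared with \<open>1 / l\<close>.\<close>
  define \<delta> where "\<delta> = d / ((real l + 1) * L + 1)"
  have den: "0 < (real l + 1) * L + 1" using L by (intro add_nonneg_pos mult_nonneg_nonneg) auto
  note [measurable] = short_memory_block_sum(1)[OF q]
  show ?thesis
  proof (intro exI[of _ \<delta>] conjI allI impI)
    show "0 < \<delta>" using d den by (simp add: \<delta>_def)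
    fix u g assume u: "0 < u" "u < \<delta>" and g: "asymptotic_coboundary (\<lambda>j w. u * q j w) g"
    have uL: "u * ((real l + 1) * L) \<le> d"
    proof -
      have "u * ((real l + 1) * L) \<le> u * ((real l + 1) * L + 1)" using u by (intro mult_left_mono) auto
      also have "\<dots> \<le> \<delta> * ((real l + 1) * L + 1)" using u den by (intro mult_right_mono) auto
      also have "\<dots> = d" using den by (simp add: \<delta>_def)
      finally show ?thesis .
    qed
    have gF: "g n \<in> borel_measurable (Future n)" and g1: "cmod (g n w) \<le> 1" for n w
      using g by (auto simp: asymptotic_coboundary_def)
    have [measurable]: "g n \<in> borel_measurable M" for n by (rule measurable_Future[OF gF])
    have ig: "integrable M (g n)" for n using g1 by (intro integrable_bounded[where B = 1]) auto
    let ?c = "\<lambda>m n w. cis (u * block_sum q m n w)"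
    have icg: "integrable M (\<lambda>w. cmod (g n w - ?c m n w * g m w))" for m n
      using g1 by (intro integrable_cmod_diff[where p = 1 and q = 1]) (auto simp: norm_mult)
    obtain N0 where N0: "\<And>n. N0 \<le> n \<Longrightarrow> 1 - d \<le> expectation (\<lambda>w. cmod (g n w))"
        "\<And>m n. N0 \<le> m \<Longrightarrow> m \<le> n \<Longrightarrow> expectation (\<lambda>w. cmod (g n w - ?c m n w * g m w)) \<le> d"
    proof -
      obtain N where N: "\<forall>n\<ge>N. 1 - d \<le> expectation (\<lambda>w. cmod (g n w)) \<and>
          (\<forall>m\<in>{N..n}. expectation (\<lambda>w. cmod (g n w - ?c m n w * g m w)) \<le> d)"
        using g d(1) unfolding asymptotic_coboundary_def block_sum_scale by blast
      show thesis by (rule that[of N]) (use N in auto)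
    qed
    have past: "\<exists>k Y. Y \<in> borel_measurable (Past k) \<and> (\<forall>w. \<bar>Y w\<bar> \<le> 1) \<and> expectation (\<lambda>w. \<bar>h (g N0 w) - Y w\<bar>) < d"
      if "h = Re \<or> h = Im" for h
    proof -
      have "(\<lambda>w. h (g N0 w)) \<in> borel_measurable (Future 0)"
        using measurable_Future_mono[OF gF, of 0 N0] that by auto
      moreover have "\<bar>h (g N0 w)\<bar> \<le> 1" for w
        using that abs_Re_le_cmod[of "g N0 w"] abs_Im_le_cmod[of "g N0 w"] g1[of N0 w] by auto
      ultimately show ?thesis using past_approximation[OF _ _ d(1)] by metis
    qed
    obtain k1 Y1 where Y1: "Y1 \<in> borel_measurable (Past k1)" "\<And>w. \<bar>Y1 w\<bar> \<le> 1" "expectation (\<lambda>w. \<bar>Re (g N0 w) - Y1 w\<bar>) < d"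
      using past[of Re] by auto
    obtain k2 Y2 where Y2: "Y2 \<in> borel_measurable (Past k2)" "\<And>w. \<bar>Y2 w\<bar> \<le> 1" "expectation (\<lambda>w. \<bar>Im (g N0 w) - Y2 w\<bar>) < d"
      using past[of Im] by auto
    define k where "k = max (Suc N0) (max k1 k2)"
    define Y where "Y = (\<lambda>w. of_real (Y1 w) + \<i> * of_real (Y2 w))"
    have YP: "Y \<in> borel_measurable (Past p)" if "k \<le> p" for p
      using measurable_Past_mono[OF Y1(1), of p] measurable_Past_mono[OF Y2(1), of p] that
      unfolding Y_def k_def by auto
    have [measurable]: "Y1 \<in> borel_measurable M" "Y2 \<in> borel_measurable M" "Y \<in> borel_measurable M"
      using measurable_Past[OF Y1(1)] measurable_Past[OF Y2(1)] measurable_Past[OF YP[OF order_refl]] by auto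
    have YB: "cmod (Y w) \<le> 2" for w
      using norm_triangle_ineq[of "of_real (Y1 w)" "\<i> * of_real (Y2 w)"] Y1(2)[of w] Y2(2)[of w]
      by (simp add: Y_def norm_mult)
    have igY: "integrable M (\<lambda>w. cmod (g N0 w - Y w))"
      using g1 YB by (intro integrable_cmod_diff) auto
    have int12: "integrable M (\<lambda>w. \<bar>Re (g N0 w) - Y1 w\<bar>)" "integrable M (\<lambda>w. \<bar>Im (g N0 w) - Y2 w\<bar>)"
    proof -
      have "integrable M Y1" "integrable M Y2"
        using Y1(2) Y2(2) by (auto intro!: integrable_bounded[where B = 1])
      then show "integrable M (\<lambda>w. \<bar>Re (g N0 w) - Y1 w\<bar>)" "integrable M (\<lambda>w. \<bar>Im (g N0 w) - Y2 w\<bar>)"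
        using ig[of N0] by auto
    qed
    have gY: "expectation (\<lambda>w. cmod (g N0 w - Y w)) \<le> 2 * d"
    proof -
      have "expectation (\<lambda>w. cmod (g N0 w - Y w)) \<le> expectation (\<lambda>w. \<bar>Re (g N0 w) - Y1 w\<bar> + \<bar>Im (g N0 w) - Y2 w\<bar>)"
      proof (intro integral_mono igY)
        show "cmod (g N0 w - Y w) \<le> \<bar>Re (g N0 w) - Y1 w\<bar> + \<bar>Im (g N0 w) - Y2 w\<bar>" for w
          using cmod_le[of "g N0 w - Y w"] by (simp add: Y_def)
      qed (use int12 in auto)
      also have "\<dots> \<le> 2 * d" using int12 Y1(3) Y2(3) by simp
      finally show ?thesis .
    qed
    define N where "N = k + l"
    have NN0: "N0 \<le> N" by (simp add: N_def k_def)
    have local: "\<exists>T\<in>borel_measurable (Past p). (\<forall>w. cmod (T w) \<le> 2) \<and> integrable M (\<lambda>w. cmod (g n w - T w)) \<and>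
        expectation (\<lambda>w. cmod (g n w - T w)) \<le> 4 * d" if n: "N \<le> n" "n = p + l" for n p
    proof -
      have "N0 \<le> p" "k \<le> p" using n by (auto simp: N_def k_def)
      from this(1) obtain r where r: "r \<in> borel_measurable (Past p)" "\<And>w. w \<in> space M \<Longrightarrow> \<bar>block_sum q N0 p w - r w\<bar> \<le> L"
        using q unfolding short_memory_def by blast
      define T where "T = (\<lambda>w. cis (u * r w) * Y w)"
      have TP: "T \<in> borel_measurable (Past p)"
        using r(1) YP[OF \<open>k \<le> p\<close>] unfolding T_def by measurable
      have [measurable]: "T \<in> borel_measurable M" by (rule measurable_Past[OF TP])
      have T2: "cmod (T w) \<le> 2" for w using YB[of w] by (simp add: T_def norm_mult)
      have igT: "integrable M (\<lambda>w. cmod (g n w - T w))"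
        using g1 T2 by (intro integrable_cmod_diff) auto
      have "expectation (\<lambda>w. cmod (g n w - T w)) \<le>
          expectation (\<lambda>w. cmod (g n w - ?c N0 n w * g N0 w) + d + cmod (g N0 w - Y w))"
      proof (intro integral_mono igT)
        fix w assume w: "w \<in> space M"
        have "\<bar>block_sum q p n w\<bar> \<le> real l * L"
          using short_memory_block_sum(2)[OF q w, of p n] n by simp
        then have "\<bar>block_sum q N0 n w - r w\<bar> \<le> (real l + 1) * L"
          using block_sum_split[of N0 p n q w] r(2)[OF w] n \<open>N0 \<le> p\<close> by (simp add: algebra_simps abs_le_iff)
        then have "\<bar>u * block_sum q N0 n w - u * r w\<bar> \<le> u * ((real l + 1) * L)"
          using u by (simp add: abs_mult flip: right_diff_distrib)
        then have "cmod (?c N0 n w - cis (u * r w)) \<le> d"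
          using cmod_cis_diff_le[of "u * block_sum q N0 n w" "u * r w"] uL by linarith
        then have "cmod (?c N0 n w - cis (u * r w)) * cmod (g N0 w) \<le> d * 1"
          using g1[of N0 w] d by (intro mult_mono) auto
        moreover have "g n w - T w = (g n w - ?c N0 n w * g N0 w) + (?c N0 n w - cis (u * r w)) * g N0 w
            + cis (u * r w) * (g N0 w - Y w)" by (simp add: T_def algebra_simps)
        then have "cmod (g n w - T w) \<le> cmod (g n w - ?c N0 n w * g N0 w) + cmod ((?c N0 n w - cis (u * r w)) * g N0 w)
            + cmod (cis (u * r w) * (g N0 w - Y w))"
          by (metis norm_triangle_ineq norm_triangle_mono order_refl)
        ultimately show "cmod (g n w - T w) \<le> cmod (g n w - ?c N0 n w * g N0 w) + d + cmod (g N0 w - Y w)"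
          by (simp add: norm_mult)
      qed (use igY icg in auto)
      also have "\<dots> = expectation (\<lambda>w. cmod (g n w - ?c N0 n w * g N0 w)) + d + expectation (\<lambda>w. cmod (g N0 w - Y w))"
        using igY icg by (simp add: prob_space)
      also have "\<dots> \<le> d + d + 2 * d" using N0(2)[of N0 n] n NN0 gY by (intro add_mono) auto
      finally show ?thesis using TP T2 igT by auto
    qed
    have dev1: "expectation (\<lambda>w. \<bar>h (g n w) - expectation (\<lambda>w. h (g n w))\<bar>) \<le> t" if n: "N \<le> n" and h: "h = Re \<or> h = Im" for n h
    proof -
      define p where "p = n - l"
      have p: "n = p + l" "1 \<le> p" "k \<le> p" using n unfolding p_def N_def k_def by linarith+
      obtain T where T: "T \<in> borel_measurable (Past p)" "\<And>w. cmod (T w) \<le> 2" "integrable M (\<lambda>w. cmod (g n w - T w))"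
          "expectation (\<lambda>w. cmod (g n w - T w)) \<le> 4 * d"
        using local[OF n p(1)] by blast
      have [measurable]: "T \<in> borel_measurable M" by (rule measurable_Past[OF T(1)])
      have h1: "\<bar>h z\<bar> \<le> cmod z" for z using h abs_Re_le_cmod abs_Im_le_cmod by auto
      have half: "expectation (\<lambda>w. \<bar>h (g n w) / 2 - expectation (\<lambda>w. h (g n w) / 2)\<bar>) \<le> t / 2"
      proof (rule L1_deviation_le[OF p(2) l(1), of "\<lambda>w. h (T w) / 2"])
        show "(\<lambda>w. h (T w) / 2) \<in> borel_measurable (Past p)" using T(1) h by auto
        show "(\<lambda>w. h (g n w) / 2) \<in> borel_measurable (Future (p + l))" using gF[of n] h p(1) by auto
        show "\<bar>h (T w) / 2\<bar> \<le> 1" for w using h1[of "T w"] T(2)[of w] by simp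
        show "\<bar>h (g n w) / 2\<bar> \<le> 1" for w using h1[of "g n w"] g1[of n w] by simp
        have "expectation (\<lambda>w. \<bar>h (g n w) / 2 - h (T w) / 2\<bar>) \<le> expectation (\<lambda>w. cmod (g n w - T w) / 2)"
        proof (intro integral_mono)
          have "h (g n w) - h (T w) = h (g n w - T w)" for w using h by auto
          then show le: "\<bar>h (g n w) / 2 - h (T w) / 2\<bar> \<le> cmod (g n w - T w) / 2" for w
            using h1[of "g n w - T w"] by (simp flip: diff_divide_distrib)
          show "integrable M (\<lambda>w. \<bar>h (g n w) / 2 - h (T w) / 2\<bar>)"
            by (rule Bochner_Integration.integrable_bound[of _ "\<lambda>w. cmod (g n w - T w) / 2"]) (use T(3) le h in auto)
        qed (use T(3) in auto)
        then have "4 * \<phi> l + 2 * expectation (\<lambda>w. \<bar>h (g n w) / 2 - h (T w) / 2\<bar>) \<le> 4 * d + 4 * d"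
          using l T(4) by simp
        also have "\<dots> = (t / 2)\<^sup>2" using d by (simp add: power_divide)
        finally show "4 * \<phi> l + 2 * expectation (\<lambda>w. \<bar>h (g n w) / 2 - h (T w) / 2\<bar>) \<le> (t / 2)\<^sup>2" .
      qed (use t in auto)
      have "\<bar>x - y\<bar> = 2 * \<bar>x / 2 - y / 2\<bar>" for x y :: real by (simp flip: diff_divide_distrib)
      then have "expectation (\<lambda>w. \<bar>h (g n w) - expectation (\<lambda>w. h (g n w))\<bar>)
          = expectation (\<lambda>w. 2 * \<bar>h (g n w) / 2 - expectation (\<lambda>w. h (g n w)) / 2\<bar>)"
        by (intro Bochner_Integration.integral_cong refl)
      then show ?thesis using half by simp
    qed
    define \<gamma>' where "\<gamma>' = (\<lambda>n. expectation (g n))"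
    define \<gamma> where "\<gamma> = (\<lambda>n. sgn (\<gamma>' n))"
    have ig': "integrable M (\<lambda>w. cmod (g n w - z))" for n z using ig[of n] by auto
    have dev: "expectation (\<lambda>w. cmod (g n w - \<gamma>' n)) \<le> 2 * t" if n: "N \<le> n" for n
    proof -
      let ?R = "\<lambda>w. \<bar>Re (g n w) - expectation (\<lambda>w. Re (g n w))\<bar>" and ?I = "\<lambda>w. \<bar>Im (g n w) - expectation (\<lambda>w. Im (g n w))\<bar>"
      have "expectation (\<lambda>w. cmod (g n w - \<gamma>' n)) \<le>
          expectation (\<lambda>w. ?R w + ?I w)"
      proof (intro integral_mono ig')
        show "cmod (g n w - \<gamma>' n) \<le> ?R w + ?I w" for w
          using cmod_le[of "g n w - \<gamma>' n"] ig[of n] by (simp add: \<gamma>'_def)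
      qed (use ig[of n] in auto)
      also have "\<dots> = expectation ?R + expectation ?I"
        using ig[of n] by (intro Bochner_Integration.integral_add) auto
      also have "\<dots> \<le> 2 * t" using dev1[OF n, of Re] dev1[OF n, of Im] by simp
      finally show ?thesis .
    qed
    have \<gamma>'_norm: "1 - 3 * t \<le> cmod (\<gamma>' n)" "cmod (\<gamma>' n) \<le> 1" if n: "N \<le> n" for n
    proof -
      have "1 - d \<le> expectation (\<lambda>w. cmod (g n w))" using N0(1)[of n] NN0 n by auto
      also have "\<dots> \<le> expectation (\<lambda>w. cmod (g n w - \<gamma>' n) + cmod (\<gamma>' n))"
      proof (intro integral_mono)
        show "cmod (g n w) \<le> cmod (g n w - \<gamma>' n) + cmod (\<gamma>' n)" for w
          using norm_triangle_ineq[of "g n w - \<gamma>' n" "\<gamma>' n"] by simp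
      qed (use ig ig' in auto)
      also have "\<dots> \<le> 2 * t + cmod (\<gamma>' n)" using dev[OF n] ig' by (simp add: prob_space)
      finally show "1 - 3 * t \<le> cmod (\<gamma>' n)" using d by linarith
      have "cmod (\<gamma>' n) \<le> expectation (\<lambda>w. cmod (g n w))" unfolding \<gamma>'_def by (rule integral_norm_bound)
      also have "\<dots> \<le> 1" using g1 ig by (intro expectation_le_const) auto
      finally show "cmod (\<gamma>' n) \<le> 1" .
    qed
    have \<gamma>1: "cmod (\<gamma> n) = 1" if "N \<le> n" for n
      using \<gamma>'_norm[OF that] t by (auto simp: \<gamma>_def norm_sgn)
    have dev\<gamma>: "expectation (\<lambda>w. cmod (g n w - \<gamma> n)) \<le> 5 * t" if n: "N \<le> n" for n
    proof -
      have "cmod (\<gamma> n - \<gamma>' n) \<le> 3 * t"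
        using sgn_scaled_diff_le[of 1 "\<gamma>' n"] \<gamma>'_norm[OF n] by (simp add: \<gamma>_def)
      then have "expectation (\<lambda>w. cmod (g n w - \<gamma> n)) \<le> expectation (\<lambda>w. cmod (g n w - \<gamma>' n) + 3 * t)"
      proof (intro integral_mono)
        assume *: "cmod (\<gamma> n - \<gamma>' n) \<le> 3 * t"
        show "cmod (g n w - \<gamma> n) \<le> cmod (g n w - \<gamma>' n) + 3 * t" for w
          using norm_triangle_ineq4[of "g n w - \<gamma>' n" "\<gamma> n - \<gamma>' n"] * by simp
      qed (use ig' in auto)
      also have "\<dots> \<le> 5 * t" using dev[OF n] ig' by (simp add: prob_space)
      finally show ?thesis .
    qed
    show "\<exists>N \<gamma>. (\<forall>n\<ge>N. cmod (\<gamma> n) = 1) \<and> (\<forall>m\<ge>N. \<forall>n\<ge>m. expectation (\<lambda>w. cmod (?c m n w * \<gamma> m - \<gamma> n)) \<le> \<eta>)"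
    proof (intro exI[of _ N] exI[of _ \<gamma>] conjI allI impI \<gamma>1)
      fix m n assume m: "N \<le> m" "m \<le> n"
      have "expectation (\<lambda>w. cmod (?c m n w * \<gamma> m - \<gamma> n)) \<le>
        expectation (\<lambda>w. cmod (g m w - \<gamma> m) + cmod (g n w - ?c m n w * g m w) + cmod (g n w - \<gamma> n))"
      proof (intro integral_mono)
        show "integrable M (\<lambda>w. cmod (?c m n w * \<gamma> m - \<gamma> n))"
          using \<gamma>1[of m] \<gamma>1[of n] m by (intro integrable_cmod_diff[where p = 1 and q = 1]) (auto simp: norm_mult)
        fix w
        have "?c m n w * \<gamma> m - \<gamma> n = (g n w - \<gamma> n) - ?c m n w * (g m w - \<gamma> m) - (g n w - ?c m n w * g m w)"
          by (simp add: algebra_simps)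
        also have "cmod \<dots> \<le> cmod (g n w - \<gamma> n) + cmod (?c m n w * (g m w - \<gamma> m)) + cmod (g n w - ?c m n w * g m w)"
          by (meson norm_triangle_ineq4 add_right_mono order_trans)
        finally show "cmod (?c m n w * \<gamma> m - \<gamma> n) \<le> cmod (g m w - \<gamma> m) + cmod (g n w - ?c m n w * g m w) + cmod (g n w - \<gamma> n)"
          by (simp add: norm_mult)
      qed (use ig' icg in auto)
      also have "\<dots> = expectation (\<lambda>w. cmod (g m w - \<gamma> m)) + expectation (\<lambda>w. cmod (g n w - ?c m n w * g m w))
          + expectation (\<lambda>w. cmod (g n w - \<gamma> n))"
        using ig' icg by simp
      also have "\<dots> \<le> 5 * t + d + 5 * t" using dev\<gamma> m N0(2)[of m n] NN0 by (intro add_mono) auto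
      also have "\<dots> \<le> \<eta>" using d t by linarith
      finally show "expectation (\<lambda>w. cmod (?c m n w * \<gamma> m - \<gamma> n)) \<le> \<eta>" .
    qed
  qed
qed

text \<open>
  Consecutive constants \<open>\<gamma> j\<close> differ little, so the argument of \<open>\<gamma> (Suc j) / \<gamma> j\<close> has a small
  determination \<open>\<Delta> j\<close>. Subtracting this drift from \<open>u * q j\<close> gives a process with small steps
  and with block sums close to the lattice.
\<close>

theorem small_coboundary_bounded_variance:
  assumes q: "short_memory q L"
  shows "\<exists>\<delta>>0. \<forall>u g. 0 < u \<longrightarrow> u < \<delta> \<longrightarrow> asymptotic_coboundary (\<lambda>j w. u * q j w) g \<longrightarrow>
    (\<exists>N c. \<forall>n\<ge>N. expectation (\<lambda>w. (u * block_sum q N n w - c n)\<^sup>2) \<le> 36)"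
proof -
  obtain l where l: "1 \<le> l" "\<phi> l \<le> 1 / 100" using mixing_small[of "1 / 100"] by auto
  define \<eta> where "\<eta> = 1 / (1000 * (real l + 2))"
  have \<eta>: "0 < \<eta>" "\<eta> \<le> 1 / 100" "(real l + 2) * \<eta> = 1 / 1000" by (auto simp: \<eta>_def field_simps)
  have L: "0 \<le> L" by (rule short_memory_nonneg[OF q])
  obtain \<delta>1 where \<delta>1: "0 < \<delta>1" "\<And>u g. 0 < u \<Longrightarrow> u < \<delta>1 \<Longrightarrow> asymptotic_coboundary (\<lambda>j w. u * q j w) g \<Longrightarrow>
    (\<exists>N \<gamma>. (\<forall>n\<ge>N. cmod (\<gamma> n) = 1) \<and>
      (\<forall>m\<ge>N. \<forall>n\<ge>m. expectation (\<lambda>w. cmod (cis (u * block_sum q m n w) * \<gamma> m - \<gamma> n)) \<le> \<eta>))"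
    using coboundary_nearly_constant[OF q \<eta>(1)] by blast
  define \<delta> where "\<delta> = min \<delta>1 (\<eta> / (L + 1))"
  show ?thesis
  proof (intro exI[of _ \<delta>] conjI allI impI)
    show "0 < \<delta>" using \<delta>1(1) \<eta>(1) L by (simp add: \<delta>_def)
    fix u g assume u: "0 < u" "u < \<delta>" and g: "asymptotic_coboundary (\<lambda>j w. u * q j w) g"
    have uL: "u * L \<le> \<eta>"
    proof -
      have "u * L \<le> \<eta> / (L + 1) * (L + 1)" using u L by (intro mult_mono) (auto simp: \<delta>_def)
      then show ?thesis using L by simp
    qed
    obtain N0 \<gamma> where \<gamma>: "\<And>n. N0 \<le> n \<Longrightarrow> cmod (\<gamma> n) = 1"
      and close: "\<And>m n. N0 \<le> m \<Longrightarrow> m \<le> n \<Longrightarrow> expectation (\<lambda>w. cmod (cis (u * block_sum q m n w) * \<gamma> m - \<gamma> n)) \<le> \<eta>"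
    proof -
      have "u < \<delta>1" using u(2) by (simp add: \<delta>_def)
      from \<delta>1(2)[OF u(1) this g] obtain N \<gamma> where "\<forall>n\<ge>N. cmod (\<gamma> n) = 1"
        "\<forall>m\<ge>N. \<forall>n\<ge>m. expectation (\<lambda>w. cmod (cis (u * block_sum q m n w) * \<gamma> m - \<gamma> n)) \<le> \<eta>" by blast
      then show thesis by (intro that[of N \<gamma>]) auto
    qed
    define N where "N = max 1 N0"
    note [measurable] = short_memory_block_sum(1)[OF q]
    define \<Delta> where "\<Delta> = (\<lambda>j. if N0 \<le> j then Im (Ln (\<gamma> (Suc j) / \<gamma> j)) else 0)"
    have step: "cis (\<Delta> j) * \<gamma> j = \<gamma> (Suc j)" "\<bar>\<Delta> j\<bar> \<le> 4 * \<eta>" if j: "N0 \<le> j" for j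
    proof -
      define z where "z = \<gamma> (Suc j) / \<gamma> j"
      have z: "cmod z = 1" "z \<noteq> 0" "\<gamma> j \<noteq> 0" using \<gamma>[of j] \<gamma>[of "Suc j"] j by (auto simp: z_def norm_divide)
      have Re: "Re (Ln z) = 0" using z by (simp add: Re_Ln)
      have "exp (Ln z) = cis (Im (Ln z))" using Re by (simp add: exp_eq_polar)
      then show "cis (\<Delta> j) * \<gamma> j = \<gamma> (Suc j)" using z j by (simp add: \<Delta>_def z_def)
      let ?r = "\<lambda>w. cis (u * block_sum q j (Suc j) w)"
      have int: "integrable M (\<lambda>w. cmod (?r w * \<gamma> j - \<gamma> (Suc j)))"
        using \<gamma>[of j] \<gamma>[of "Suc j"] j by (intro integrable_cmod_diff[where p = 1 and q = 1]) (auto simp: norm_mult)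
      have "cmod (\<gamma> (Suc j) - \<gamma> j) = expectation (\<lambda>w. cmod (\<gamma> (Suc j) - \<gamma> j))" by (simp add: prob_space)
      also have "\<dots> \<le> expectation (\<lambda>w. cmod (?r w * \<gamma> j - \<gamma> (Suc j)) + \<eta>)"
      proof (intro integral_mono)
        fix w assume w: "w \<in> space M"
        have "\<bar>u * block_sum q j (Suc j) w\<bar> \<le> u * L"
          using short_memory_boundD[OF q w, of j] u by (simp add: block_sum_def abs_mult)
        then have "cmod (?r w - 1) \<le> \<eta>"
          using cmod_cis_diff_le[of "u * block_sum q j (Suc j) w" 0] uL by simp
        then have "cmod ((?r w - 1) * \<gamma> j) \<le> \<eta>"
          using \<gamma>[OF j] by (simp add: norm_mult)
        moreover have "cmod (\<gamma> (Suc j) - \<gamma> j) = cmod ((?r w - 1) * \<gamma> j - (?r w * \<gamma> j - \<gamma> (Suc j)))"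
          by (simp add: algebra_simps)
        ultimately show "cmod (\<gamma> (Suc j) - \<gamma> j) \<le> cmod (?r w * \<gamma> j - \<gamma> (Suc j)) + \<eta>"
          using norm_triangle_ineq4[of "(?r w - 1) * \<gamma> j" "?r w * \<gamma> j - \<gamma> (Suc j)"]
          by linarith
      qed (use int in auto)
      also have "\<dots> \<le> 2 * \<eta>" using close[OF j, of "Suc j"] int by (simp add: prob_space)
      finally have "cmod (\<gamma> (Suc j) - \<gamma> j) \<le> 2 * \<eta>" .
      moreover have "cmod (z - 1) = cmod (\<gamma> (Suc j) - \<gamma> j)"
      proof -
        have "(z - 1) * \<gamma> j = \<gamma> (Suc j) - \<gamma> j" using z by (simp add: z_def left_diff_distrib)
        then show ?thesis using \<gamma>[OF j] by (metis mult.right_neutral norm_mult)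
      qed
      ultimately have z1: "cmod (z - 1) \<le> 2 * \<eta>" by simp
      then have "cmod (Ln (1 + (z - 1))) \<le> 2 * cmod (z - 1)" using \<eta> by (intro norm_Ln_le) linarith
      then have "cmod (Ln z) \<le> 4 * \<eta>" using z1 by simp
      then show "\<bar>\<Delta> j\<bar> \<le> 4 * \<eta>" using abs_Im_le_cmod[of "Ln z"] j by (simp add: \<Delta>_def z_def)
    qed
    have \<Delta>_le: "\<bar>\<Delta> j\<bar> \<le> 4 * \<eta>" for j
      using step(2)[of j] \<eta> by (cases "N0 \<le> j") (auto simp: \<Delta>_def)
    have rotate: "cis (\<Sum>j\<in>{m..<n}. \<Delta> j) * \<gamma> m = \<gamma> n" if "N0 \<le> m" "m \<le> n" for m n
      using that(2)
    proof (induction n rule: dec_induct)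
      case (step n)
      then have "cis (\<Sum>j\<in>{m..<Suc n}. \<Delta> j) * \<gamma> m = cis (\<Delta> n) * (cis (\<Sum>j\<in>{m..<n}. \<Delta> j) * \<gamma> m)"
        by (simp add: cis_mult[symmetric] mult.commute mult.left_commute)
      also have "\<dots> = \<gamma> (Suc n)" using step \<open>N0 \<le> m\<close> step(3) \<open>\<And>j. N0 \<le> j \<Longrightarrow> cis (\<Delta> j) * \<gamma> j = \<gamma> (Suc j)\<close> by auto
      finally show ?case .
    qed simp
    define W where "W = (\<lambda>j w. u * q j w - \<Delta> j)"
    interpret near_identity M Past Future \<phi> W "u * L + 4 * \<eta>" l N
    proof unfold_locales
      show "short_memory W (u * L + 4 * \<eta>)"
        unfolding W_def using q u \<Delta>_le by (intro short_memory_affine) auto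
      show "1 \<le> l" "\<phi> l \<le> 1 / 100" by (fact l)+
      have "(real l + 2) * (u * L + 4 * \<eta>) \<le> (real l + 2) * (5 * \<eta>)" using uL by (intro mult_left_mono) auto
      then show "real (l + 2) * (u * L + 4 * \<eta>) \<le> 1 / 100" using \<eta>(3) unfolding of_nat_add of_nat_numeral by linarith
      show "1 \<le> N" by (simp add: N_def)
      fix m n assume m: "N \<le> m" "m \<le> n"
      have "cmod (cis (block_sum W m n w) - 1) = cmod (cis (u * block_sum q m n w) * \<gamma> m - \<gamma> n)" for w
      proof -
        have "cis (u * block_sum q m n w) = cis (block_sum W m n w) * cis (\<Sum>j\<in>{m..<n}. \<Delta> j)"
          by (simp add: W_def block_sum_diff cis_mult)
        then have "cis (u * block_sum q m n w) * \<gamma> m - \<gamma> n = (cis (block_sum W m n w) - 1) * \<gamma> n"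
          using rotate[of m n] m by (simp add: N_def left_diff_distrib mult.assoc)
        then show ?thesis using \<gamma>[of n] m by (simp add: norm_mult N_def)
      qed
      then show "expectation (\<lambda>w. cmod (cis (block_sum W m n w) - 1)) \<le> 1 / 100"
        using close[of m n] m \<eta>(2) by (simp add: N_def)
    qed
    show "\<exists>N c. \<forall>n\<ge>N. expectation (\<lambda>w. (u * block_sum q N n w - c n)\<^sup>2) \<le> 36"
      using second_moment_le unfolding W_def block_sum_diff
      by (intro exI[of _ N] exI[of _ "\<lambda>n. \<Sum>j\<in>{N..<n}. \<Delta> j"]) auto
  qed
qed

text \<open>
  For tight sums a small multiple of the process has all its block sums close to \<open>0\<close> with high
  probability, so the exit estimates apply without any drift.
\<close>

theorem tight_sums_bounded_second_moment:
  assumes q: "short_memory q L"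
    and tight: "\<And>\<epsilon>. 0 < \<epsilon> \<Longrightarrow> \<exists>K. \<forall>n. prob (tail (block_sum q 0 n) K) \<le> \<epsilon>"
  shows "\<exists>C. \<forall>n. expectation (\<lambda>w. (block_sum q 0 n w)\<^sup>2) \<le> C"
proof -
  obtain l where l: "1 \<le> l" "\<phi> l \<le> 1 / 100" using mixing_small[of "1 / 100"] by auto
  have L: "0 \<le> L" by (rule short_memory_nonneg[OF q])
  note [measurable] = short_memory_block_sum(1)[OF q]
  obtain K0 where K0: "\<And>n. prob (tail (block_sum q 0 n) K0) \<le> 1 / 800"
    using tight[of "1 / 800"] by auto
  define K where "K = max K0 0"
  have K: "0 \<le> K" by (simp add: K_def)
  have PK: "prob (tail (block_sum q 0 n) K) \<le> 1 / 800" for n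
    using order_trans[OF finite_measure_mono K0[of n], of "(tail (block_sum q 0 n) K)"]
    by (auto simp: K_def)
  define D where "D = 400 * K + 100 * (real l + 2) * L + 1"
  have D: "0 < D" "400 * K \<le> D" "100 * (real l + 2) * L \<le> D" using K L by (auto simp: D_def intro!: add_nonneg_pos)
  define s where "s = 1 / D"
  have s: "0 < s" "s * (2 * K) \<le> 1 / 200" "(real l + 2) * (s * L) \<le> 1 / 100"
    using D by (auto simp: s_def field_simps)
  \<comment> \<open>The zero drift keeps the form of \<open>short_memory_affine\<close>; the start is at \<open>1\<close> since mixing is only available for pasts of positive times.\<close>
  interpret near_identity M Past Future \<phi> "\<lambda>j w. s * q j w - 0" "s * L + 0" l 1
  proof unfold_locales
    show "short_memory (\<lambda>j w. s * q j w - 0) (s * L + 0)"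
      using q s by (intro short_memory_affine[of q L s "\<lambda>_. 0" 0]) auto
    show "1 \<le> l" "\<phi> l \<le> 1 / 100" by (fact l)+
    show "real (l + 2) * (s * L + 0) \<le> 1 / 100" using s(3) by (simp add: add.commute)
    show "1 \<le> (1::nat)" by simp
    fix m n :: nat assume m: "1 \<le> m" "m \<le> n"
    have "prob (tail (block_sum q m n) (2 * K))
      \<le> prob ((tail (block_sum q 0 m) K) \<union> (tail (block_sum q 0 n) K))"
      using block_sum_split[of 0 m n q] m by (intro finite_measure_mono) auto
    also have "\<dots> \<le> prob (tail (block_sum q 0 m) K) + prob (tail (block_sum q 0 n) K)"
      by (intro measure_Un_le) auto
    also have "\<dots> \<le> 1 / 400" using PK[of m] PK[of n] by simp
    finally have "prob (tail (block_sum q m n) (2 * K)) \<le> 1 / 400" .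
    then have "expectation (\<lambda>w. cmod (cis (s * block_sum q m n w) - 1)) \<le> 1 / 200 + 2 * (1 / 400)"
      using expectation_cis_near_one[of "block_sum q m n" s "2 * K"] s K by auto
    then show "expectation (\<lambda>w. cmod (cis (block_sum (\<lambda>j w. s * q j w - 0) m n w) - 1)) \<le> 1 / 100"
      by (simp add: block_sum_scale)
  qed
  have "expectation (\<lambda>w. (block_sum q 0 n w)\<^sup>2) \<le> 2 * L\<^sup>2 + 72 / s\<^sup>2" for n
  proof (cases "n = 0")
    case True
    then show ?thesis by simp
  next
    case False
    have sq: "expectation (\<lambda>w. (s * block_sum q 1 n w)\<^sup>2) \<le> 36"
      using second_moment_le[of n] False by (simp add: block_sum_scale)
    note int = short_memory_block_sum(4)[OF q]
    have "expectation (\<lambda>w. (block_sum q 0 n w)\<^sup>2) \<le> expectation (\<lambda>w. 2 * L\<^sup>2 + 2 * (block_sum q 1 n w)\<^sup>2)"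
    proof (intro integral_mono)
      fix w assume w: "w \<in> space M"
      have "block_sum q 0 n w = q 0 w + block_sum q 1 n w"
        using block_sum_split[of 0 1 n q w] False by (simp add: block_sum_def)
      then have "(block_sum q 0 n w)\<^sup>2 \<le> 2 * (q 0 w)\<^sup>2 + 2 * (block_sum q 1 n w)\<^sup>2"
        using zero_le_power2[of "q 0 w - block_sum q 1 n w"] by (simp add: power2_eq_square algebra_simps)
      moreover have "(q 0 w)\<^sup>2 \<le> L\<^sup>2"
        using short_memory_boundD[OF q w, of 0] L by (intro abs_le_square_iff[THEN iffD1]) auto
      ultimately show "(block_sum q 0 n w)\<^sup>2 \<le> 2 * L\<^sup>2 + 2 * (block_sum q 1 n w)\<^sup>2" by linarith
    qed (use int in auto)
    also have "\<dots> = 2 * L\<^sup>2 + 2 * expectation (\<lambda>w. (block_sum q 1 n w)\<^sup>2)" using int by (simp add: prob_space)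
    also have "expectation (\<lambda>w. (block_sum q 1 n w)\<^sup>2) \<le> 36 / s\<^sup>2"
      using sq s(1) by (simp add: power_mult_distrib field_simps)
    finally show ?thesis by simp
  qed
  then show ?thesis by blast
qed

end

section \<open>Discrete subgroups of the reals\<close>

lemma discrete_subgroup_eq_multiples:
  fixes G :: "real set"
  assumes zero: "0 \<in> G" and diff: "\<And>x y. x \<in> G \<Longrightarrow> y \<in> G \<Longrightarrow> x - y \<in> G"
    and \<delta>: "0 < \<delta>" "\<And>x. x \<in> G \<Longrightarrow> \<bar>x\<bar> < \<delta> \<Longrightarrow> x = 0" and nz: "g \<in> G" "g \<noteq> 0"
  obtains h where "0 < h" "G = {h * real_of_int k | k. True}"
proof -
  have minus: "- x \<in> G" if "x \<in> G" for x using diff[OF zero that] by simp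
  have add: "x + y \<in> G" if "x \<in> G" "y \<in> G" for x y using diff[OF that(1) minus[OF that(2)]] by simp
  define P where "P = {x \<in> G. 0 < x}"
  have "\<bar>g\<bar> \<in> P" using nz minus[OF nz(1)] by (auto simp: P_def abs_if)
  then have ne: "P \<noteq> {}" by auto
  have bdd: "bdd_below P" by (intro bdd_belowI[of _ 0]) (auto simp: P_def)
  define h where "h = Inf P"
  have ge: "h \<le> x" if "x \<in> P" for x unfolding h_def using that bdd by (rule cInf_lower)
  have "h \<in> P"
  proof -
    obtain x where x: "x \<in> P" "x < h + \<delta>" using cInf_lessD[OF ne, of "h + \<delta>"] \<delta>(1) by (auto simp: h_def)
    have "x = h"
    proof (rule ccontr)
      assume "x \<noteq> h"
      then have "h < x" using ge[OF x(1)] by simp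
      then obtain y where y: "y \<in> P" "y < x" using cInf_lessD[OF ne, of x] by (auto simp: h_def)
      have "x - y \<in> G" using x y diff by (auto simp: P_def)
      moreover have "\<bar>x - y\<bar> < \<delta>" using ge[OF y(1)] x y by auto
      ultimately have "x - y = 0" by (rule \<delta>(2))
      then show False using y by simp
    qed
    then show ?thesis using x by simp
  qed
  then have h: "0 < h" "h \<in> G" by (auto simp: P_def)
  have nat_mult: "h * real n \<in> G" for n
    by (induction n) (auto simp: zero distrib_left intro: add h(2))
  have int_mult: "h * real_of_int k \<in> G" for k
    using nat_mult[of "nat k"] minus[OF nat_mult[of "nat (- k)"]] by (cases "0 \<le> k") auto
  have "\<exists>k. x = h * real_of_int k" if "x \<in> G" for x
  proof
    let ?k = "\<lfloor>x / h\<rfloor>"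
    have r: "x - h * real_of_int ?k \<in> G" using diff[OF that int_mult] .
    have "0 \<le> x - h * real_of_int ?k" "x - h * real_of_int ?k < h"
      using h(1) floor_divide_lower[OF h(1), of x] floor_divide_upper[OF h(1), of x] by (auto simp: algebra_simps)
    moreover have "\<not> (0 < x - h * real_of_int ?k \<and> x - h * real_of_int ?k < h)"
      using ge[of "x - h * real_of_int ?k"] r by (auto simp: P_def)
    ultimately show "x = h * real_of_int ?k" by linarith
  qed
  then have "G = {h * real_of_int k | k. True}" using int_mult by auto
  then show thesis using that h(1) by blast
qed

section \<open>The chain and its observables\<close>

lemma space_metric_borel [simp]: "space (metric_borel E d) = E"
  by (simp add: metric_borel_def space_measure_of_conv)

lemma space_path_space [simp]: "space (path_space E d I) = PiE I E"
  by (simp add: path_space_def space_PiM)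

lemma ennreal_divide_le_iff:
  assumes "0 \<le> p" "0 \<le> q" "0 \<le> K"
  shows "ennreal p / ennreal q \<le> ennreal K \<longleftrightarrow> p \<le> K * q"
proof (cases "q = 0")
  case True
  then show ?thesis using assms by (cases "p = 0") (auto simp: top_unique)
next
  case False
  then have "0 < q" using assms by simp
  then show ?thesis using assms by (simp add: divide_ennreal divide_le_eq)
qed

lemma sum_power_gap_le:
  assumes "0 < a" "a < (1::real)"
  shows "(\<Sum>i\<in>{j..<p}. a ^ (p - i)) \<le> a / (1 - a)"
proof (cases "j \<le> p")
  case True
  then show ?thesis
  proof (induction p rule: dec_induct)
    case (step p)
    have "(\<Sum>i\<in>{j..<Suc p}. a ^ (Suc p - i)) = a * (\<Sum>i\<in>{j..<p}. a ^ (p - i)) + a"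
      using step by (simp add: sum_distrib_left Suc_diff_le)
    also have "\<dots> \<le> a * (a / (1 - a)) + a" using step assms by (intro add_right_mono mult_left_mono) auto
    also have "\<dots> = a / (1 - a)" using assms by (simp add: field_simps)
    finally show ?case .
  qed (use assms in auto)
qed (use assms in auto)

locale mixing_chain = prob_space M for M :: "'w measure" +
  fixes E :: "nat \<Rightarrow> 'a set" and d :: "nat \<Rightarrow> 'a \<Rightarrow> 'a \<Rightarrow> real" and X :: "nat \<Rightarrow> 'w \<Rightarrow> 'a"
    and \<omega> :: "real \<Rightarrow> real" and a A1 A \<gamma> :: real
  assumes metric: "\<And>j. Metric_space (E j) (d j)"
    and diam: "\<And>j x y. x \<in> E j \<Longrightarrow> y \<in> E j \<Longrightarrow> d j x y \<le> 1"
    and X_measurable: "\<And>j. X j \<in> measurable M (metric_borel (E j) (d j))"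
    and omega_range: "\<omega> \<in> {0..1} \<rightarrow> {0..1}" and omega_zero: "\<omega> 0 = 0"
    and a: "0 < a" "a < 1" and A1: "0 < A1"
    and mixing_rate: "0 < \<gamma>" "\<gamma> < 1" "\<And>n. 1 \<le> n \<Longrightarrow> phi_R M E d X n \<le> A * \<gamma> ^ n"
begin

abbreviation paths :: "nat \<Rightarrow> (nat \<Rightarrow> 'a) set" where "paths j \<equiv> PiE {j..} E"

abbreviation law :: "nat \<Rightarrow> (nat \<Rightarrow> 'a) measure" where "law j \<equiv> kappa M E d X j"

abbreviation past :: "nat \<Rightarrow> 'w measure" where "past k \<equiv> chain_sigma M E d X 0 (enat k)"

abbreviation future :: "nat \<Rightarrow> 'w measure" where "future n \<equiv> chain_sigma M E d X n \<infinity>"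

abbreviation path_algebra :: "nat \<Rightarrow> (nat \<Rightarrow> 'a) measure" where "path_algebra j \<equiv> path_space E d {j..}"

abbreviation mean :: "(nat \<Rightarrow> (nat \<Rightarrow> 'a) \<Rightarrow> real) \<Rightarrow> nat \<Rightarrow> real" where
  "mean H j \<equiv> LINT y | law j. H j y"

abbreviation path_dist :: "nat \<Rightarrow> (nat \<Rightarrow> 'a) \<Rightarrow> (nat \<Rightarrow> 'a) \<Rightarrow> real" ("\<rho>") where
  "\<rho> \<equiv> omega_dist d \<omega> a A1"

definition along :: "(nat \<Rightarrow> (nat \<Rightarrow> 'a) \<Rightarrow> real) \<Rightarrow> nat \<Rightarrow> 'w \<Rightarrow> real" where
  "along H j w = H j (path_seg X {j..} w)"

lemma X_in: "w \<in> space M \<Longrightarrow> X j w \<in> E j"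
  using measurable_space[OF X_measurable] by simp

lemma path_seg_in: "w \<in> space M \<Longrightarrow> path_seg X {j..} w \<in> paths j"
  by (auto simp: path_seg_def X_in)

lemma paths_nonempty: "paths j \<noteq> {}"
  using not_empty path_seg_in by blast

lemma space_chain_sigma [simp]: "space (chain_sigma M E d X u v) = space M"
  by (simp add: chain_sigma_def space_measure_of_conv)

lemma sets_chain_sigma:
  "sets (chain_sigma M E d X u v) = sigma_sets (space M)
    {X s -` B \<inter> space M | s B. u \<le> s \<and> enat s \<le> v \<and> B \<in> sets (metric_borel (E s) (d s))}"
  unfolding chain_sigma_def by (rule sets_measure_of) auto

lemma subalgebra_chain_sigma: "subalgebra M (chain_sigma M E d X u v)"
  unfolding subalgebra_def sets_chain_sigma
  using measurable_sets[OF X_measurable] by (auto intro!: sets.sigma_sets_subset)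

lemma chain_sigma_mono:
  assumes "u' \<le> u" "v \<le> v'"
  shows "sets (chain_sigma M E d X u v) \<subseteq> sets (chain_sigma M E d X u' v')"
  unfolding sets_chain_sigma using assms by (intro sigma_sets_mono') (auto intro: order_trans; blast intro: order_trans)

lemma X_chain_sigma:
  assumes "u \<le> s" "enat s \<le> v"
  shows "X s \<in> measurable (chain_sigma M E d X u v) (metric_borel (E s) (d s))"
proof (rule measurableI)
  fix B assume "B \<in> sets (metric_borel (E s) (d s))"
  then show "X s -` B \<inter> space (chain_sigma M E d X u v) \<in> sets (chain_sigma M E d X u v)"
    unfolding space_chain_sigma unfolding sets_chain_sigma using assms by (intro sigma_sets.Basic) auto
qed (simp add: X_in)

lemma path_seg_measurable:
  "path_seg X {j..} \<in> measurable (future j) (path_algebra j)"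
  unfolding path_space_def path_seg_def by (intro measurable_restrict X_chain_sigma) auto

lemma path_seg_measurable': "path_seg X {j..} \<in> measurable M (path_algebra j)"
  by (rule measurable_from_subalg[OF subalgebra_chain_sigma path_seg_measurable])

lemma phi_R_bound:
  assumes "1 \<le> k" "B \<in> sets (past k)" "C \<in> sets (future (k + n))" "0 < prob C"
  shows "\<bar>prob (B \<inter> C) / prob C - prob B\<bar> \<le> phi_R M E d X n"
  unfolding phi_R_def
proof (rule cSup_upper)
  show "bdd_above {\<bar>prob (B \<inter> C) / prob C - prob B\<bar> | B C k. 1 \<le> k \<and> B \<in> sets (past k) \<and>
      C \<in> sets (future (k + n)) \<and> 0 < prob C}"
  proof (rule bdd_aboveI[of _ 1], clarify)
    fix B C k assume C: "0 < prob C" "C \<in> sets (future (k + n))"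
    then have "C \<in> events" using subalgebra_chain_sigma by (auto simp: subalgebra_def)
    then have "prob (B \<inter> C) \<le> prob C" by (intro finite_measure_mono) auto
    then have "0 \<le> prob (B \<inter> C) / prob C" "prob (B \<inter> C) / prob C \<le> 1" using C by auto
    then show "\<bar>prob (B \<inter> C) / prob C - prob B\<bar> \<le> 1" using prob_le_1[of B] measure_nonneg[of M B] by linarith
  qed
qed (use assms in blast)

sublocale mixing_filtrations M past future "\<lambda>n. A * \<gamma> ^ n"
proof unfold_locales
  show "subalgebra M (past k)" "subalgebra M (future n)" for k n
    by (rule subalgebra_chain_sigma)+
  show "sets (past j) \<subseteq> sets (past k)" if "j \<le> k" for j k
    using that by (intro chain_sigma_mono) auto
  show "sets (future n) \<subseteq> sets (future m)" if "m \<le> n" for m n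
    using that by (intro chain_sigma_mono) auto
  show "sets (future 0) \<subseteq> sigma_sets (space M) (\<Union>k. sets (past k))"
    unfolding sets_chain_sigma[of 0 \<infinity>]
  proof (rule sigma_sets_mono', clarify)
    fix s B assume "B \<in> sets (metric_borel (E s) (d s))"
    then have "X s -` B \<inter> space M \<in> sets (past s)"
      unfolding sets_chain_sigma by (intro sigma_sets.Basic) auto
    then show "X s -` B \<inter> space M \<in> (\<Union>k. sets (past k))" by blast
  qed
  show "\<bar>prob (B \<inter> C) - prob B * prob C\<bar> \<le> A * \<gamma> ^ n * prob C"
    if "1 \<le> k" "1 \<le> n" "B \<in> sets (past k)" "C \<in> sets (future (k + n))" for k n B C
  proof (cases "prob C = 0")
    case True
    have "C \<in> events" using that(4) subalgebra_chain_sigma by (auto simp: subalgebra_def)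
    then have "prob (B \<inter> C) \<le> prob C" by (intro finite_measure_mono) auto
    then show ?thesis using True measure_nonneg[of M "B \<inter> C"] by simp
  next
    case False
    then have C: "0 < prob C" by (simp add: zero_less_measure_iff)
    have "\<bar>prob (B \<inter> C) - prob B * prob C\<bar> = \<bar>prob (B \<inter> C) / prob C - prob B\<bar> * prob C"
      using C by (simp add: abs_mult[symmetric, of _ "prob C", unfolded abs_of_pos[OF C]] left_diff_distrib)
    also have "\<dots> \<le> A * \<gamma> ^ n * prob C"
      using phi_R_bound[OF that(1,3,4) C] mixing_rate(3)[OF that(2)] by (intro mult_right_mono) auto
    finally show ?thesis .
  qed
  show "(\<lambda>n. A * \<gamma> ^ n) \<longlonglongrightarrow> 0"
    using mixing_rate(1,2) by (intro tendsto_mult_right_zero LIMSEQ_power_zero) auto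
qed

lemma omega_term:
  assumes "x \<in> paths j" "y \<in> paths j"
  shows "0 \<le> \<omega> (d (j + n) (x (j + n)) (y (j + n)))" "\<omega> (d (j + n) (x (j + n)) (y (j + n))) \<le> 1"
proof -
  have "x (j + n) \<in> E (j + n)" "y (j + n) \<in> E (j + n)" using assms by (auto simp: PiE_iff)
  then have "d (j + n) (x (j + n)) (y (j + n)) \<in> {0..1}"
    using diam metric[of "j + n"] by (auto simp: Metric_space.nonneg)
  then have "\<omega> (d (j + n) (x (j + n)) (y (j + n))) \<in> {0..1}" using omega_range by blast
  then show "0 \<le> \<omega> (d (j + n) (x (j + n)) (y (j + n)))" "\<omega> (d (j + n) (x (j + n)) (y (j + n))) \<le> 1" by auto
qed

text \<open>
  Points agreeing on their first \<open>N\<close> coordinates are close: the weights \<open>a ^ n\<close> in \<open>omega_dist\<close>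
  turn regularity into exponentially fading dependence on far coordinates.
\<close>

lemma omega_dist_le_of_agree:
  assumes x: "x \<in> paths j" and y: "y \<in> paths j" and agree: "\<And>n. n < N \<Longrightarrow> x (j + n) = y (j + n)"
  shows "\<rho> j x y \<le> 2 * A1 * a ^ N"
proof -
  have "a ^ n * \<omega> (d (j + n) (x (j + n)) (y (j + n))) \<le> a ^ N" for n
  proof (cases "n < N")
    case True
    have "y (j + n) \<in> E (j + n)" using y by (auto simp: PiE_iff)
    then have "d (j + n) (x (j + n)) (y (j + n)) = 0"
      using agree[OF True] metric[of "j + n"] by (simp add: Metric_space.mdist_zero)
    then show ?thesis using a omega_zero by simp
  next
    case False
    have "a ^ n * \<omega> (d (j + n) (x (j + n)) (y (j + n))) \<le> a ^ n * 1"
      using omega_term[OF x y, of n] a by (intro mult_left_mono) auto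
    also have "\<dots> \<le> a ^ N" using a False by (simp add: power_decreasing)
    finally show ?thesis .
  qed
  then have "(SUP n. a ^ n * \<omega> (d (j + n) (x (j + n)) (y (j + n)))) \<le> a ^ N" by (intro cSUP_least) auto
  then show ?thesis using A1 by (simp add: omega_dist_def)
qed

lemma omega_dist_bounds:
  assumes x: "x \<in> paths j" and y: "y \<in> paths j"
  shows "0 \<le> \<rho> j x y" "\<rho> j x y \<le> 2 * A1"
proof -
  show "\<rho> j x y \<le> 2 * A1" using omega_dist_le_of_agree[OF x y, of 0] by simp
  let ?t = "\<lambda>n. a ^ n * \<omega> (d (j + n) (x (j + n)) (y (j + n)))"
  have "?t n \<le> 1" for n
    using omega_term[OF x y, of n] a power_le_one[of a n] mult_mono[of "a ^ n" 1 "\<omega> (d (j + n) (x (j + n)) (y (j + n)))" 1] by auto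
  then have "?t 0 \<le> (SUP n. ?t n)" by (intro cSUP_upper bdd_aboveI2[of _ _ 1]) auto
  then have "0 \<le> (SUP n. ?t n)" using omega_term(1)[OF x y, of 0] by simp
  then show "0 \<le> \<rho> j x y" using A1 by (simp add: omega_dist_def)
qed

text \<open>
  One constant for both parts of the norm, with suprema over all points instead of essential
  suprema. The next lemmas show that this is no loss: the variation controls the function
  everywhere from its value at a single point.
\<close>

definition uniformly_regular :: "(nat \<Rightarrow> (nat \<Rightarrow> 'a) \<Rightarrow> real) \<Rightarrow> real \<Rightarrow> bool" where
  "uniformly_regular H K \<longleftrightarrow> (\<forall>j. H j \<in> borel_measurable (path_algebra j)) \<and>
    (\<forall>j. \<forall>x\<in>paths j. \<bar>H j x\<bar> \<le> K) \<and>
    (\<forall>j. \<forall>x\<in>paths j. \<forall>y\<in>paths j. \<bar>H j x - H j y\<bar> \<le> K * \<rho> j x y)"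

lemma uniformly_regular_nonneg:
  assumes "uniformly_regular H K"
  shows "0 \<le> K"
proof -
  obtain x where "x \<in> paths 0" using paths_nonempty by blast
  then have "\<bar>H 0 x\<bar> \<le> K" using assms by (simp add: uniformly_regular_def)
  then show ?thesis using abs_ge_zero order_trans by blast
qed

lemma prob_space_law: "prob_space (law j)"
  unfolding kappa_def by (rule prob_space_distr[OF path_seg_measurable'])

lemma space_law [simp]: "space (law j) = paths j"
  by (simp add: kappa_def)

lemma sets_law [measurable_cong]: "sets (law j) = sets (path_algebra j)"
  by (simp add: kappa_def)

lemma omega_norm_bounded_iff:
  assumes H: "\<And>j. H j \<in> borel_measurable (path_algebra j)"
  shows "(SUP j. omega_norm M E d X \<omega> a A1 j (H j)) < \<infinity> \<longleftrightarrow> (\<exists>K. uniformly_regular H K)"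
proof
  let ?S = "SUP j. omega_norm M E d X \<omega> a A1 j (H j)"
  assume fin: "?S < \<infinity>"
  define K where "K = enn2real ?S"
  have K: "ennreal K = ?S" "0 \<le> K" using fin by (auto simp: K_def)
  have le: "omega_norm M E d X \<omega> a A1 j (H j) \<le> ennreal K" for j
    unfolding K(1) by (rule SUP_upper) simp
  have var: "\<bar>H j x - H j y\<bar> \<le> K * \<rho> j x y" if x: "x \<in> paths j" and y: "y \<in> paths j" for j x y
  proof (cases "x = y")
    case True
    then show ?thesis using K omega_dist_bounds[OF x y] by simp
  next
    case False
    have "ennreal \<bar>H j x - H j y\<bar> / ennreal (\<rho> j x y) \<le> omega_var E d \<omega> a A1 j (H j)"
      unfolding omega_var_def using x y False by (intro Sup_upper) auto
    also have "\<dots> \<le> omega_norm M E d X \<omega> a A1 j (H j)" by (simp add: omega_norm_def)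
    also have "\<dots> \<le> ennreal K" by (rule le)
    finally show ?thesis using K omega_dist_bounds[OF x y] by (subst (asm) ennreal_divide_le_iff) auto
  qed
  have bound: "\<bar>H j x\<bar> \<le> K + K * (2 * A1)" if x: "x \<in> paths j" for j x
  proof -
    interpret law: prob_space "law j" by (rule prob_space_law)
    have "esssup (law j) (\<lambda>x. ennreal \<bar>H j x\<bar>) \<le> omega_norm M E d X \<omega> a A1 j (H j)" by (simp add: omega_norm_def)
    also have "\<dots> \<le> ennreal K" by (rule le)
    finally have "AE y in law j. ennreal \<bar>H j y\<bar> \<le> ennreal K"
      using esssup_AE[of "\<lambda>x. ennreal \<bar>H j x\<bar>" "law j"] by (auto elim: eventually_mono)
    then have "AE y in law j. \<bar>H j y\<bar> \<le> K" by eventually_elim (simp add: K(2))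
    then obtain y where y: "y \<in> paths j" "\<bar>H j y\<bar> \<le> K"
      using law.AE_contr[of "\<lambda>y. \<not> \<bar>H j y\<bar> \<le> K"] by (metis (mono_tags, lifting) AE_I2 eventually_mono space_law)
    have "\<bar>H j x - H j y\<bar> \<le> K * \<rho> j x y" by (rule var[OF x y(1)])
    also have "\<dots> \<le> K * (2 * A1)" using K omega_dist_bounds[OF x y(1)] by (intro mult_left_mono) auto
    finally show ?thesis using y(2) by linarith
  qed
  have "\<bar>H j x - H j y\<bar> \<le> (K + K * (2 * A1)) * \<rho> j x y"
    if x: "x \<in> paths j" and y: "y \<in> paths j" for j x y
    using var[OF x y] omega_dist_bounds[OF x y] K A1
    by (elim order_trans) (intro mult_right_mono, auto)
  then show "\<exists>K. uniformly_regular H K"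
    unfolding uniformly_regular_def using H bound by (intro exI[of _ "K + K * (2 * A1)"]) auto
next
  assume "\<exists>K. uniformly_regular H K"
  then obtain K where K: "uniformly_regular H K" ..
  then have K0: "0 \<le> K" by (rule uniformly_regular_nonneg)
  have "omega_norm M E d X \<omega> a A1 j (H j) \<le> ennreal K + ennreal K" for j
    unfolding omega_norm_def
  proof (intro add_mono)
    have "(\<lambda>x. ennreal \<bar>H j x\<bar>) \<in> borel_measurable (law j)" using H[of j] by measurable
    then show "esssup (law j) (\<lambda>x. ennreal \<bar>H j x\<bar>) \<le> ennreal K"
      using K by (intro esssup_I) (auto intro!: AE_I2 ennreal_leI simp: uniformly_regular_def)
    show "omega_var E d \<omega> a A1 j (H j) \<le> ennreal K"
      unfolding omega_var_def
      by (intro Sup_least) (use K K0 omega_dist_bounds in \<open>auto simp: ennreal_divide_le_iff uniformly_regular_def\<close>)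
  qed
  then have "(SUP j. omega_norm M E d X \<omega> a A1 j (H j)) \<le> ennreal K + ennreal K" by (intro SUP_least)
  also have "\<dots> < \<infinity>" by simp
  finally show "(SUP j. omega_norm M E d X \<omega> a A1 j (H j)) < \<infinity>" .
qed

lemma along_Future:
  "H j \<in> borel_measurable (path_algebra j) \<Longrightarrow> along H j \<in> borel_measurable (future j)"
  unfolding along_def by (rule measurable_compose[OF path_seg_measurable])

text \<open>
  A term at time \<open>i\<close> is localised to the past of \<open>p\<close> by freezing the coordinates after \<open>p\<close> along a
  fixed path. The error is of order \<open>a ^ (p - i)\<close>, and the sum of these errors over \<open>i\<close> is bounded
  independently of the length of the block.
\<close>

lemma short_memory_along:
  assumes H: "uniformly_regular H K"
  shows "short_memory (along H) (K + 2 * A1 * K * (a / (1 - a)))"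
proof -
  let ?L = "K + 2 * A1 * K * (a / (1 - a))"
  have K: "0 \<le> K" using H by (rule uniformly_regular_nonneg)
  have extra: "0 \<le> 2 * A1 * K * (a / (1 - a))" using K A1 a by simp
  obtain w0 where w0: "w0 \<in> space M" using not_empty by auto
  show ?thesis
    unfolding short_memory_def
  proof (intro conjI allI ballI impI)
    show "along H j \<in> borel_measurable (future j)" for j
      using H by (intro along_Future) (simp add: uniformly_regular_def)
    show "\<bar>along H j w\<bar> \<le> ?L" if "w \<in> space M" for j w
    proof -
      have "\<bar>along H j w\<bar> \<le> K" using H path_seg_in[OF that] by (simp add: uniformly_regular_def along_def)
      then show ?thesis using extra by linarith
    qed
    fix j p :: nat assume "j \<le> p"
    define xi where "xi = (\<lambda>i w. \<lambda>k\<in>{i..}. if k \<le> p then X k w else X k w0)"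
    have xi_in: "xi i w \<in> paths i" if "w \<in> space M" for i w
      using X_in[OF that] X_in[OF w0] by (auto simp: xi_def)
    have xi_meas: "xi i \<in> measurable (past p) (path_space E d {i..})" for i
      unfolding path_space_def xi_def
    proof (intro measurable_restrict)
      fix k
      show "(\<lambda>w. if k \<le> p then X k w else X k w0) \<in> measurable (past p) (metric_borel (E k) (d k))"
        using X_chain_sigma[of 0 k "enat p"] X_in[OF w0] by (cases "k \<le> p") auto
    qed
    define r where "r = (\<lambda>w. \<Sum>i\<in>{j..<p}. H i (xi i w))"
    have "r \<in> borel_measurable (past p)"
      unfolding r_def
    proof (intro borel_measurable_sum)
      fix i
      have "H i \<in> borel_measurable (path_space E d {i..})" using H by (simp add: uniformly_regular_def)
      then show "(\<lambda>w. H i (xi i w)) \<in> borel_measurable (past p)"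
        by (rule measurable_compose[OF xi_meas])
    qed
    moreover have "\<bar>block_sum (along H) j p w - r w\<bar> \<le> ?L" if w: "w \<in> space M" for w
    proof -
      have "\<bar>block_sum (along H) j p w - r w\<bar> = \<bar>\<Sum>i\<in>{j..<p}. along H i w - H i (xi i w)\<bar>"
        by (simp add: block_sum_def r_def sum_subtractf)
      also have "\<dots> \<le> (\<Sum>i\<in>{j..<p}. \<bar>along H i w - H i (xi i w)\<bar>)" by (rule sum_abs)
      also have "\<dots> \<le> (\<Sum>i\<in>{j..<p}. K * (2 * A1 * a ^ (p - i)))"
      proof (intro sum_mono)
        fix i assume "i \<in> {j..<p}"
        have "\<bar>along H i w - H i (xi i w)\<bar> \<le> K * \<rho> i (path_seg X {i..} w) (xi i w)"
          using H path_seg_in[OF w] xi_in[OF w] by (simp add: uniformly_regular_def along_def)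
        also have "\<dots> \<le> K * (2 * A1 * a ^ (p - i))"
          using K by (intro mult_left_mono omega_dist_le_of_agree path_seg_in xi_in w) (auto simp: path_seg_def xi_def)
        finally show "\<bar>along H i w - H i (xi i w)\<bar> \<le> K * (2 * A1 * a ^ (p - i))" .
      qed
      also have "\<dots> = 2 * A1 * K * (\<Sum>i\<in>{j..<p}. a ^ (p - i))"
        by (simp add: sum_distrib_left mult.assoc mult.left_commute)
      also have "\<dots> \<le> 2 * A1 * K * (a / (1 - a))"
        using K A1 a by (intro mult_left_mono sum_power_gap_le) auto
      finally show ?thesis using K by linarith
    qed
    ultimately show "\<exists>r\<in>borel_measurable (past p). \<forall>w\<in>space M. \<bar>block_sum (along H) j p w - r w\<bar> \<le> ?L"
      by blast
  qed
qed

text \<open>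
  Tightness of the laws of the partial sums, in a form that passes to linear combinations.
\<close>

definition tight_sums :: "(nat \<Rightarrow> (nat \<Rightarrow> 'a) \<Rightarrow> real) \<Rightarrow> bool" where
  "tight_sums H \<longleftrightarrow> (\<forall>\<epsilon>>0. \<exists>K. \<forall>n. prob (tail (block_sum (along H) 0 n) K) \<le> \<epsilon>)"

lemma birkhoff_sum_eq: "birkhoff_sum X H n w = block_sum (along H) 0 n w"
  by (simp add: birkhoff_sum_def block_sum_def along_def lessThan_atLeast0)

lemma along_sums_measurable:
  assumes "\<And>j. H j \<in> borel_measurable (path_algebra j)"
  shows "block_sum (along H) m n \<in> borel_measurable M"
  using block_sum_measurable[of "along H"] along_Future[of H] assms by blast

lemma tight_iff_tight_sums:
  assumes H: "\<And>j. H j \<in> borel_measurable (path_algebra j)"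
  shows "tight (\<lambda>n. distr M borel (birkhoff_sum X H (Suc n))) \<longleftrightarrow> tight_sums H"
proof
  let ?I = "\<lambda>n p q. {w \<in> space M. p < block_sum (along H) 0 (Suc n) w \<and> block_sum (along H) 0 (Suc n) w \<le> q}"
  have S[measurable]: "block_sum (along H) m n \<in> borel_measurable M" for m n
    using along_sums_measurable H by blast
  have birk: "birkhoff_sum X H n = block_sum (along H) 0 n" for n
    by (rule ext) (rule birkhoff_sum_eq)
  have meas: "measure (distr M borel (birkhoff_sum X H n)) {p<..q} = prob {w \<in> space M. p < block_sum (along H) 0 n w \<and> block_sum (along H) 0 n w \<le> q}" for p q n
    unfolding birk by (subst measure_distr) (auto intro!: arg_cong[where f = prob])
  {
    assume t: "tight (\<lambda>n. distr M borel (birkhoff_sum X H (Suc n)))"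
    show "tight_sums H" unfolding tight_sums_def
    proof (intro allI impI)
      fix \<epsilon> :: real assume \<epsilon>: "0 < \<epsilon>"
      then obtain p q where pq: "\<And>n. 1 - \<epsilon> < prob (?I n p q)"
      proof -
        have "\<exists>p q. p < q \<and> (\<forall>n. 1 - \<epsilon> < prob (?I n p q))"
          using t \<epsilon> unfolding tight_def meas by simp
        then show thesis using that by blast
      qed
      have "prob {w \<in> space M. max \<bar>p\<bar> \<bar>q\<bar> < \<bar>block_sum (along H) 0 n w\<bar>} \<le> \<epsilon>" for n
      proof (cases n)
        case 0
        then show ?thesis using \<epsilon> by simp
      next
        case (Suc n')
        let ?G = "{w \<in> space M. p < block_sum (along H) 0 n w \<and> block_sum (along H) 0 n w \<le> q}"
        have "prob {w \<in> space M. max \<bar>p\<bar> \<bar>q\<bar> < \<bar>block_sum (along H) 0 n w\<bar>} \<le> prob (space M - ?G)"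
          by (intro finite_measure_mono) auto
        also have "\<dots> = 1 - prob ?G" by (intro prob_compl) measurable
        also have "\<dots> \<le> \<epsilon>" using pq[of n'] Suc by simp
        finally show ?thesis .
      qed
      then show "\<exists>K. \<forall>n. prob (tail (block_sum (along H) 0 n) K) \<le> \<epsilon>" by blast
    qed
  next
    assume t: "tight_sums H"
    show "tight (\<lambda>n. distr M borel (birkhoff_sum X H (Suc n)))" unfolding tight_def meas
    proof (intro conjI allI impI)
      show "real_distribution (distr M borel (birkhoff_sum X H (Suc n)))" for n
        unfolding birk by (rule real_distribution_distr) (rule S)
      fix \<epsilon> :: real assume \<epsilon>: "0 < \<epsilon>"
      then obtain K where K: "\<And>n. prob (tail (block_sum (along H) 0 n) K) \<le> \<epsilon> / 2"
        using t unfolding tight_sums_def by (meson half_gt_zero)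
      let ?c = "\<bar>K\<bar> + 1"
      have "1 - \<epsilon> < prob (?I n (- ?c) ?c)" for n
      proof -
        let ?B = "(tail (block_sum (along H) 0 (Suc n)) K)"
        have "1 - \<epsilon> < 1 - prob ?B" using K[of "Suc n"] \<epsilon> by linarith
        also have "\<dots> = prob (space M - ?B)" by (intro prob_compl[symmetric]) measurable
        also have "\<dots> \<le> prob (?I n (- ?c) ?c)"
          by (intro finite_measure_mono) auto
        finally show ?thesis .
      qed
      then show "\<exists>p q. p < q \<and> (\<forall>n. 1 - \<epsilon> < prob (?I n p q))"
        by (intro exI[of _ "- ?c"] exI[of _ ?c]) auto
    qed
  }
qed

definition negligible :: "(nat \<Rightarrow> (nat \<Rightarrow> 'a) \<Rightarrow> real) \<Rightarrow> bool" where
  "negligible H \<longleftrightarrow> (\<exists>K. uniformly_regular H K) \<and> tight_sums H"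

lemma reduction_iff:
  "reduction M E d X \<omega> a A1 f h H Z \<longleftrightarrow> negligible H \<and>
    (\<forall>j. \<forall>x\<in>paths j. f j x = mean f j + H j x + h * real_of_int (Z j x))"
proof (cases "\<forall>j. H j \<in> borel_measurable (path_algebra j)")
  case True
  then show ?thesis
    unfolding reduction_def negligible_def using omega_norm_bounded_iff[of H] tight_iff_tight_sums[of H] by auto
next
  case False
  then show ?thesis unfolding reduction_def negligible_def uniformly_regular_def by auto
qed

lemma negligible_linear:
  assumes H1: "negligible H1" and H2: "negligible H2"
  shows "negligible (\<lambda>j x. c1 * H1 j x + c2 * H2 j x)"
proof -
  obtain K1 where K1: "uniformly_regular H1 K1" using H1 by (auto simp: negligible_def)
  obtain K2 where K2: "uniformly_regular H2 K2" using H2 by (auto simp: negligible_def)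
  let ?H = "\<lambda>j x. c1 * H1 j x + c2 * H2 j x"
  have meas1: "H1 j \<in> borel_measurable (path_algebra j)" and meas2: "H2 j \<in> borel_measurable (path_algebra j)" for j
    using K1 K2 by (auto simp: uniformly_regular_def)
  have comb: "\<bar>c1 * p + c2 * q\<bar> \<le> \<bar>c1\<bar> * P + \<bar>c2\<bar> * Q" if "\<bar>p\<bar> \<le> P" "\<bar>q\<bar> \<le> Q" for p q P Q :: real
    using abs_triangle_ineq[of "c1 * p" "c2 * q"] mult_left_mono[OF that(1), of "\<bar>c1\<bar>"] mult_left_mono[OF that(2), of "\<bar>c2\<bar>"]
    by (simp add: abs_mult)
  have "uniformly_regular ?H (\<bar>c1\<bar> * K1 + \<bar>c2\<bar> * K2)"
    unfolding uniformly_regular_def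
  proof (intro conjI allI ballI)
    show "?H j \<in> borel_measurable (path_algebra j)" for j using meas1[of j] meas2[of j] by measurable
    show "\<bar>?H j x\<bar> \<le> \<bar>c1\<bar> * K1 + \<bar>c2\<bar> * K2" if "x \<in> paths j" for j x
      using K1 K2 that by (intro comb) (auto simp: uniformly_regular_def)
    fix j x y assume x: "x \<in> paths j" and y: "y \<in> paths j"
    let ?o = "\<rho> j x y"
    have "\<bar>c1 * (H1 j x - H1 j y) + c2 * (H2 j x - H2 j y)\<bar> \<le> \<bar>c1\<bar> * (K1 * ?o) + \<bar>c2\<bar> * (K2 * ?o)"
      using K1 K2 x y by (intro comb) (auto simp: uniformly_regular_def)
    then show "\<bar>?H j x - ?H j y\<bar> \<le> (\<bar>c1\<bar> * K1 + \<bar>c2\<bar> * K2) * ?o" by (simp add: algebra_simps)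
  qed
  moreover have "tight_sums ?H" unfolding tight_sums_def
  proof (intro allI impI)
    fix \<epsilon> :: real assume "0 < \<epsilon>"
    then obtain L1 L2 where L1: "\<And>n. prob (tail (block_sum (along H1) 0 n) L1) \<le> \<epsilon> / 2"
      and L2: "\<And>n. prob (tail (block_sum (along H2) 0 n) L2) \<le> \<epsilon> / 2"
      using H1 H2 unfolding negligible_def tight_sums_def by (meson half_gt_zero)
    have [measurable]: "block_sum (along H1) 0 n \<in> borel_measurable M" "block_sum (along H2) 0 n \<in> borel_measurable M" for n
      using along_sums_measurable[OF meas1] along_sums_measurable[OF meas2] by auto
    have eq: "block_sum (along ?H) 0 n w = c1 * block_sum (along H1) 0 n w + c2 * block_sum (along H2) 0 n w" for n w
      by (simp add: block_sum_def along_def sum.distrib sum_distrib_left)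
    have "prob {w \<in> space M. \<bar>c1\<bar> * L1 + \<bar>c2\<bar> * L2 < \<bar>block_sum (along ?H) 0 n w\<bar>} \<le> \<epsilon>" for n
    proof -
      have "prob {w \<in> space M. \<bar>c1\<bar> * L1 + \<bar>c2\<bar> * L2 < \<bar>block_sum (along ?H) 0 n w\<bar>} \<le>
          prob ((tail (block_sum (along H1) 0 n) L1) \<union> (tail (block_sum (along H2) 0 n) L2))"
        unfolding eq using comb[of "block_sum (along H1) 0 n _" L1 "block_sum (along H2) 0 n _" L2]
        by (intro finite_measure_mono) (auto simp: not_less[symmetric])
      also have "\<dots> \<le> prob (tail (block_sum (along H1) 0 n) L1) + prob (tail (block_sum (along H2) 0 n) L2)"
        by (intro measure_Un_le) auto
      also have "\<dots> \<le> \<epsilon>" using L1[of n] L2[of n] by simp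
      finally show ?thesis .
    qed
    then show "\<exists>K. \<forall>n. prob (tail (block_sum (along ?H) 0 n) K) \<le> \<epsilon>" by blast
  qed
  ultimately show ?thesis unfolding negligible_def by blast
qed

lemma negligible_zero: "negligible (\<lambda>j x. 0)"
  unfolding negligible_def
proof
  show "\<exists>K. uniformly_regular (\<lambda>j x. 0) K" by (intro exI[of _ 0]) (simp add: uniformly_regular_def)
  show "tight_sums (\<lambda>j x. 0)" unfolding tight_sums_def
    by (auto simp: block_sum_def along_def intro!: exI[of _ 0])
qed

lemma integral_law: "H j \<in> borel_measurable (path_algebra j) \<Longrightarrow> mean H j = expectation (along H j)"
  unfolding kappa_def along_def by (rule integral_distr[OF path_seg_measurable'])

lemma integrable_law:
  assumes "uniformly_regular H K"
  shows "integrable (law j) (H j)"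
proof -
  interpret law: prob_space "law j" by (rule prob_space_law)
  have "H j \<in> borel_measurable (path_algebra j)" using assms by (simp add: uniformly_regular_def)
  then have "H j \<in> borel_measurable (law j)" by measurable
  then show ?thesis
    using assms by (intro law.integrable_bounded[where B = K]) (auto simp: uniformly_regular_def)
qed

lemma integrable_along:
  assumes "uniformly_regular H K"
  shows "integrable M (along H j)"
proof (rule integrable_bounded)
  show "along H j \<in> borel_measurable M"
    using assms along_Future[of H j] measurable_Future by (simp add: uniformly_regular_def)
  show "norm (along H j w) \<le> K" if "w \<in> space M" for w
    using assms path_seg_in[OF that] by (simp add: uniformly_regular_def along_def)
qed

lemma mean_bound:
  assumes H: "uniformly_regular H K"
  shows "mean H j = expectation (along H j)" and "\<bar>mean H j\<bar> \<le> K"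
proof -
  show eq: "mean H j = expectation (along H j)" using H by (intro integral_law) (simp add: uniformly_regular_def)
  have "\<bar>mean H j\<bar> \<le> expectation (\<lambda>w. \<bar>along H j w\<bar>)" unfolding eq by (rule integral_abs_bound)
  also have "\<dots> \<le> K" using integrable_along[OF H] H path_seg_in
    by (intro expectation_le_const integrable_abs) (auto simp: uniformly_regular_def along_def[abs_def])
  finally show "\<bar>mean H j\<bar> \<le> K" .
qed

text \<open>
  Tightness alone does not bound the means of the sums; the bounded second moments do.
\<close>

lemma negligible_centered:
  assumes H: "negligible H"
  shows "negligible (\<lambda>j x. H j x - mean H j)"
proof -
  obtain K where K: "uniformly_regular H K" using H by (auto simp: negligible_def)
  define v where "v = mean H"
  have meas: "H j \<in> borel_measurable (path_algebra j)" for j using K by (simp add: uniformly_regular_def)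
  have v: "v j = expectation (along H j)" and vK: "\<bar>v j\<bar> \<le> K" for j
    unfolding v_def by (rule mean_bound[OF K])+
  have S[measurable]: "block_sum (along H) m n \<in> borel_measurable M" for m n
    by (rule along_sums_measurable[OF meas])
  have K0: "0 \<le> K" using K by (rule uniformly_regular_nonneg)
  have "uniformly_regular (\<lambda>j x. H j x - v j) (2 * K)"
    unfolding uniformly_regular_def
  proof (intro conjI allI ballI)
    show "(\<lambda>x. H j x - v j) \<in> borel_measurable (path_algebra j)" for j using meas[of j] by measurable
    show "\<bar>H j x - v j\<bar> \<le> 2 * K" if "x \<in> paths j" for j x
    proof -
      have "\<bar>H j x\<bar> \<le> K" using K that by (simp add: uniformly_regular_def)
      then show ?thesis using vK[of j] by linarith
    qed
    fix j x y assume x: "x \<in> paths j" and y: "y \<in> paths j"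
    have "\<bar>H j x - H j y\<bar> \<le> K * \<rho> j x y" using K x y by (simp add: uniformly_regular_def)
    moreover have "0 \<le> K * \<rho> j x y" using K0 omega_dist_bounds[OF x y] by simp
    ultimately show "\<bar>H j x - v j - (H j y - v j)\<bar> \<le> 2 * K * \<rho> j x y" by simp
  qed
  moreover have "tight_sums (\<lambda>j x. H j x - v j)" unfolding tight_sums_def
  proof (intro allI impI)
    have tight: "\<exists>K. \<forall>n. prob (tail (block_sum (along H) 0 n) K) \<le> \<epsilon>" if "0 < \<epsilon>" for \<epsilon>
      using H that by (auto simp: negligible_def tight_sums_def)
    obtain C where C: "\<And>n. expectation (\<lambda>w. (block_sum (along H) 0 n w)\<^sup>2) \<le> C"
      using tight_sums_bounded_second_moment[OF short_memory_along[OF K] tight] by blast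
    define c where "c = sqrt C"
    have mean: "\<bar>\<Sum>j<n. v j\<bar> \<le> c" for n
    proof -
      have "(\<Sum>j<n. v j) = expectation (block_sum (along H) 0 n)"
        unfolding block_sum_def v lessThan_atLeast0
        using integrable_along[OF K] by (subst Bochner_Integration.integral_sum) auto
      moreover have "(expectation (block_sum (along H) 0 n))\<^sup>2 \<le> expectation (\<lambda>w. (block_sum (along H) 0 n w)\<^sup>2)"
        using short_memory_block_sum(2)[OF short_memory_along[OF K], of _ 0 n] by (intro square_expectation_le) auto
      ultimately have "(\<Sum>j<n. v j)\<^sup>2 \<le> C" using C[of n] by simp
      then show ?thesis unfolding c_def by (rule real_le_rsqrt[of "\<bar>_\<bar>", simplified])
    qed
    fix \<epsilon> :: real assume "0 < \<epsilon>"
    let ?S = "block_sum (along (\<lambda>j x. H j x - v j)) 0"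
    obtain L where L: "\<And>n. prob (tail (block_sum (along H) 0 n) L) \<le> \<epsilon>" using tight \<open>0 < \<epsilon>\<close> by blast
    have "prob (tail (?S n) (L + c)) \<le> \<epsilon>" for n
    proof -
      have "?S n w = block_sum (along H) 0 n w - (\<Sum>j<n. v j)" for w
        by (simp add: block_sum_def along_def sum_subtractf lessThan_atLeast0)
      then have "L < \<bar>block_sum (along H) 0 n w\<bar>" if "L + c < \<bar>?S n w\<bar>" for w
        using mean[of n] that by fastforce
      then have "prob (tail (?S n) (L + c))
          \<le> prob (tail (block_sum (along H) 0 n) L)"
        by (intro finite_measure_mono) auto
      then show ?thesis using L[of n] by linarith
    qed
    then show "\<exists>K. \<forall>n. prob (tail (?S n) K) \<le> \<epsilon>" by blast
  qed
  ultimately show ?thesis unfolding negligible_def v_def by blast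
qed

section \<open>The group of frequencies\<close>

text \<open>
  A frequency is a number \<open>t\<close> such that the centred \<open>t * f\<close> is integer valued up to a negligible
  sequence. Passing from \<open>h\<close> to \<open>t = 1 / h\<close> makes the condition additive in \<open>t\<close> and admits \<open>t = 0\<close>.
\<close>

definition frequency :: "(nat \<Rightarrow> (nat \<Rightarrow> 'a) \<Rightarrow> real) \<Rightarrow> real \<Rightarrow> bool" where
  "frequency f t \<longleftrightarrow> (\<exists>H (Z :: nat \<Rightarrow> (nat \<Rightarrow> 'a) \<Rightarrow> int). negligible H \<and>
    (\<forall>j. \<forall>x\<in>paths j. t * (f j x - mean f j) = H j x + real_of_int (Z j x)))"

lemma reducible_to_iff_frequency:
  "reducible_to M E d X \<omega> a A1 f h \<longleftrightarrow> h \<noteq> 0 \<and> frequency f (1 / h)"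
proof (cases "h = 0")
  case False
  show ?thesis
  proof
    assume "reducible_to M E d X \<omega> a A1 f h"
    then obtain H Z where "negligible H" and eq: "\<And>j x. x \<in> paths j \<Longrightarrow> f j x = mean f j + H j x + h * real_of_int (Z j x)"
      unfolding reducible_to_def reduction_iff by blast
    then have "negligible (\<lambda>j x. 1 / h * H j x + 0 * H j x)" by (intro negligible_linear)
    moreover have "1 / h * (f j x - mean f j) = (1 / h * H j x + 0 * H j x) + real_of_int (Z j x)" if "x \<in> paths j" for j x
      using False eq[OF that] by (simp add: field_simps)
    ultimately show "h \<noteq> 0 \<and> frequency f (1 / h)" unfolding frequency_def using False by blast
  next
    assume "h \<noteq> 0 \<and> frequency f (1 / h)"
    then obtain H Z where "negligible H"
      and eq: "\<And>j x. x \<in> paths j \<Longrightarrow> 1 / h * (f j x - mean f j) = H j x + real_of_int (Z j x)"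
      unfolding frequency_def by blast
    then have "negligible (\<lambda>j x. h * H j x + 0 * H j x)" by (intro negligible_linear)
    moreover have "f j x = mean f j + (h * H j x + 0 * H j x) + h * real_of_int (Z j x)" if "x \<in> paths j" for j x
      using False eq[OF that] by (simp add: field_simps)
    ultimately show "reducible_to M E d X \<omega> a A1 f h" unfolding reducible_to_def reduction_iff using False by blast
  qed
qed (simp add: reducible_to_def)

lemma frequency_zero: "frequency f 0"
  unfolding frequency_def by (intro exI[of _ "\<lambda>j x. 0"]) (auto simp: negligible_zero intro!: exI[of _ "\<lambda>j x. 0"])

lemma frequency_diff:
  assumes "frequency f s" "frequency f t"
  shows "frequency f (s - t)"
proof -
  obtain H1 Z1 where 1: "negligible H1"
    "\<And>j x. x \<in> paths j \<Longrightarrow> s * (f j x - mean f j) = H1 j x + real_of_int (Z1 j x)"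
    using assms(1) unfolding frequency_def by blast
  obtain H2 Z2 where 2: "negligible H2"
    "\<And>j x. x \<in> paths j \<Longrightarrow> t * (f j x - mean f j) = H2 j x + real_of_int (Z2 j x)"
    using assms(2) unfolding frequency_def by blast
  have "negligible (\<lambda>j x. 1 * H1 j x + (- 1) * H2 j x)" using 1 2 by (intro negligible_linear)
  moreover have "(s - t) * (f j x - mean f j) = (1 * H1 j x + (- 1) * H2 j x) + real_of_int (Z1 j x - Z2 j x)"
    if "x \<in> paths j" for j x
    using 1(2)[OF that] 2(2)[OF that] by (simp add: left_diff_distrib)
  ultimately show ?thesis unfolding frequency_def
    by (intro exI[of _ "\<lambda>j x. 1 * H1 j x + (- 1) * H2 j x"] exI[of _ "\<lambda>j x. Z1 j x - Z2 j x"]) simp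
qed

lemma reduction_freqs_eq: "reduction_freqs M E d X \<omega> a A1 f = {t. frequency f t}"
proof (intro equalityI subsetI)
  fix t assume "t \<in> {t. frequency f t}"
  then show "t \<in> reduction_freqs M E d X \<omega> a A1 f"
    unfolding reduction_freqs_def reducible_to_iff_frequency
    by (cases "t = 0") (auto intro!: exI[of _ "1 / t"])
qed (auto simp: reduction_freqs_def reducible_to_iff_frequency frequency_zero)

text \<open>
  A small frequency makes \<open>cis (u * S)\<close> an asymptotic coboundary for the centred sums \<open>S\<close> of \<open>f\<close>,
  which bounds the variance of \<open>S\<close> from some time on. The finitely many terms before that time
  contribute a bounded amount.
\<close>

theorem frequencies_isolated:
  assumes f: "uniformly_regular f K" and sigma: "filterlim (sigma_dev M X f) at_top sequentially"
  shows "\<exists>\<delta>>0. \<forall>t. frequency f t \<longrightarrow> \<bar>t\<bar> < \<delta> \<longrightarrow> t = 0"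
proof -
  define v where "v = mean f"
  have v: "v j = expectation (along f j)" and vK: "\<bar>v j\<bar> \<le> K" for j
    unfolding v_def by (rule mean_bound[OF f])+
  define q where "q = (\<lambda>j w. 1 * along f j w - v j)"
  obtain L where q: "short_memory q L"
    unfolding q_def using short_memory_affine[OF short_memory_along[OF f], of 1 v K] vK by auto
  obtain \<delta> where \<delta>: "0 < \<delta>" "\<And>u g. 0 < u \<Longrightarrow> u < \<delta> \<Longrightarrow> asymptotic_coboundary (\<lambda>j w. u * q j w) g \<Longrightarrow>
    (\<exists>N c. \<forall>n\<ge>N. expectation (\<lambda>w. (u * block_sum q N n w - c n)\<^sup>2) \<le> 36)"
    using small_coboundary_bounded_variance[OF q] by blast
  note [measurable] = short_memory_block_sum(1)[OF q]
  note Sb = short_memory_block_sum(2)[OF q] and iS = short_memory_block_sum(3)[OF q] and iS2 = short_memory_block_sum(4)[OF q]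
  have mean: "expectation (block_sum q m n) = 0" for m n
  proof -
    have "expectation (block_sum q m n) = (\<Sum>j\<in>{m..<n}. expectation (\<lambda>w. 1 * along f j w - v j))"
      unfolding block_sum_def q_def using integrable_along[OF f] by (intro Bochner_Integration.integral_sum) auto
    also have "\<dots> = 0" using integrable_along[OF f] v by (simp add: prob_space)
    finally show ?thesis .
  qed
  have no_small: "\<not> frequency f t" if t: "0 < t" "2 * pi * t < \<delta>" for t
  proof
    assume "frequency f t"
    then obtain H Z where H: "negligible H"
      and eq: "\<And>j x. x \<in> paths j \<Longrightarrow> t * (f j x - v j) = H j x + real_of_int (Z j x)"
      unfolding frequency_def v_def by blast
    obtain KH where KH: "uniformly_regular H KH" using H by (auto simp: negligible_def)
    obtain g where g: "asymptotic_coboundary (\<lambda>j w. 2 * pi * along H j w) g"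
      using tight_sums_asymptotic_coboundary[of "along H"] short_memory_FutureD[OF short_memory_along[OF KH]] H
      unfolding negligible_def tight_sums_def by blast
    let ?q = "block_sum (\<lambda>j w. 2 * pi * t * q j w)" and ?a = "block_sum (\<lambda>j w. 2 * pi * along H j w)"
    have phase: "cis (?q m n w) = cis (?a m n w)"
      if w: "w \<in> space M" for m n w
    proof -
      let ?z = "\<lambda>j. Z j (path_seg X {j..} w)"
      have "2 * pi * t * q j w = 2 * pi * along H j w + 2 * pi * real_of_int (?z j)" for j
        using eq[OF path_seg_in[OF w], of j] by (simp add: q_def along_def mult.assoc distrib_left[symmetric])
      then have "?q m n w
          = ?a m n w + 2 * pi * real_of_int (\<Sum>j\<in>{m..<n}. ?z j)"
        by (simp add: block_sum_def sum.distrib sum_distrib_left)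
      moreover have "cis (2 * pi * real_of_int (\<Sum>j\<in>{m..<n}. ?z j)) = 1" by (rule cis_multiple_2pi) (rule Ints_of_int)
      ultimately show ?thesis by (simp only: cis_mult[symmetric] mult_1_right)
    qed
    have "asymptotic_coboundary (\<lambda>j w. 2 * pi * t * q j w) g"
    proof -
      have "expectation (\<lambda>w. cmod (g n w - cis (?q m n w) * g m w))
          = expectation (\<lambda>w. cmod (g n w - cis (?a m n w) * g m w))" for m n
        by (intro Bochner_Integration.integral_cong) (auto simp: phase)
      then show ?thesis using g unfolding asymptotic_coboundary_def by simp
    qed
    then obtain N c where Nc: "\<And>n. N \<le> n \<Longrightarrow> expectation (\<lambda>w. (2 * pi * t * block_sum q N n w - c n)\<^sup>2) \<le> 36"
      using \<delta>(2)[of "2 * pi * t" g] t by auto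
    define u where "u = 2 * pi * t"
    have u: "0 < u" using t by (simp add: u_def)
    have var: "expectation (\<lambda>w. (block_sum q N n w)\<^sup>2) \<le> 36 / u\<^sup>2" if "N \<le> n" for n
    proof -
      have "u\<^sup>2 * expectation (\<lambda>w. (block_sum q N n w)\<^sup>2) \<le> u\<^sup>2 * expectation (\<lambda>w. (block_sum q N n w)\<^sup>2) - 2 * u * c n * expectation (block_sum q N n) + (c n)\<^sup>2"
        by (simp add: mean)
      also have "\<dots> = expectation (\<lambda>w. u\<^sup>2 * (block_sum q N n w)\<^sup>2 - 2 * u * c n * block_sum q N n w + (c n)\<^sup>2)"
        using iS iS2 by (simp add: prob_space)
      also have "\<dots> = expectation (\<lambda>w. (u * block_sum q N n w - c n)\<^sup>2)"
        by (simp add: power2_diff power_mult_distrib algebra_simps)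
      also have "\<dots> \<le> 36" using Nc[OF that] by (simp add: u_def)
      finally show ?thesis using u by (simp add: field_simps)
    qed
    define C where "C = 2 * (real N * L)\<^sup>2 + 2 * (36 / u\<^sup>2)"
    have sigma_le: "sigma_dev M X f n \<le> sqrt C" if n: "N \<le> n" for n
    proof -
      have "birkhoff_sum X f n w = block_sum q 0 n w + (\<Sum>j<n. v j)" for w
        by (simp add: birkhoff_sum_eq block_sum_def q_def sum_subtractf lessThan_atLeast0)
      then have "sigma_dev M X f n = sqrt (expectation (\<lambda>w. (block_sum q 0 n w)\<^sup>2))"
        using iS mean by (simp add: sigma_dev_def prob_space)
      moreover have "expectation (\<lambda>w. (block_sum q 0 n w)\<^sup>2) \<le> expectation (\<lambda>w. 2 * (real N * L)\<^sup>2 + 2 * (block_sum q N n w)\<^sup>2)"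
      proof (intro integral_mono iS2)
        fix w assume w: "w \<in> space M"
        have "(x + y)\<^sup>2 \<le> 2 * x\<^sup>2 + 2 * y\<^sup>2" for x y :: real
          using zero_le_power2[of "x - y"] by (simp add: power2_eq_square algebra_simps)
        then have "(block_sum q 0 n w)\<^sup>2 \<le> 2 * (block_sum q 0 N w)\<^sup>2 + 2 * (block_sum q N n w)\<^sup>2"
          using block_sum_split[of 0 N n q w] n by simp
        moreover have "\<bar>block_sum q 0 N w\<bar>\<^sup>2 \<le> (real N * L)\<^sup>2"
          using Sb[OF w, of 0 N] by (intro power_mono) auto
        ultimately show "(block_sum q 0 n w)\<^sup>2 \<le> 2 * (real N * L)\<^sup>2 + 2 * (block_sum q N n w)\<^sup>2" by simp
      qed (use iS2 in auto)
      moreover have "\<dots> \<le> C" using iS2 var[OF n] by (simp add: C_def prob_space)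
      ultimately show ?thesis by simp
    qed
    have "\<forall>\<^sub>F n in sequentially. sqrt C + 1 \<le> sigma_dev M X f n \<and> N \<le> n"
      using sigma unfolding filterlim_at_top by (intro eventually_conj eventually_ge_at_top) auto
    then obtain n where "sqrt C + 1 \<le> sigma_dev M X f n" "N \<le> n"
      using eventually_happens'[OF sequentially_bot] by blast
    then show False using sigma_le[of n] by linarith
  qed
  show ?thesis
  proof (intro exI[of _ "\<delta> / (2 * pi)"] conjI allI impI)
    show "0 < \<delta> / (2 * pi)" using \<delta>(1) by simp
    fix t assume t: "frequency f t" "\<bar>t\<bar> < \<delta> / (2 * pi)"
    then have small: "2 * pi * \<bar>t\<bar> < \<delta>" by (simp add: field_simps)
    have "frequency f \<bar>t\<bar>" using t(1) frequency_diff[OF frequency_zero t(1)] by (auto simp: abs_if)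
    then show "t = 0" using no_small[of "\<bar>t\<bar>"] small by auto
  qed
qed

text \<open>
  The mean of \<open>Z j\<close> is \<open>- 1 / h\<close> times the mean of \<open>H j\<close>, so substituting the representation of \<open>Z\<close>
  into that of \<open>f\<close> leaves the centred \<open>H j\<close>, and centring preserves tightness.
\<close>

lemma frequency_refine:
  assumes f: "uniformly_regular f K" and red: "reduction M E d X \<omega> a A1 f h H Z" and h: "h \<noteq> 0"
    and Z: "reducible_to M E d X \<omega> a A1 (\<lambda>j x. real_of_int (Z j x)) h'"
  shows "frequency f (1 / (h * h'))"
proof -
  let ?z = "mean (\<lambda>j y. real_of_int (Z j y))"
  have H: "negligible H" and eq: "\<And>j x. x \<in> paths j \<Longrightarrow> f j x = mean f j + H j x + h * real_of_int (Z j x)"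
    using red unfolding reduction_iff by auto
  obtain KH where KH: "uniformly_regular H KH" using H by (auto simp: negligible_def)
  obtain H' Z' where h': "h' \<noteq> 0" and H': "negligible H'"
    and eq': "\<And>j x. x \<in> paths j \<Longrightarrow> real_of_int (Z j x) = ?z j + H' j x + h' * real_of_int (Z' j x)"
    using Z unfolding reducible_to_def reduction_iff by blast
  have mean: "?z j = - mean H j / h" for j
  proof -
    interpret law: prob_space "law j" by (rule prob_space_law)
    let ?v = "mean f j"
    have "?z j = (LINT y | law j. (f j y - ?v - H j y) / h)"
      using eq[of _ j] h by (intro Bochner_Integration.integral_cong) (auto simp: field_simps)
    also have "\<dots> = - mean H j / h"
      using integrable_law[OF f, of j] integrable_law[OF KH, of j] law.prob_space by simp
    finally show ?thesis .
  qed
  let ?H = "\<lambda>j x. 1 / (h * h') * (H j x - mean H j) + 1 / h' * H' j x"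
  have "negligible ?H" using negligible_centered[OF H] H' by (rule negligible_linear)
  moreover have "1 / (h * h') * (f j x - mean f j) = ?H j x + real_of_int (Z' j x)" if x: "x \<in> paths j" for j x
  proof -
    have "f j x - mean f j = (H j x - mean H j) + h * H' j x + h * h' * real_of_int (Z' j x)"
    proof -
      have "h * real_of_int (Z j x) = h * H' j x + h * h' * real_of_int (Z' j x) - mean H j"
        using eq'[OF x] h unfolding mean by (simp add: field_simps)
      then show ?thesis using eq[OF x] by linarith
    qed
    then show ?thesis using h h' by (simp add: distrib_left)
  qed
  ultimately show ?thesis unfolding frequency_def by blast
qed

end

text \<open>
  The generator \<open>h0\<close> of the group of frequencies gives the largest \<open>r = 1 / h0\<close>. Any
  reduction of the corresponding \<open>Z\<close> with \<open>h' > 1\<close> would produce the frequency \<open>h0 / h'\<close>.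
\<close>

theorem theorem2p13:
  fixes M :: "'w measure"
    and E :: "nat \<Rightarrow> 'a set"
    and d :: "nat \<Rightarrow> 'a \<Rightarrow> 'a \<Rightarrow> real"
    and X :: "nat \<Rightarrow> 'w \<Rightarrow> 'a"
    and P :: "nat \<Rightarrow> nat \<Rightarrow> 'a \<Rightarrow> (nat \<Rightarrow> 'a) measure"
    and \<omega> :: "real \<Rightarrow> real"
    and a A \<gamma> A1 :: real
    and n0 m0 :: nat
    and f :: "nat \<Rightarrow> (nat \<Rightarrow> 'a) \<Rightarrow> real"
  assumes prob: "prob_space M"
    and metric: "\<And>j. Metric_space (E j) (d j)"
    and diam: "\<And>j x y. x \<in> E j \<Longrightarrow> y \<in> E j \<Longrightarrow> d j x y \<le> 1"
    and chain: "markov_chain M E d X"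
    and cond: "\<And>j n. 1 \<le> n \<Longrightarrow> cond_law M E d X j n (P j n)"
    and omega_range: "\<omega> \<in> {0..1} \<rightarrow> {0..1}"
    and omega_cont: "continuous (at 0 within {0..1}) \<omega>"
    and omega_zero: "\<omega> 0 = 0"
    and a: "0 < a" "a < 1"
    and mixing: "0 < A" "0 < \<gamma>" "\<gamma> < 1" "\<And>n. 1 \<le> n \<Longrightarrow> phi_R M E d X n \<le> A * \<gamma> ^ n"
    and regular: "0 < A1" "1 \<le> n0"
      "\<And>j x y. x \<in> E (j + n0) \<Longrightarrow> y \<in> E (j + n0) \<Longrightarrow>
        tv_dist (P j n0 x) (P j n0 y) \<le> A1 * \<omega> (d (j + n0) x y)"
    and balls: "1 \<le> m0"
      "\<forall>\<^sub>F r in at_right 0.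
        0 < Inf {measure (P j m0 x) (omega_ball E d \<omega> j m0 b r) | j b x.
                  b \<in> PiE {j..<j + m0} E \<and> x \<in> E (j + m0)}"
    and f_meas: "\<And>j. f j \<in> borel_measurable (path_space E d {j..})"
    and f_bdd: "(SUP j. omega_norm M E d X \<omega> a A1 j (f j)) < \<infinity>"
    and f_red: "reducible M E d X \<omega> a A1 f"
    and sigma: "filterlim (sigma_dev M X f) at_top sequentially"
  shows "\<exists>h0>0.
      reduction_freqs M E d X \<omega> a A1 f = {h0 * real_of_int k | k. True} \<and>
      reducible_to M E d X \<omega> a A1 f (1 / h0) \<and>
      (\<forall>r>0. reducible_to M E d X \<omega> a A1 f r \<longrightarrow> r \<le> 1 / h0) \<and>
      (\<exists>h H Z. h \<noteq> 0 \<and> reduction M E d X \<omega> a A1 f h H Z \<and>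
        \<not> int_reducible M E d X \<omega> a A1 Z)"
proof -
  interpret prob_space M by (rule prob)
  interpret mixing_chain M E d X \<omega> a A1 A \<gamma>
  proof (intro mixing_chain.intro mixing_chain_axioms.intro prob)
    show "X j \<in> measurable M (metric_borel (E j) (d j))" for j
      using chain by (simp add: markov_chain_def)
  qed (fact metric diam omega_range omega_zero a mixing regular(1))+
  obtain K where K: "uniformly_regular f K"
    using omega_norm_bounded_iff[OF f_meas] f_bdd by blast
  obtain \<delta> where \<delta>: "0 < \<delta>" "\<And>t. frequency f t \<Longrightarrow> \<bar>t\<bar> < \<delta> \<Longrightarrow> t = 0"
    using frequencies_isolated[OF K sigma] by blast
  obtain r where r: "r \<noteq> 0" "frequency f (1 / r)"
    using f_red unfolding reducible_def reducible_to_iff_frequency by blast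
  obtain h0 where h0: "0 < h0" and freqs: "{t. frequency f t} = {h0 * real_of_int k | k. True}"
    using discrete_subgroup_eq_multiples[of "{t. frequency f t}" \<delta> "1 / r"] frequency_zero frequency_diff \<delta> r by auto
  have freq_iff: "frequency f t \<longleftrightarrow> (\<exists>k. t = h0 * real_of_int k)" for t using freqs by blast
  have "frequency f h0" unfolding freq_iff by (intro exI[of _ 1]) simp
  then have red: "reducible_to M E d X \<omega> a A1 f (1 / h0)" using h0 by (simp add: reducible_to_iff_frequency)
  have largest: "s \<le> 1 / h0" if s: "0 < s" "frequency f (1 / s)" for s
  proof -
    obtain k where k: "1 / s = h0 * real_of_int k" using s(2) freq_iff by blast
    have "0 < h0 * real_of_int k" unfolding k[symmetric] using s(1) by simp
    then have "1 \<le> k" using h0 by (simp add: zero_less_mult_iff)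
    then have "h0 * 1 \<le> h0 * real_of_int k" using h0 by (intro mult_left_mono) auto
    then have "h0 \<le> 1 / s" using k by simp
    then show ?thesis using s h0 by (simp add: field_simps)
  qed
  obtain H Z where HZ: "reduction M E d X \<omega> a A1 f (1 / h0) H Z"
    using red unfolding reducible_to_def by blast
  have irreducible: "\<not> int_reducible M E d X \<omega> a A1 Z"
  proof
    assume "int_reducible M E d X \<omega> a A1 Z"
    then obtain h' where h': "1 < h'" "reducible_to M E d X \<omega> a A1 (\<lambda>j x. real_of_int (Z j x)) h'"
      unfolding int_reducible_def by blast
    have "frequency f (1 / (1 / h0 * h'))" using frequency_refine[OF K HZ _ h'(2)] h0 by simp
    then have "1 / h0 * h' \<le> 1 / h0" using h0 h'(1) by (intro largest) auto
    then show False using h0 h'(1) by (simp add: field_simps)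
  qed
  show ?thesis
  proof (rule exI[of _ h0], intro conjI allI impI)
    show "\<exists>h H Z. h \<noteq> 0 \<and> reduction M E d X \<omega> a A1 f h H Z \<and> \<not> int_reducible M E d X \<omega> a A1 Z"
      using h0 HZ irreducible by (intro exI[of _ "1 / h0"]) auto
  qed (use h0 freqs red largest in \<open>auto simp: reduction_freqs_eq reducible_to_iff_frequency\<close>)
qed

end
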